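(* Let $(G_x \mid x \geq 0)$ be a coclass family of finite $p$-groups. Then there exists $x_0 \in \mathbb{N}$ such that the Quillen categories $\mathcal{A}_p(G_x)$ and $\mathcal{A}_p(G_y)$ are equivalent for all $x, y \geq x_0$.
   Context: Cohomology conventions: for a group $G$ acting on the right on an additively written abelian group $M$ (action $m \mapsto m^g$), $Z^n(G,M)$, $B^n(G,M)$, $H^n(G,M)$ denote normalised cocycles, coboundaries and cohomology. For $\tau \in Z^2(G,M)$, $\mathrm{Ext}(\tau)$ is the set $G \times M$ with multiplication $(g,m)(h,n) = (gh, m^h + n + \tau(g,h))$; it is an extension of $G$ by $M \cong \{(1,m)\}$. Setting: $p$ is a prime, $S$ is an infinite pro-$p$-group of finite coclass, and $T = \gamma_\ell(S)$ (a term of the lower central series, $\ell$ large enough) is a translation subgroup: $T \cong \mathbb{Z}_p^d$ ($\mathbb{Z}_p$ the $p$-adic integers), $P := S/T$ is a finite $p$-group, and the series $T_0 = T$, $T_{i+1} = [T_i, S]$ has $[T_i : T_{i+1}] = p$ for all $i$. Write $|P| = p^m$; $T$ is written additively and is a $P$-module via conjugation. Identify $S$ with $\mathrm{Ext}(\rho)$ for some $\rho \in Z^2(P,T)$. Coclass families: put $e = 3m$ and $M_x = T/p^{x+e}T$ for $x \in \mathbb{N}_0$. Let $pro_x : Z^2(P,T) \to Z^2(P,M_x)$ be induced by projection, $I^2(P,M_x)$ its image, and $J^2(P,M_x)$ the image of the map $Z^2(P, p^{x+e-m}T/p^{x+e}T) \to Z^2(P,M_x)$ induced by inclusion. For each $x$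 fix a complement $K^2(P,M_x)$ to $I^2(P,M_x)$ in $Z^2(P,M_x)$ contained in $J^2(P,M_x)$, chosen such that $mul(K^2(P,M_x)) = K^2(P,M_{x+1})$, where $mul$ is induced by $t + p^{x+e}T \mapsto pt + p^{x+e+1}T$ (such choices exist). The composite of the quotient map $Z^2(P,M_x) \to H^2(P,M_x)$, the connecting homomorphism $H^2(P,M_x) \to H^3(P,p^{x+e}T)$ of $0 \to p^{x+e}T \to T \to M_x \to 0$, and the isomorphism $H^3(P,p^{x+e}T) \to H^3(P,T)$ induced by division by $p^{x+e}$, restricts to an isomorphism $K^2(P,M_x) \to H^3(P,T)$. For $\eta \in H^3(P,T)$ let $\eta_x \in K^2(P,M_x)$ be the preimage of $\eta$, let $\rho_x = pro_x(\rho)$, and let $G_x = \mathrm{Ext}(\rho_x + \eta_x)$. The family $(G_x \mid x \in \mathbb{N}_0)$ is the coclass family defined by $\eta$; a coclass family is any family arising in this way. The Quillen category $\mathcal{A}_p(G)$ of a group $G$ has as objects the elementary abelian $p$-subgroups of $G$ and as morphisms $E \to F$ the injective homomorphisms $e \mapsto e^g$ induced by conjugation with elements $g \in G$ satisfying $E^g \leq F$. *)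

theory Defs
  imports "HOL-Algebra.Coset" "HOL-Algebra.Generated_Groups" "HOL-Computational_Algebra.Primes"
begin

text \<open>A p-adic integer is represented by its compatible sequence of residues:
  a n is the residue modulo p^n, in [0, p^n).\<close>
definition Zp :: "nat \<Rightarrow> (nat \<Rightarrow> int) set" where
  "Zp p = {a. \<forall>n. 0 \<le> a n \<and> a n < int p ^ n \<and> a (Suc n) mod int p ^ n = a n}"

definition zp_add :: "nat \<Rightarrow> (nat \<Rightarrow> int) \<Rightarrow> (nat \<Rightarrow> int) \<Rightarrow> (nat \<Rightarrow> int)" where
  "zp_add p a b = (\<lambda>n. (a n + b n) mod int p ^ n)"

definition zp_neg :: "nat \<Rightarrow> (nat \<Rightarrow> int) \<Rightarrow> (nat \<Rightarrow> int)" where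
  "zp_neg p a = (\<lambda>n. (- a n) mod int p ^ n)"

type_synonym zpvec = "nat \<Rightarrow> nat \<Rightarrow> int"   \<comment> \<open>coordinate i, level n\<close>
type_synonym resvec = "nat \<Rightarrow> int"

definition Tvec :: "nat \<Rightarrow> nat \<Rightarrow> zpvec set" where
  "Tvec p d = {v. (\<forall>i<d. v i \<in> Zp p) \<and> (\<forall>i. d \<le> i \<longrightarrow> v i = (\<lambda>n. 0))}"

definition vadd :: "nat \<Rightarrow> zpvec \<Rightarrow> zpvec \<Rightarrow> zpvec" where
  "vadd p v w = (\<lambda>i. zp_add p (v i) (w i))"

definition vneg :: "nat \<Rightarrow> zpvec \<Rightarrow> zpvec" where
  "vneg p v = (\<lambda>i. zp_neg p (v i))"

text \<open>T / p^N T = (Z/p^N)^d, elements represented by residues in [0, p^N).\<close>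
definition Rvec :: "nat \<Rightarrow> nat \<Rightarrow> nat \<Rightarrow> resvec set" where
  "Rvec p d N = {r. (\<forall>i<d. 0 \<le> r i \<and> r i < int p ^ N) \<and> (\<forall>i. d \<le> i \<longrightarrow> r i = 0)}"

definition radd :: "nat \<Rightarrow> nat \<Rightarrow> resvec \<Rightarrow> resvec \<Rightarrow> resvec" where
  "radd p N r s = (\<lambda>i. (r i + s i) mod int p ^ N)"

definition rneg :: "nat \<Rightarrow> nat \<Rightarrow> resvec \<Rightarrow> resvec" where
  "rneg p N r = (\<lambda>i. (- r i) mod int p ^ N)"

definition proj :: "nat \<Rightarrow> zpvec \<Rightarrow> resvec" where
  "proj N v = (\<lambda>i. v i N)"

definition lift :: "nat \<Rightarrow> resvec \<Rightarrow> zpvec" where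
  "lift p r = (\<lambda>i n. r i mod int p ^ n)"

text \<open>Division by p^N of an element of p^N T.\<close>
definition divp :: "nat \<Rightarrow> nat \<Rightarrow> zpvec \<Rightarrow> zpvec" where
  "divp p N v = (\<lambda>i n. v i (n + N) div int p ^ N)"

text \<open>The map T/p^N T \<rightarrow> T/p^(N+1) T induced by t \<mapsto> p t.\<close>
definition rmul :: "nat \<Rightarrow> resvec \<Rightarrow> resvec" where
  "rmul p r = (\<lambda>i. int p * r i)"

record ('g, 'm) pmodule =
  mcarrier :: "'m set"
  madd :: "'m \<Rightarrow> 'm \<Rightarrow> 'm"
  mzero :: "'m"
  mneg :: "'m \<Rightarrow> 'm"
  mact :: "'m \<Rightarrow> 'g \<Rightarrow> 'm"

definition Tmod :: "nat \<Rightarrow> nat \<Rightarrow> ('g \<Rightarrow> zpvec \<Rightarrow> zpvec) \<Rightarrow> ('g, zpvec) pmodule" where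
  "Tmod p d act = \<lparr> mcarrier = Tvec p d, madd = vadd p, mzero = (\<lambda>i n. 0),
                    mneg = vneg p, mact = (\<lambda>v g. act g v) \<rparr>"

definition Rmod :: "nat \<Rightarrow> nat \<Rightarrow> ('g \<Rightarrow> zpvec \<Rightarrow> zpvec) \<Rightarrow> nat \<Rightarrow> ('g, resvec) pmodule" where
  "Rmod p d act N = \<lparr> mcarrier = Rvec p d N, madd = radd p N, mzero = (\<lambda>i. 0),
                      mneg = rneg p N, mact = (\<lambda>r g. proj N (act g (lift p r))) \<rparr>"

text \<open>The submodule p^k T / p^N T of T/p^N T (for k \<le> N).\<close>
definition Rsub :: "nat \<Rightarrow> nat \<Rightarrow> ('g \<Rightarrow> zpvec \<Rightarrow> zpvec) \<Rightarrow> nat \<Rightarrow> nat \<Rightarrow> ('g, resvec) pmodule" where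
  "Rsub p d act N k = (Rmod p d act N)
      \<lparr> mcarrier := {r \<in> Rvec p d N. \<forall>i. int p ^ k dvd r i} \<rparr>"

definition is_pmodule :: "('g, 'c) monoid_scheme \<Rightarrow> ('g, 'm) pmodule \<Rightarrow> bool" where
  "is_pmodule P M \<longleftrightarrow>
     (\<forall>g\<in>carrier P. \<forall>m\<in>mcarrier M. mact M m g \<in> mcarrier M) \<and>
     (\<forall>g\<in>carrier P. \<forall>m\<in>mcarrier M. \<forall>n\<in>mcarrier M.
         mact M (madd M m n) g = madd M (mact M m g) (mact M n g)) \<and>
     (\<forall>m\<in>mcarrier M. mact M m \<one>\<^bsub>P\<^esub> = m) \<and>
     (\<forall>g\<in>carrier P. \<forall>h\<in>carrier P. \<forall>m\<in>mcarrier M.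
         mact M (mact M m g) h = mact M m (g \<otimes>\<^bsub>P\<^esub> h))"

definition cochains :: "('g, 'c) monoid_scheme \<Rightarrow> ('g, 'm) pmodule \<Rightarrow> nat \<Rightarrow> ('g list \<Rightarrow> 'm) set" where
  "cochains P M n = {f.
     (\<forall>xs. length xs = n \<and> set xs \<subseteq> carrier P \<longrightarrow> f xs \<in> mcarrier M) \<and>
     (\<forall>xs. length xs = n \<and> set xs \<subseteq> carrier P \<and> \<one>\<^bsub>P\<^esub> \<in> set xs \<longrightarrow> f xs = mzero M) \<and>
     (\<forall>xs. \<not> (length xs = n \<and> set xs \<subseteq> carrier P) \<longrightarrow> f xs = mzero M)}"

definition msum :: "('g, 'm) pmodule \<Rightarrow> 'm list \<Rightarrow> 'm" where
  "msum M xs = foldr (madd M) xs (mzero M)"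

definition msign :: "('g, 'm) pmodule \<Rightarrow> nat \<Rightarrow> 'm \<Rightarrow> 'm" where
  "msign M k x = (if even k then x else mneg M x)"

definition cobound :: "('g, 'c) monoid_scheme \<Rightarrow> ('g, 'm) pmodule \<Rightarrow> nat \<Rightarrow> ('g list \<Rightarrow> 'm) \<Rightarrow> ('g list \<Rightarrow> 'm)" where
  "cobound P M n f = (\<lambda>xs.
     if length xs = Suc n \<and> set xs \<subseteq> carrier P then
       msum M ([f (tl xs)] @
               map (\<lambda>i. msign M (Suc i)
                      (f (take i xs @ [xs ! i \<otimes>\<^bsub>P\<^esub> xs ! Suc i] @ drop (Suc (Suc i)) xs))) [0..<n] @
               [msign M (Suc n) (mact M (f (butlast xs)) (last xs))])
     else mzero M)"

definition cadd :: "('g, 'm) pmodule \<Rightarrow> ('g list \<Rightarrow> 'm) \<Rightarrow> ('g list \<Rightarrow> 'm) \<Rightarrow> ('g list \<Rightarrow> 'm)" where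
  "cadd M f h = (\<lambda>xs. madd M (f xs) (h xs))"

definition czero :: "('g, 'm) pmodule \<Rightarrow> ('g list \<Rightarrow> 'm)" where
  "czero M = (\<lambda>xs. mzero M)"

definition cocycles :: "('g, 'c) monoid_scheme \<Rightarrow> ('g, 'm) pmodule \<Rightarrow> nat \<Rightarrow> ('g list \<Rightarrow> 'm) set" where
  "cocycles P M n = {f \<in> cochains P M n. cobound P M n f = czero M}"

definition coboundaries :: "('g, 'c) monoid_scheme \<Rightarrow> ('g, 'm) pmodule \<Rightarrow> nat \<Rightarrow> ('g list \<Rightarrow> 'm) set" where
  "coboundaries P M n = (case n of 0 \<Rightarrow> {czero M}
       | Suc k \<Rightarrow> cobound P M k ` cochains P M k)"

definition cohom_class :: "('g, 'c) monoid_scheme \<Rightarrow> ('g, 'm) pmodule \<Rightarrow> nat \<Rightarrow> ('g list \<Rightarrow> 'm) \<Rightarrow> ('g list \<Rightarrow> 'm) set" where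
  "cohom_class P M n f = {h \<in> cocycles P M n. \<exists>b\<in>coboundaries P M n. h = cadd M f b}"

definition cohom :: "('g, 'c) monoid_scheme \<Rightarrow> ('g, 'm) pmodule \<Rightarrow> nat \<Rightarrow> ('g list \<Rightarrow> 'm) set set" where
  "cohom P M n = cohom_class P M n ` cocycles P M n"

definition Ext :: "('g, 'c) monoid_scheme \<Rightarrow> ('g, 'm) pmodule \<Rightarrow> ('g list \<Rightarrow> 'm) \<Rightarrow> ('g \<times> 'm) monoid" where
  "Ext P M \<tau> = \<lparr> carrier = carrier P \<times> mcarrier M,
      monoid.mult = (\<lambda>(g, m) (h, n). (g \<otimes>\<^bsub>P\<^esub> h, madd M (madd M (mact M m h) n) (\<tau> [g, h]))),
      monoid.one = (\<one>\<^bsub>P\<^esub>, mzero M) \<rparr>"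

definition commsub :: "('a, 'b) monoid_scheme \<Rightarrow> 'a set \<Rightarrow> 'a set \<Rightarrow> 'a set" where
  "commsub G A B = generate G
     {inv\<^bsub>G\<^esub> a \<otimes>\<^bsub>G\<^esub> inv\<^bsub>G\<^esub> b \<otimes>\<^bsub>G\<^esub> a \<otimes>\<^bsub>G\<^esub> b | a b. a \<in> A \<and> b \<in> B}"

text \<open>gamma G i = \<gamma>_i(G), with \<gamma>_1(G) = G (and \<gamma>_0(G) := G by convention).\<close>
fun gamma :: "('a, 'b) monoid_scheme \<Rightarrow> nat \<Rightarrow> 'a set" where
  "gamma G 0 = carrier G"
| "gamma G (Suc 0) = carrier G"
| "gamma G (Suc (Suc i)) = commsub G (gamma G (Suc i)) (carrier G)"

fun tseries :: "('a, 'b) monoid_scheme \<Rightarrow> 'a set \<Rightarrow> nat \<Rightarrow> 'a set" where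
  "tseries S T 0 = T"
| "tseries S T (Suc i) = commsub S (tseries S T i) (carrier S)"

definition sindex :: "('a, 'b) monoid_scheme \<Rightarrow> 'a set \<Rightarrow> 'a set \<Rightarrow> nat" where
  "sindex G A B = card ((\<lambda>a. B #>\<^bsub>G\<^esub> a) ` A)"

text \<open>pro_x, mul, and the composite K^2(P,M_x) \<rightarrow> H^3(P,T) (connecting
  homomorphism of 0 \<rightarrow> p^N T \<rightarrow> T \<rightarrow> T/p^N T \<rightarrow> 0 followed by division by p^N),
  where N = x + e.\<close>
definition pro_c :: "nat \<Rightarrow> ('g list \<Rightarrow> zpvec) \<Rightarrow> ('g list \<Rightarrow> resvec)" where
  "pro_c N f = (\<lambda>xs. proj N (f xs))"

definition mul_c :: "nat \<Rightarrow> ('g list \<Rightarrow> resvec) \<Rightarrow> ('g list \<Rightarrow> resvec)" where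
  "mul_c p f = (\<lambda>xs. rmul p (f xs))"

definition conn :: "('g, 'c) monoid_scheme \<Rightarrow> nat \<Rightarrow> nat \<Rightarrow> ('g \<Rightarrow> zpvec \<Rightarrow> zpvec) \<Rightarrow> nat
                     \<Rightarrow> ('g list \<Rightarrow> resvec) \<Rightarrow> ('g list \<Rightarrow> zpvec) set" where
  "conn P p d act N \<tau> = cohom_class P (Tmod p d act) 3
      (\<lambda>xs. divp p N (cobound P (Tmod p d act) 2 (\<lambda>ys. lift p (\<tau> ys)) xs))"

definition coclass_setting ::
  "nat \<Rightarrow> ('g, 'c) monoid_scheme \<Rightarrow> nat \<Rightarrow> nat \<Rightarrow> ('g \<Rightarrow> zpvec \<Rightarrow> zpvec) \<Rightarrow> ('g list \<Rightarrow> zpvec) \<Rightarrow> bool" where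
  "coclass_setting p P m d act \<rho> \<longleftrightarrow>
     prime p \<and> group P \<and> finite (carrier P) \<and> card (carrier P) = p ^ m \<and>
     is_pmodule P (Tmod p d act) \<and>
     \<rho> \<in> cocycles P (Tmod p d act) 2 \<and>
     (let S = Ext P (Tmod p d act) \<rho>; T = {\<one>\<^bsub>P\<^esub>} \<times> Tvec p d in
        (\<exists>l. gamma S l = T) \<and> (\<forall>i. sindex S (tseries S T i) (tseries S T (Suc i)) = p))"

definition complement_choice ::
  "nat \<Rightarrow> ('g, 'c) monoid_scheme \<Rightarrow> nat \<Rightarrow> nat \<Rightarrow> ('g \<Rightarrow> zpvec \<Rightarrow> zpvec)
   \<Rightarrow> (nat \<Rightarrow> ('g list \<Rightarrow> resvec) set) \<Rightarrow> bool" where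
  "complement_choice p P m d act K \<longleftrightarrow>
     (\<forall>x. let N = x + 3 * m; M = Rmod p d act N;
             Z2 = cocycles P M 2;
             I2 = pro_c N ` cocycles P (Tmod p d act) 2;
             J2 = cocycles P (Rsub p d act N (N - m)) 2 in
        K x \<subseteq> Z2 \<and> czero M \<in> K x \<and>
        (\<forall>f\<in>K x. \<forall>h\<in>K x. cadd M f h \<in> K x) \<and>
        (\<forall>f\<in>K x. (\<lambda>xs. mneg M (f xs)) \<in> K x) \<and>
        I2 \<inter> K x = {czero M} \<and>
        (\<forall>z\<in>Z2. \<exists>a\<in>I2. \<exists>k\<in>K x. z = cadd M a k) \<and>
        K x \<subseteq> J2 \<and>
        mul_c p ` K x = K (Suc x))"

text \<open>G x for the coclass family defined by \<eta> \<in> H^3(P,T): here etas x is the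
  preimage \<eta>_x \<in> K^2(P,M_x) of \<eta>.\<close>
definition family_member ::
  "nat \<Rightarrow> ('g, 'c) monoid_scheme \<Rightarrow> nat \<Rightarrow> nat \<Rightarrow> ('g \<Rightarrow> zpvec \<Rightarrow> zpvec) \<Rightarrow> ('g list \<Rightarrow> zpvec)
   \<Rightarrow> (nat \<Rightarrow> ('g list \<Rightarrow> resvec)) \<Rightarrow> nat \<Rightarrow> ('g \<times> resvec) monoid" where
  "family_member p P m d act \<rho> etas x =
     (let N = x + 3 * m; M = Rmod p d act N in Ext P M (cadd M (pro_c N \<rho>) (etas x)))"

record ('o, 'h) category =
  Ob :: "'o set"
  Hom :: "'o \<Rightarrow> 'o \<Rightarrow> 'h set"
  Comp :: "'h \<Rightarrow> 'h \<Rightarrow> 'h"     \<comment> \<open>Comp g f = g \<circ> f\<close>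
  Idm :: "'o \<Rightarrow> 'h"

definition elem_ab_p_subgroup :: "nat \<Rightarrow> ('a, 'b) monoid_scheme \<Rightarrow> 'a set \<Rightarrow> bool" where
  "elem_ab_p_subgroup p G E \<longleftrightarrow> subgroup E G \<and>
     (\<forall>x\<in>E. \<forall>y\<in>E. x \<otimes>\<^bsub>G\<^esub> y = y \<otimes>\<^bsub>G\<^esub> x) \<and> (\<forall>x\<in>E. x [^]\<^bsub>G\<^esub> p = \<one>\<^bsub>G\<^esub>)"

definition quillen :: "nat \<Rightarrow> ('a, 'b) monoid_scheme \<Rightarrow> ('a set, 'a set \<times> 'a set \<times> ('a \<Rightarrow> 'a)) category" where
  "quillen p G = \<lparr> Ob = {E. elem_ab_p_subgroup p G E},
     Hom = (\<lambda>E F. {(E, F, restrict (\<lambda>e. inv\<^bsub>G\<^esub> g \<otimes>\<^bsub>G\<^esub> e \<otimes>\<^bsub>G\<^esub> g) E) | g.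
                     g \<in> carrier G \<and> (\<forall>e\<in>E. inv\<^bsub>G\<^esub> g \<otimes>\<^bsub>G\<^esub> e \<otimes>\<^bsub>G\<^esub> g \<in> F)}),
     Comp = (\<lambda>(F, F', \<psi>) (E, F0, \<phi>). (E, F', restrict (\<psi> \<circ> \<phi>) E)),
     Idm = (\<lambda>E. (E, E, restrict id E)) \<rparr>"

definition is_functor :: "('o1, 'h1, 'x) category_scheme \<Rightarrow> ('o2, 'h2, 'y) category_scheme
                          \<Rightarrow> ('o1 \<Rightarrow> 'o2) \<Rightarrow> ('h1 \<Rightarrow> 'h2) \<Rightarrow> bool" where
  "is_functor C D Fo Fm \<longleftrightarrow>
     (\<forall>a\<in>Ob C. Fo a \<in> Ob D) \<and>
     (\<forall>a\<in>Ob C. \<forall>b\<in>Ob C. \<forall>f\<in>Hom C a b. Fm f \<in> Hom D (Fo a) (Fo b)) \<and>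
     (\<forall>a\<in>Ob C. Fm (Idm C a) = Idm D (Fo a)) \<and>
     (\<forall>a\<in>Ob C. \<forall>b\<in>Ob C. \<forall>c\<in>Ob C. \<forall>f\<in>Hom C a b. \<forall>g\<in>Hom C b c.
         Fm (Comp C g f) = Comp D (Fm g) (Fm f))"

definition is_iso :: "('o, 'h, 'x) category_scheme \<Rightarrow> 'o \<Rightarrow> 'o \<Rightarrow> 'h \<Rightarrow> bool" where
  "is_iso C a b f \<longleftrightarrow> f \<in> Hom C a b \<and>
     (\<exists>g\<in>Hom C b a. Comp C g f = Idm C a \<and> Comp C f g = Idm C b)"

definition is_nat_iso :: "('o1, 'h1, 'x) category_scheme \<Rightarrow> ('o2, 'h2, 'y) category_scheme
    \<Rightarrow> ('o1 \<Rightarrow> 'o2) \<Rightarrow> ('h1 \<Rightarrow> 'h2) \<Rightarrow> ('o1 \<Rightarrow> 'o2) \<Rightarrow> ('h1 \<Rightarrow> 'h2) \<Rightarrow> ('o1 \<Rightarrow> 'h2) \<Rightarrow> bool" where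
  "is_nat_iso C D Fo Fm Go Gm \<alpha> \<longleftrightarrow>
     (\<forall>a\<in>Ob C. is_iso D (Fo a) (Go a) (\<alpha> a)) \<and>
     (\<forall>a\<in>Ob C. \<forall>b\<in>Ob C. \<forall>f\<in>Hom C a b. Comp D (\<alpha> b) (Fm f) = Comp D (Gm f) (\<alpha> a))"

definition cat_equivalent :: "('o1, 'h1, 'x) category_scheme \<Rightarrow> ('o2, 'h2, 'y) category_scheme \<Rightarrow> bool" where
  "cat_equivalent C D \<longleftrightarrow>
     (\<exists>Fo Fm Go Gm \<alpha> \<beta>. is_functor C D Fo Fm \<and> is_functor D C Go Gm \<and>
        is_nat_iso C C id id (Go \<circ> Fo) (Gm \<circ> Fm) \<alpha> \<and>
        is_nat_iso D D id id (Fo \<circ> Go) (Fm \<circ> Gm) \<beta>)"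

end

theory Submission
  imports Defs "HOL-Algebra.FiniteProduct"
begin

text \<open>
All members \<open>G x\<close> of the family with \<open>x \<ge> k\<close> are quotients of one group
\<open>\<Gamma>\<close>, the extension of \<open>P\<close> by \<open>T \<times> M\<close> with
\<open>M = T / p ^ (k + e) T\<close> and cocycle \<open>(\<rho>, \<eta>\<^sub>k)\<close>: since
\<open>\<eta>\<^sub>x = p ^ (x - k) \<eta>\<^sub>k\<close>, the map
\<open>(g, t, w) \<mapsto> (g, t + p ^ (x - k) w)\<close> is a surjection onto \<open>G x\<close>. Its kernel
\<open>{(1, - p ^ (x - k) t, t mod p ^ (k + e))}\<close> is isomorphic to \<open>T\<close>, hence torsion free.
The elementary abelian subgroups \<open>E\<close> of \<open>G x\<close> have order dividing \<open>p ^ k\<close>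
if \<open>k \<ge> m + d\<close>. They lift to \<open>\<Gamma>\<close>, because the obstruction in
\<open>H\<^sup>2(E, T)\<close> is a multiple of \<open>p ^ k\<close>, and \<open>|E|\<close> kills the cohomology. Whether
two subgroups of \<open>\<Gamma>\<close> become conjugate in \<open>G x\<close> does not depend on \<open>x\<close>
either: passing from \<open>x\<close> to \<open>y\<close> changes the \<open>T\<close>-component of the discrepancy, a
1-cocycle, by a multiple of \<open>p ^ (y - k) - p ^ (x - k)\<close>, which is a coboundary.
\<close>

section \<open>Quillen categories of two quotients of one group\<close>

text \<open>Members of the family are not compared by a homomorphism between them: each functor uses
  one chosen lift to \<Gamma> for every elementary abelian subgroup, and lifts are not unique, so
  the comparison is an equivalence. The factor M of \<Gamma> makes the obstruction visible: for the
  section with M-component 0, the T-valued factor set reduces to \<open>\<eta>_k\<close> modulo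
  p^(k+e), and it is divisible by p^k because \<open>\<eta>_k = p^k \<eta>_0\<close>. That identity
  comes from the complements: \<open>mul\<close> maps K into the next K and respects the normalised
  connecting map, which is injective on K. The exponent m + d bounds the orders of elementary
  abelian subgroups E: the image in P has at most p^m elements, and the p-torsion of (Z/p^N)^d at
  most p^d, whatever N is. Torsion-freeness of T enters twice. The kernels contain no element of
  order p, so elementary abelian subgroups of \<Gamma> embed into every quotient; and a cocycle
  identity known for |E| z holds for z. Averaging exhibits exactly |E| z as a coboundary, so T never
  has to be divided by |E|.\<close>

definition conj_map :: "('a, 'b) monoid_scheme \<Rightarrow> 'a set \<Rightarrow> 'a set \<Rightarrow> ('a \<Rightarrow> 'a) \<Rightarrow> bool" where
  "conj_map G E F f \<longleftrightarrow>
     f \<in> E \<rightarrow> F \<and> (\<exists>g\<in>carrier G. \<forall>e\<in>E. e \<otimes>\<^bsub>G\<^esub> g = g \<otimes>\<^bsub>G\<^esub> f e)"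

lemma quillen_simps [simp]:
  "Ob (quillen p G) = {E. elem_ab_p_subgroup p G E}"
  "Comp (quillen p G) (F, F', \<psi>) (E, F0, \<phi>) = (E, F', restrict (\<psi> \<circ> \<phi>) E)"
  "Idm (quillen p G) E = (E, E, restrict id E)"
  by (simp_all add: quillen_def)

lemma elem_ab_p_subgroupD:
  assumes "elem_ab_p_subgroup p G E"
  shows "subgroup E G" "E \<subseteq> carrier G"
  using assms subgroup.subset by (auto simp: elem_ab_p_subgroup_def)

context group
begin

lemma conj_eq_iff:
  assumes "g \<in> carrier G" "e \<in> carrier G" "y \<in> carrier G"
  shows "inv g \<otimes> e \<otimes> g = y \<longleftrightarrow> e \<otimes> g = g \<otimes> y"
  using assms by (metis inv_closed inv_solve_left m_assoc m_closed)

text \<open>Conjugation is expressed by \<open>e \<otimes> g = g \<otimes> f e\<close>, with no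
  inverse, so that the equation passes easily through homomorphisms and lifts. The values of
  \<open>f\<close> off \<open>E\<close> are arbitrary; \<open>restrict\<close> erases them from the
  morphism.\<close>

lemma quillen_Hom_iff:
  assumes "E \<subseteq> carrier G" "F \<subseteq> carrier G"
  shows "h \<in> Hom (quillen p G) E F \<longleftrightarrow>
           (\<exists>f. h = (E, F, restrict f E) \<and> conj_map G E F f)"
proof
  assume "h \<in> Hom (quillen p G) E F"
  then obtain g where g: "g \<in> carrier G" "\<forall>e\<in>E. inv g \<otimes> e \<otimes> g \<in> F"
      and h: "h = (E, F, restrict (\<lambda>e. inv g \<otimes> e \<otimes> g) E)"
    by (auto simp: quillen_def)
  have "conj_map G E F (\<lambda>e. inv g \<otimes> e \<otimes> g)"
    unfolding conj_map_def using g assms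
    by (auto intro!: bexI[of _ g] simp: m_assoc[symmetric] subset_iff)
  then show "\<exists>f. h = (E, F, restrict f E) \<and> conj_map G E F f"
    using h by blast
next
  assume "\<exists>f. h = (E, F, restrict f E) \<and> conj_map G E F f"
  then obtain f g where h: "h = (E, F, restrict f E)" and f: "f \<in> E \<rightarrow> F"
      and g: "g \<in> carrier G" "\<forall>e\<in>E. e \<otimes> g = g \<otimes> f e"
    by (auto simp: conj_map_def)
  have eq: "inv g \<otimes> e \<otimes> g = f e" if "e \<in> E" for e
    using that g f assms by (subst conj_eq_iff) (auto simp: Pi_iff subset_iff)
  then have "restrict f E = restrict (\<lambda>e. inv g \<otimes> e \<otimes> g) E"
    by (intro restrict_ext) simp
  moreover have "\<forall>e\<in>E. inv g \<otimes> e \<otimes> g \<in> F"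
    using eq f by auto
  ultimately show "h \<in> Hom (quillen p G) E F"
    using g h by (auto simp: quillen_def)
qed

lemma conj_map_inv_into:
  assumes "E \<subseteq> carrier G" "F \<subseteq> carrier G" "conj_map G E F f" "bij_betw f E F"
  shows "conj_map G F E (inv_into E f)"
proof -
  obtain g where g: "g \<in> carrier G" "\<forall>e\<in>E. e \<otimes> g = g \<otimes> f e"
    using assms(3) by (auto simp: conj_map_def)
  have "y \<otimes> inv g = inv g \<otimes> inv_into E f y" if "y \<in> F" for y
  proof -
    define e where "e = inv_into E f y"
    have e: "e \<in> E" "f e = y"
      using that assms(4) unfolding e_def
      by (auto simp: bij_betw_def inv_into_into f_inv_into_f)
    have c: "e \<in> carrier G" "y \<in> carrier G" using e that assms(1,2) by auto
    have "inv g \<otimes> e \<otimes> g = y" using conj_eq_iff[OF g(1) c] g(2) e by auto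
    then show ?thesis
      using c g(1) unfolding e_def[symmetric] by (metis inv_closed inv_solve_right m_closed)
  qed
  moreover have "inv_into E f \<in> F \<rightarrow> E"
    using assms(4) by (auto simp: bij_betw_def inv_into_into)
  ultimately show ?thesis
    unfolding conj_map_def using g(1) by blast
qed

text \<open>Conjugation by \<open>inv g\<close> undoes conjugation by \<open>g\<close>, so a
  conjugation that maps onto \<open>F\<close> is invertible in the category.\<close>

lemma quillen_is_iso:
  assumes "E \<subseteq> carrier G" "F \<subseteq> carrier G" "conj_map G E F f" "bij_betw f E F"
  shows "is_iso (quillen p G) E F (E, F, restrict f E)"
proof -
  let ?g = "inv_into E f"
  have fE: "f e \<in> F" "?g (f e) = e" if "e \<in> E" for e
    using that assms(4) by (auto simp: bij_betw_def)
  have gF: "?g y \<in> E" "f (?g y) = y" if "y \<in> F" for y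
    using that assms(4) by (auto simp: bij_betw_def inv_into_into f_inv_into_f)
  have "(F, E, restrict ?g F) \<in> Hom (quillen p G) F E"
    using quillen_Hom_iff[OF assms(2,1)] conj_map_inv_into[OF assms] by blast
  moreover have "(E, F, restrict f E) \<in> Hom (quillen p G) E F"
    using quillen_Hom_iff[OF assms(1,2)] assms(3) by blast
  moreover have "Comp (quillen p G) (F, E, restrict ?g F) (E, F, restrict f E) = Idm (quillen p G) E"
    using fE by (auto simp: fun_eq_iff)
  moreover have "Comp (quillen p G) (E, F, restrict f E) (F, E, restrict ?g F) = Idm (quillen p G) F"
    using gF by (auto simp: fun_eq_iff)
  ultimately show ?thesis
    unfolding is_iso_def by blast
qed

end

text \<open>The family is indexed by subgroups because lifts are chosen for each subgroup separately
  and need not be compatible with inclusions: the value on an element may depend on the subgroup in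
  which it is considered.\<close>

definition transport_map ::
  "('a set \<Rightarrow> 'a \<Rightarrow> 'b) \<Rightarrow> 'a set \<times> 'a set \<times> ('a \<Rightarrow> 'a) \<Rightarrow> 'b set \<times> 'b set \<times> ('b \<Rightarrow> 'b)" where
  "transport_map \<theta> = (\<lambda>(E, F, f).
     (\<theta> E ` E, \<theta> F ` F, restrict (\<lambda>b. \<theta> F (f (inv_into E (\<theta> E) b))) (\<theta> E ` E)))"

text \<open>Composition is preserved because the bijections at the middle object cancel. The content
  lies in hypothesis \<open>conj\<close>: the transported maps again come from group
  elements.\<close>

lemma transport_functor:
  assumes G: "group G" and H: "group H"
    and ob: "\<And>E. elem_ab_p_subgroup p G E \<Longrightarrow> elem_ab_p_subgroup p H (\<theta> E ` E)"
    and inj: "\<And>E. elem_ab_p_subgroup p G E \<Longrightarrow> inj_on (\<theta> E) E"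
    and conj: "\<And>E F f. elem_ab_p_subgroup p G E \<Longrightarrow> elem_ab_p_subgroup p G F \<Longrightarrow>
       conj_map G E F f \<Longrightarrow>
       conj_map H (\<theta> E ` E) (\<theta> F ` F) (\<lambda>b. \<theta> F (f (inv_into E (\<theta> E) b)))"
  shows "is_functor (quillen p G) (quillen p H) (\<lambda>E. \<theta> E ` E) (transport_map \<theta>)"
  unfolding is_functor_def
proof (intro conjI ballI)
  fix E assume "E \<in> Ob (quillen p G)"
  then have E: "elem_ab_p_subgroup p G E" by simp
  show "\<theta> E ` E \<in> Ob (quillen p H)" using ob[OF E] by simp
  show "transport_map \<theta> (Idm (quillen p G) E) = Idm (quillen p H) (\<theta> E ` E)"
    using inj[OF E] by (auto simp: transport_map_def fun_eq_iff)
next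
  fix E F h
  assume "E \<in> Ob (quillen p G)" "F \<in> Ob (quillen p G)" and h: "h \<in> Hom (quillen p G) E F"
  then have E: "elem_ab_p_subgroup p G E" and F: "elem_ab_p_subgroup p G F" by simp_all
  obtain f where f: "h = (E, F, restrict f E)" "conj_map G E F f"
    using h group.quillen_Hom_iff[OF G] E F elem_ab_p_subgroupD by metis
  have "transport_map \<theta> h
      = (\<theta> E ` E, \<theta> F ` F, restrict (\<lambda>b. \<theta> F (f (inv_into E (\<theta> E) b))) (\<theta> E ` E))"
    using inj[OF E] by (auto simp: transport_map_def f(1) fun_eq_iff)
  then show "transport_map \<theta> h \<in> Hom (quillen p H) (\<theta> E ` E) (\<theta> F ` F)"
    using group.quillen_Hom_iff[OF H elem_ab_p_subgroupD(2)[OF ob[OF E]]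
        elem_ab_p_subgroupD(2)[OF ob[OF F]]] conj[OF E F f(2)]
    by blast
next
  fix A B C f g
  assume "A \<in> Ob (quillen p G)" "B \<in> Ob (quillen p G)" "C \<in> Ob (quillen p G)"
    and f: "f \<in> Hom (quillen p G) A B" and g: "g \<in> Hom (quillen p G) B C"
  then have A: "elem_ab_p_subgroup p G A" and B: "elem_ab_p_subgroup p G B"
    and C: "elem_ab_p_subgroup p G C" by simp_all
  obtain f' where f': "f = (A, B, restrict f' A)" "conj_map G A B f'"
    using f group.quillen_Hom_iff[OF G] A B elem_ab_p_subgroupD by metis
  obtain g' where g': "g = (B, C, restrict g' B)"
    using g group.quillen_Hom_iff[OF G] B C elem_ab_p_subgroupD by metis
  have "f' a \<in> B" if "a \<in> A" for a using f'(2) that by (auto simp: conj_map_def)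
  then show "transport_map \<theta> (Comp (quillen p G) g f)
      = Comp (quillen p H) (transport_map \<theta> g) (transport_map \<theta> f)"
    using inj[OF A] inj[OF B] by (auto simp: transport_map_def f'(1) g' fun_eq_iff)
qed

text \<open>The component at \<open>E\<close> is the round trip to \<open>H\<close> and back.
  Naturality is formal, since transport in both directions conjugates by exactly this map; that the
  component is a morphism at all is hypothesis \<open>conj\<close>.\<close>

lemma transport_nat_iso:
  assumes G: "group G"
    and ob: "\<And>E. elem_ab_p_subgroup p G E \<Longrightarrow> elem_ab_p_subgroup p H (\<theta> E ` E)"
    and ob': "\<And>E. elem_ab_p_subgroup p H E \<Longrightarrow> elem_ab_p_subgroup p G (\<theta>' E ` E)"
    and inj: "\<And>E. elem_ab_p_subgroup p G E \<Longrightarrow> inj_on (\<theta> E) E"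
    and inj': "\<And>E. elem_ab_p_subgroup p H E \<Longrightarrow> inj_on (\<theta>' E) E"
    and conj: "\<And>E. elem_ab_p_subgroup p G E \<Longrightarrow>
       conj_map G E (\<theta>' (\<theta> E ` E) ` \<theta> E ` E) (\<lambda>e. \<theta>' (\<theta> E ` E) (\<theta> E e))"
  shows "is_nat_iso (quillen p G) (quillen p G) id id
      ((\<lambda>E. \<theta>' E ` E) \<circ> (\<lambda>E. \<theta> E ` E)) (transport_map \<theta>' \<circ> transport_map \<theta>)
      (\<lambda>E. (E, \<theta>' (\<theta> E ` E) ` \<theta> E ` E, restrict (\<lambda>e. \<theta>' (\<theta> E ` E) (\<theta> E e)) E))"
  unfolding is_nat_iso_def
proof (intro conjI ballI)
  fix E assume "E \<in> Ob (quillen p G)"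
  then have E: "elem_ab_p_subgroup p G E" by simp
  have "bij_betw (\<lambda>e. \<theta>' (\<theta> E ` E) (\<theta> E e)) E (\<theta>' (\<theta> E ` E) ` \<theta> E ` E)"
    using inj[OF E] inj'[OF ob[OF E]] by (auto simp: bij_betw_def inj_on_def image_image)
  then show "is_iso (quillen p G) (id E) (((\<lambda>E. \<theta>' E ` E) \<circ> (\<lambda>E. \<theta> E ` E)) E)
      (E, \<theta>' (\<theta> E ` E) ` \<theta> E ` E, restrict (\<lambda>e. \<theta>' (\<theta> E ` E) (\<theta> E e)) E)"
    using group.quillen_is_iso[OF G _ _ conj[OF E]] elem_ab_p_subgroupD(2)[OF E]
      elem_ab_p_subgroupD(2)[OF ob'[OF ob[OF E]]] by simp
next
  fix A B h
  assume "A \<in> Ob (quillen p G)" "B \<in> Ob (quillen p G)" and h: "h \<in> Hom (quillen p G) A B"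
  then have A: "elem_ab_p_subgroup p G A" and B: "elem_ab_p_subgroup p G B" by simp_all
  obtain f where f: "h = (A, B, restrict f A)" "conj_map G A B f"
    using h group.quillen_Hom_iff[OF G] A B elem_ab_p_subgroupD by metis
  have "f a \<in> B" if "a \<in> A" for a using f(2) that by (auto simp: conj_map_def)
  then show "Comp (quillen p G)
      (B, \<theta>' (\<theta> B ` B) ` \<theta> B ` B, restrict (\<lambda>e. \<theta>' (\<theta> B ` B) (\<theta> B e)) B) (id h)
    = Comp (quillen p G) ((transport_map \<theta>' \<circ> transport_map \<theta>) h)
      (A, \<theta>' (\<theta> A ` A) ` \<theta> A ` A, restrict (\<lambda>e. \<theta>' (\<theta> A ` A) (\<theta> A e)) A)"
    using inj[OF A] inj'[OF ob[OF A]]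
    by (auto simp: transport_map_def f(1) fun_eq_iff)
qed

section \<open>Comparing two quotients through chosen lifts to a common cover\<close>

lemma elem_ab_p_subgroup_hom_image:
  assumes "group G" "group H" "f \<in> hom G H" "elem_ab_p_subgroup p G L"
  shows "elem_ab_p_subgroup p H (f ` L)"
proof -
  interpret h: group_hom G H f
    using assms by (simp add: group_hom_def group_hom_axioms_def)
  have sub: "subgroup L G" and L: "L \<subseteq> carrier G"
    using elem_ab_p_subgroupD[OF assms(4)] by auto
  have comm: "x \<otimes>\<^bsub>G\<^esub> y = y \<otimes>\<^bsub>G\<^esub> x" "x [^]\<^bsub>G\<^esub> p = \<one>\<^bsub>G\<^esub>" if "x \<in> L" "y \<in> L" for x y
    using that assms(4) by (auto simp: elem_ab_p_subgroup_def)
  have "f x \<otimes>\<^bsub>H\<^esub> f y = f y \<otimes>\<^bsub>H\<^esub> f x" if "x \<in> L" "y \<in> L" for x y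
    using comm(1)[OF that] that L by (metis h.hom_mult subsetD)
  moreover have "f x [^]\<^bsub>H\<^esub> p = \<one>\<^bsub>H\<^esub>" if "x \<in> L" for x
    using comm(2)[OF that that] that L by (metis h.hom_nat_pow h.hom_one subsetD)
  ultimately show ?thesis
    using h.subgroup_img_is_subgroup[OF sub] by (auto simp: elem_ab_p_subgroup_def)
qed

text \<open>\<open>\<theta> E\<close> climbs from \<open>E\<close> to the chosen lift
  \<open>\<sigma> E\<close> by the inverse of \<open>\<pi>\<close> and descends by
  \<open>\<psi>\<close>. A morphism is first moved to the lifts, where \<open>conj\<close> trades a
  conjugating element of \<open>G\<close> for one of \<open>H\<close>.\<close>

lemma cover_transport:
  assumes injG: "\<forall>L. elem_ab_p_subgroup p \<Gamma> L \<longrightarrow> inj_on \<pi> L"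
    and injH: "\<forall>L. elem_ab_p_subgroup p \<Gamma> L \<longrightarrow> inj_on \<psi> L"
    and conj: "\<forall>L L' \<phi>. elem_ab_p_subgroup p \<Gamma> L \<longrightarrow> elem_ab_p_subgroup p \<Gamma> L' \<longrightarrow> \<phi> \<in> L \<rightarrow> L' \<longrightarrow>
      (\<exists>g\<in>carrier G. \<forall>e\<in>L. \<pi> e \<otimes>\<^bsub>G\<^esub> g = g \<otimes>\<^bsub>G\<^esub> \<pi> (\<phi> e)) \<longleftrightarrow>
      (\<exists>h\<in>carrier H. \<forall>e\<in>L. \<psi> e \<otimes>\<^bsub>H\<^esub> h = h \<otimes>\<^bsub>H\<^esub> \<psi> (\<phi> e))"
    and \<sigma>: "\<forall>E. elem_ab_p_subgroup p G E \<longrightarrow> elem_ab_p_subgroup p \<Gamma> (\<sigma> E) \<and> \<pi> ` \<sigma> E = E"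
  defines "\<theta> \<equiv> \<lambda>E a. \<psi> (inv_into (\<sigma> E) \<pi> a)"
  shows "elem_ab_p_subgroup p G E \<Longrightarrow> \<theta> E ` E = \<psi> ` \<sigma> E"
    and "elem_ab_p_subgroup p G E \<Longrightarrow> inj_on (\<theta> E) E"
    and "elem_ab_p_subgroup p G E \<Longrightarrow> elem_ab_p_subgroup p G F \<Longrightarrow> conj_map G E F f \<Longrightarrow>
       conj_map H (\<theta> E ` E) (\<theta> F ` F) (\<lambda>b. \<theta> F (f (inv_into E (\<theta> E) b)))"
proof -
  have bij: "bij_betw (inv_into (\<sigma> E) \<pi>) E (\<sigma> E)" if "elem_ab_p_subgroup p G E" for E
    using \<sigma>[rule_format, OF that] injG[rule_format, of "\<sigma> E"] by (metis bij_betw_def bij_betw_inv_into)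
  show im: "\<theta> E ` E = \<psi> ` \<sigma> E" if "elem_ab_p_subgroup p G E" for E
    using bij[OF that] unfolding \<theta>_def by (auto simp: bij_betw_def image_image[symmetric])
  show inj: "inj_on (\<theta> E) E" if "elem_ab_p_subgroup p G E" for E
    using comp_inj_on[of "inv_into (\<sigma> E) \<pi>" E \<psi>] bij[OF that] injH \<sigma>[rule_format, OF that]
    unfolding \<theta>_def by (simp add: bij_betw_def comp_def)
  assume E: "elem_ab_p_subgroup p G E" and F: "elem_ab_p_subgroup p G F"
    and f: "conj_map G E F f"
  \<comment> \<open>The morphism moved to the chosen lifts. It is only a map of sets between them
    and need not be a conjugation inside \<Gamma>.\<close>
  let ?\<phi> = "\<lambda>l. inv_into (\<sigma> F) \<pi> (f (\<pi> l))"
  have \<pi>E: "\<pi> l \<in> E" if "l \<in> \<sigma> E" for l using that \<sigma>[rule_format, OF E] by auto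
  have fF: "f a \<in> F" if "a \<in> E" for a using that f by (auto simp: conj_map_def)
  have \<pi>\<phi>: "\<pi> (?\<phi> l) = f (\<pi> l)" if "l \<in> \<sigma> E" for l
    using fF[OF \<pi>E[OF that]] \<sigma>[rule_format, OF F] by (metis f_inv_into_f)
  have \<phi>: "?\<phi> \<in> \<sigma> E \<rightarrow> \<sigma> F"
    using fF \<pi>E \<sigma>[rule_format, OF F] by (intro Pi_I inv_into_into) simp
  have "\<exists>g\<in>carrier G. \<forall>e\<in>\<sigma> E. \<pi> e \<otimes>\<^bsub>G\<^esub> g = g \<otimes>\<^bsub>G\<^esub> \<pi> (?\<phi> e)"
    using f \<pi>E \<pi>\<phi> unfolding conj_map_def by metis
  then obtain h where h: "h \<in> carrier H" "\<forall>e\<in>\<sigma> E. \<psi> e \<otimes>\<^bsub>H\<^esub> h = h \<otimes>\<^bsub>H\<^esub> \<psi> (?\<phi> e)"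
    using conj[rule_format, OF _ _ \<phi>] \<sigma>[rule_format, OF E] \<sigma>[rule_format, OF F] by blast
  have inv\<theta>: "inv_into E (\<theta> E) (\<psi> l) = \<pi> l" if "l \<in> \<sigma> E" for l
  proof (rule inv_into_f_eq[OF inj[OF E] \<pi>E[OF that]])
    show "\<theta> E (\<pi> l) = \<psi> l" using that \<sigma>[rule_format, OF E] injG unfolding \<theta>_def by simp
  qed
  have "\<theta> F (f (inv_into E (\<theta> E) (\<psi> l))) = \<psi> (?\<phi> l)" if "l \<in> \<sigma> E" for l
    unfolding inv\<theta>[OF that] by (simp add: \<theta>_def)
  then show "conj_map H (\<theta> E ` E) (\<theta> F ` F) (\<lambda>b. \<theta> F (f (inv_into E (\<theta> E) b)))"
    unfolding im[OF E] im[OF F] conj_map_def using h \<phi> by (auto simp: Pi_iff)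
qed

text \<open>Two lifts with the same image in \<open>H\<close> are matched elementwise by a map that
  the identity of \<open>H\<close> conjugates; \<open>conj\<close> turns this into a conjugating
  element of \<open>G\<close>.\<close>

lemma cover_round_trip:
  assumes H: "group H"
    and injG: "\<forall>L. elem_ab_p_subgroup p \<Gamma> L \<longrightarrow> inj_on \<pi> L"
    and injH: "\<forall>L. elem_ab_p_subgroup p \<Gamma> L \<longrightarrow> inj_on \<psi> L"
    and conj: "\<forall>L L' \<phi>. elem_ab_p_subgroup p \<Gamma> L \<longrightarrow> elem_ab_p_subgroup p \<Gamma> L' \<longrightarrow> \<phi> \<in> L \<rightarrow> L' \<longrightarrow>
      (\<exists>g\<in>carrier G. \<forall>e\<in>L. \<pi> e \<otimes>\<^bsub>G\<^esub> g = g \<otimes>\<^bsub>G\<^esub> \<pi> (\<phi> e)) \<longleftrightarrow>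
      (\<exists>h\<in>carrier H. \<forall>e\<in>L. \<psi> e \<otimes>\<^bsub>H\<^esub> h = h \<otimes>\<^bsub>H\<^esub> \<psi> (\<phi> e))"
    and \<psi>: "\<psi> \<in> hom \<Gamma> H"
    and L: "elem_ab_p_subgroup p \<Gamma> L" and L': "elem_ab_p_subgroup p \<Gamma> L'" and eq: "\<psi> ` L = \<psi> ` L'"
  defines "f \<equiv> \<lambda>a. \<pi> (inv_into L' \<psi> (\<psi> (inv_into L \<pi> a)))"
  shows "conj_map G (\<pi> ` L) (f ` \<pi> ` L) f"
proof -
  interpret H: group H by (rule H)
  let ?\<phi> = "\<lambda>l. inv_into L' \<psi> (\<psi> l)"
  have \<psi>\<phi>: "?\<phi> l \<in> L'" "\<psi> (?\<phi> l) = \<psi> l" if "l \<in> L" for l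
    using that eq by (auto intro!: inv_into_into f_inv_into_f simp: set_eq_iff image_iff)
  have "\<psi> l \<in> carrier H" if "l \<in> L" for l
    using that elem_ab_p_subgroupD(2)[OF L] \<psi> by (auto simp: hom_def)
  then have "\<exists>h\<in>carrier H. \<forall>e\<in>L. \<psi> e \<otimes>\<^bsub>H\<^esub> h = h \<otimes>\<^bsub>H\<^esub> \<psi> (?\<phi> e)"
    using \<psi>\<phi> by (auto intro!: bexI[of _ "\<one>\<^bsub>H\<^esub>"])
  then obtain g where "g \<in> carrier G" "\<forall>e\<in>L. \<pi> e \<otimes>\<^bsub>G\<^esub> g = g \<otimes>\<^bsub>G\<^esub> \<pi> (?\<phi> e)"
    using conj[rule_format, OF L L', of ?\<phi>] \<psi>\<phi> by auto
  then show ?thesis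
    using injG[rule_format, OF L] by (auto simp: conj_map_def f_def)
qed

text \<open>The chosen lifts to the common cover carry the category of one quotient to that of the
  other; a subgroup and its image after going back and forth have two lifts with the same image
  in the second group, which makes them conjugate in the first.\<close>
lemma quillen_equivalent_of_cover:
  fixes \<Gamma> :: "('c, 'x) monoid_scheme" and G :: "('a, 'y) monoid_scheme"
    and H :: "('b, 'z) monoid_scheme"
  assumes \<Gamma>: "group \<Gamma>" and G: "group G" and H: "group H"
    and \<pi>: "\<pi> \<in> hom \<Gamma> G" and \<psi>: "\<psi> \<in> hom \<Gamma> H"
    and liftG: "\<And>E. elem_ab_p_subgroup p G E \<Longrightarrow> \<exists>L. elem_ab_p_subgroup p \<Gamma> L \<and> \<pi> ` L = E"
    and liftH: "\<And>E. elem_ab_p_subgroup p H E \<Longrightarrow> \<exists>L. elem_ab_p_subgroup p \<Gamma> L \<and> \<psi> ` L = E"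
    and injG: "\<forall>L. elem_ab_p_subgroup p \<Gamma> L \<longrightarrow> inj_on \<pi> L"
    and injH: "\<forall>L. elem_ab_p_subgroup p \<Gamma> L \<longrightarrow> inj_on \<psi> L"
    and conj: "\<forall>L L' \<phi>. elem_ab_p_subgroup p \<Gamma> L \<longrightarrow> elem_ab_p_subgroup p \<Gamma> L' \<longrightarrow> \<phi> \<in> L \<rightarrow> L' \<longrightarrow>
      (\<exists>g\<in>carrier G. \<forall>e\<in>L. \<pi> e \<otimes>\<^bsub>G\<^esub> g = g \<otimes>\<^bsub>G\<^esub> \<pi> (\<phi> e)) \<longleftrightarrow>
      (\<exists>h\<in>carrier H. \<forall>e\<in>L. \<psi> e \<otimes>\<^bsub>H\<^esub> h = h \<otimes>\<^bsub>H\<^esub> \<psi> (\<phi> e))"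
  shows "cat_equivalent (quillen p G) (quillen p H)"
proof -
  have imG: "elem_ab_p_subgroup p G (\<pi> ` L)" if L: "elem_ab_p_subgroup p \<Gamma> L" for L
    using elem_ab_p_subgroup_hom_image[OF \<Gamma> G \<pi> L] .
  have imH: "elem_ab_p_subgroup p H (\<psi> ` L)" if L: "elem_ab_p_subgroup p \<Gamma> L" for L
    using elem_ab_p_subgroup_hom_image[OF \<Gamma> H \<psi> L] .
  obtain \<sigma> where \<sigma>: "\<forall>E. elem_ab_p_subgroup p G E \<longrightarrow> elem_ab_p_subgroup p \<Gamma> (\<sigma> E) \<and> \<pi> ` \<sigma> E = E"
    using liftG by metis
  obtain \<sigma>' where \<sigma>': "\<forall>E. elem_ab_p_subgroup p H E \<longrightarrow> elem_ab_p_subgroup p \<Gamma> (\<sigma>' E) \<and> \<psi> ` \<sigma>' E = E"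
    using liftH by metis
  define \<theta> where "\<theta> E a = \<psi> (inv_into (\<sigma> E) \<pi> a)" for E a
  define \<theta>' where "\<theta>' E b = \<pi> (inv_into (\<sigma>' E) \<psi> b)" for E b
  have conj': "\<forall>L L' \<phi>. elem_ab_p_subgroup p \<Gamma> L \<longrightarrow> elem_ab_p_subgroup p \<Gamma> L' \<longrightarrow> \<phi> \<in> L \<rightarrow> L' \<longrightarrow>
      (\<exists>h\<in>carrier H. \<forall>e\<in>L. \<psi> e \<otimes>\<^bsub>H\<^esub> h = h \<otimes>\<^bsub>H\<^esub> \<psi> (\<phi> e)) \<longleftrightarrow>
      (\<exists>g\<in>carrier G. \<forall>e\<in>L. \<pi> e \<otimes>\<^bsub>G\<^esub> g = g \<otimes>\<^bsub>G\<^esub> \<pi> (\<phi> e))"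
    using conj by simp
  note one = cover_transport[OF injG injH conj \<sigma>, folded \<theta>_def]
  note two = cover_transport[OF injH injG conj' \<sigma>', folded \<theta>'_def]
  have im: "\<theta> E ` E = \<psi> ` \<sigma> E" if "elem_ab_p_subgroup p G E" for E
    using one(1)[OF that] .
  have im': "\<theta>' E ` E = \<pi> ` \<sigma>' E" if "elem_ab_p_subgroup p H E" for E
    using two(1)[OF that] .
  have ob: "elem_ab_p_subgroup p H (\<theta> E ` E)" if "elem_ab_p_subgroup p G E" for E
    unfolding im[OF that] using imH \<sigma>[rule_format, OF that] by blast
  have ob': "elem_ab_p_subgroup p G (\<theta>' E ` E)" if "elem_ab_p_subgroup p H E" for E
    unfolding im'[OF that] using imG \<sigma>'[rule_format, OF that] by blast
  have round_trip: "conj_map G E (\<theta>' (\<theta> E ` E) ` \<theta> E ` E) (\<lambda>e. \<theta>' (\<theta> E ` E) (\<theta> E e))"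
    if E: "elem_ab_p_subgroup p G E" for E
  proof -
    \<comment> \<open>The lift of \<open>E\<close> along \<pi> and the lift chosen along \<psi> for
      its image in \<open>H\<close> may be different subgroups of \<Gamma>, but their images in
      \<open>H\<close> agree.\<close>
    note L = \<sigma>[rule_format, OF E] \<sigma>'[rule_format, OF ob[OF E]]
    have "\<psi> ` \<sigma> E = \<psi> ` \<sigma>' (\<theta> E ` E)" using L(2) im[OF E] by metis
    from cover_round_trip[OF H injG injH conj \<psi> conjunct1[OF L(1)] conjunct1[OF L(2)] this,
        folded \<theta>_def \<theta>'_def]
    show ?thesis unfolding conjunct2[OF L(1)] by (simp add: image_image)
  qed
  have round_trip': "conj_map H E (\<theta> (\<theta>' E ` E) ` \<theta>' E ` E) (\<lambda>e. \<theta> (\<theta>' E ` E) (\<theta>' E e))"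
    if E: "elem_ab_p_subgroup p H E" for E
  proof -
    note L = \<sigma>'[rule_format, OF E] \<sigma>[rule_format, OF ob'[OF E]]
    have "\<pi> ` \<sigma>' E = \<pi> ` \<sigma> (\<theta>' E ` E)" using L(2) im'[OF E] by metis
    from cover_round_trip[OF G injH injG conj' \<pi> conjunct1[OF L(1)] conjunct1[OF L(2)] this,
        folded \<theta>_def \<theta>'_def]
    show ?thesis unfolding conjunct2[OF L(1)] by (simp add: image_image)
  qed
  show ?thesis
    unfolding cat_equivalent_def
  proof (intro exI conjI)
    show "is_functor (quillen p G) (quillen p H) (\<lambda>E. \<theta> E ` E) (transport_map \<theta>)"
      by (rule transport_functor[OF G H]) (fact ob one)+
    show "is_functor (quillen p H) (quillen p G) (\<lambda>E. \<theta>' E ` E) (transport_map \<theta>')"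
      by (rule transport_functor[OF H G]) (fact ob' two)+
    show "is_nat_iso (quillen p G) (quillen p G) id id
      ((\<lambda>E. \<theta>' E ` E) \<circ> (\<lambda>E. \<theta> E ` E)) (transport_map \<theta>' \<circ> transport_map \<theta>)
      (\<lambda>E. (E, \<theta>' (\<theta> E ` E) ` \<theta> E ` E, restrict (\<lambda>e. \<theta>' (\<theta> E ` E) (\<theta> E e)) E))"
      by (rule transport_nat_iso[OF G]) (fact ob ob' one two round_trip)+
    show "is_nat_iso (quillen p H) (quillen p H) id id
      ((\<lambda>E. \<theta> E ` E) \<circ> (\<lambda>E. \<theta>' E ` E)) (transport_map \<theta> \<circ> transport_map \<theta>')
      (\<lambda>E. (E, \<theta> (\<theta>' E ` E) ` \<theta>' E ` E, restrict (\<lambda>e. \<theta> (\<theta>' E ` E) (\<theta>' E e)) E))"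
      by (rule transport_nat_iso[OF H]) (fact ob ob' one two round_trip')+
  qed
qed

section \<open>Quotients by torsion-free modules\<close>

lemma (in comm_monoid) hom_finprod_endo:
  assumes "h \<in> hom G G" "h \<one> = \<one>" "f \<in> A \<rightarrow> carrier G"
  shows "h (finprod G f A) = finprod G (\<lambda>x. h (f x)) A"
  using assms(3)
proof (induction A rule: infinite_finite_induct)
  case (insert a A)
  have f: "f a \<in> carrier G" "f \<in> A \<rightarrow> carrier G" using insert.prems by auto
  moreover have "(\<lambda>x. h (f x)) \<in> A \<rightarrow> carrier G" "h (f a) \<in> carrier G"
    using f assms(1) by (auto simp: hom_def Pi_iff)
  ultimately show ?case
    using insert assms(1) by (simp add: hom_mult Pi_def)
qed (use assms in auto)

text \<open>Right translation permutes a subgroup: the change of variable behind both averaging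
  arguments below.\<close>

lemma (in group) finprod_translate:
  assumes E: "subgroup E G" and M: "comm_monoid M" and f: "f \<in> E \<rightarrow> carrier M" and b: "b \<in> E"
  shows "finprod M (\<lambda>a. f (a \<otimes> b)) E = finprod M f E"
proof -
  interpret M: comm_monoid M by (rule M)
  have sub: "E \<subseteq> carrier G" using E by (rule subgroup.subset)
  have inj: "inj_on (\<lambda>a. a \<otimes> b) E"
    using sub b by (auto simp: inj_on_def subset_iff)
  have "(\<lambda>a. a \<otimes> b) ` E = E"
  proof
    show "(\<lambda>a. a \<otimes> b) ` E \<subseteq> E" using E b by (auto simp: subgroup.m_closed)
    show "E \<subseteq> (\<lambda>a. a \<otimes> b) ` E"
    proof
      fix x assume "x \<in> E"
      then have "x = (x \<otimes> inv b) \<otimes> b" "x \<otimes> inv b \<in> E"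
        using E b sub by (auto simp: subgroup.m_closed subgroup.m_inv_closed m_assoc subset_iff)
      then show "x \<in> (\<lambda>a. a \<otimes> b) ` E" by blast
    qed
  qed
  then show ?thesis
    using M.finprod_reindex[OF _ inj, of f] f by simp
qed

text \<open>An action need not be compatible with products in the acting group: the homomorphisms
  \<open>\<kappa>\<close> below force that on their images.\<close>
locale group_action_module = group \<Gamma> + T: comm_group T
  for \<Gamma> :: "('c, 'x) monoid_scheme" (structure) and T :: "('t, 'y) monoid_scheme" +
  fixes act :: "'t \<Rightarrow> 'c \<Rightarrow> 't"
  assumes act_hom: "a \<in> carrier \<Gamma> \<Longrightarrow> (\<lambda>t. act t a) \<in> hom T T"
    and torsion_free: "t \<in> carrier T \<Longrightarrow> 0 < n \<Longrightarrow> t [^]\<^bsub>T\<^esub> (n::nat) = \<one>\<^bsub>T\<^esub> \<Longrightarrow> t = \<one>\<^bsub>T\<^esub>"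
begin

text \<open>The second clause says, without an inverse, that conjugation by \<open>a\<close> maps
  the image of \<open>\<kappa>\<close> to itself and induces \<open>act\<close> there. The
  embeddings of both kernels are of this kind, and so is the map \<open>\<mu>\<close> that measures
  their difference.\<close>

definition equivariant :: "('t \<Rightarrow> 'c) \<Rightarrow> bool" where
  "equivariant \<kappa> \<longleftrightarrow> \<kappa> \<in> hom T \<Gamma> \<and>
     (\<forall>t\<in>carrier T. \<forall>a\<in>carrier \<Gamma>. \<kappa> t \<otimes> a = a \<otimes> \<kappa> (act t a))"

lemma act_closed: "t \<in> carrier T \<Longrightarrow> a \<in> carrier \<Gamma> \<Longrightarrow> act t a \<in> carrier T"
  using act_hom by (auto simp: hom_def)

lemma group_hom_act: "a \<in> carrier \<Gamma> \<Longrightarrow> group_hom T T (\<lambda>t. act t a)"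
  using act_hom by (simp add: group_hom_def group_hom_axioms_def T.is_group)

lemma act_pow: "t \<in> carrier T \<Longrightarrow> a \<in> carrier \<Gamma> \<Longrightarrow> act (t [^]\<^bsub>T\<^esub> (n::nat)) a = act t a [^]\<^bsub>T\<^esub> n"
  using group_hom.hom_nat_pow[OF group_hom_act] .

lemma act_int_pow: "t \<in> carrier T \<Longrightarrow> a \<in> carrier \<Gamma> \<Longrightarrow> act (t [^]\<^bsub>T\<^esub> (n::int)) a = act t a [^]\<^bsub>T\<^esub> n"
  using group_hom.hom_int_pow[OF group_hom_act] .

lemma act_inv: "t \<in> carrier T \<Longrightarrow> a \<in> carrier \<Gamma> \<Longrightarrow> act (inv\<^bsub>T\<^esub> t) a = inv\<^bsub>T\<^esub> (act t a)"
  using group_hom.hom_inv[OF group_hom_act] .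

lemma act_finprod:
  assumes "a \<in> carrier \<Gamma>" "f \<in> A \<rightarrow> carrier T"
  shows "act (finprod T f A) a = finprod T (\<lambda>x. act (f x) a) A"
  using T.hom_finprod_endo[OF act_hom[OF assms(1)] _ assms(2)]
    group_hom.hom_one[OF group_hom_act[OF assms(1)]] by simp

lemma nat_pow_inject:
  assumes "s \<in> carrier T" "t \<in> carrier T" "0 < n" "s [^]\<^bsub>T\<^esub> (n::nat) = t [^]\<^bsub>T\<^esub> n"
  shows "s = t"
proof -
  have "(s \<otimes>\<^bsub>T\<^esub> inv\<^bsub>T\<^esub> t) [^]\<^bsub>T\<^esub> n = \<one>\<^bsub>T\<^esub>"
    using assms by (simp add: T.nat_pow_distrib T.nat_pow_inv)
  then have "s \<otimes>\<^bsub>T\<^esub> inv\<^bsub>T\<^esub> t = \<one>\<^bsub>T\<^esub>"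
    using torsion_free[of "s \<otimes>\<^bsub>T\<^esub> inv\<^bsub>T\<^esub> t" n] assms by simp
  then show ?thesis
    using assms by (metis T.inv_closed T.inv_equality T.inv_inv)
qed

context
  fixes \<kappa>
  assumes \<kappa>: "equivariant \<kappa>"
begin

lemma equivariant_hom: "\<kappa> \<in> hom T \<Gamma>"
  using \<kappa> by (simp add: equivariant_def)

lemma equivariant_closed: "t \<in> carrier T \<Longrightarrow> \<kappa> t \<in> carrier \<Gamma>"
  using equivariant_hom by (auto simp: hom_def)

lemma equivariant_mult:
  "s \<in> carrier T \<Longrightarrow> t \<in> carrier T \<Longrightarrow> \<kappa> (s \<otimes>\<^bsub>T\<^esub> t) = \<kappa> s \<otimes> \<kappa> t"
  using equivariant_hom by (auto simp: hom_def)

lemma equivariant_act: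
  "t \<in> carrier T \<Longrightarrow> a \<in> carrier \<Gamma> \<Longrightarrow> \<kappa> t \<otimes> a = a \<otimes> \<kappa> (act t a)"
  using \<kappa> by (simp add: equivariant_def)

lemma equivariant_one: "\<kappa> \<one>\<^bsub>T\<^esub> = \<one>"
  by (rule hom_one[OF equivariant_hom T.is_group is_group])

text \<open>The collection rule of an extension: pulling \<open>\<kappa> s\<close> to the right past
  \<open>b\<close> costs the action of \<open>b\<close>.\<close>

lemma equivariant_pass:
  assumes "a \<in> carrier \<Gamma>" "b \<in> carrier \<Gamma>" "s \<in> carrier T" "t \<in> carrier T"
  shows "a \<otimes> \<kappa> s \<otimes> (b \<otimes> \<kappa> t) = a \<otimes> b \<otimes> \<kappa> (act s b \<otimes>\<^bsub>T\<^esub> t)"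
proof -
  have "a \<otimes> \<kappa> s \<otimes> (b \<otimes> \<kappa> t) = a \<otimes> (\<kappa> s \<otimes> b) \<otimes> \<kappa> t"
    using assms by (simp add: m_assoc equivariant_closed)
  also have "\<dots> = a \<otimes> b \<otimes> (\<kappa> (act s b) \<otimes> \<kappa> t)"
    unfolding equivariant_act[OF assms(3,2)] using assms by (simp add: m_assoc act_closed equivariant_closed)
  finally show ?thesis
    using assms by (simp add: equivariant_mult act_closed)
qed

end

text \<open>The cocycle of the section \<open>\<sigma>\<close> is \<open>|E|\<close> times a cocycle, hence a coboundary
  by averaging.\<close>
lemma split_of_divisible_cocycle:
  fixes G :: "('a, 'z) monoid_scheme"
  assumes \<kappa>: "equivariant \<kappa>" and G: "group G" and E: "subgroup E G" and fin: "finite E" and inj: "inj_on \<kappa> (carrier T)"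
    and \<sigma>: "\<sigma> \<in> E \<rightarrow> carrier \<Gamma>"
    and z: "\<And>a b. a \<in> E \<Longrightarrow> b \<in> E \<Longrightarrow> z a b \<in> carrier T"
    and mult: "\<And>a b. a \<in> E \<Longrightarrow> b \<in> E \<Longrightarrow>
      \<sigma> a \<otimes> \<sigma> b = \<sigma> (a \<otimes>\<^bsub>G\<^esub> b) \<otimes> \<kappa> (z a b [^]\<^bsub>T\<^esub> card E)"
  shows "\<exists>c\<in>E \<rightarrow> carrier T. (\<lambda>a. \<sigma> a \<otimes> \<kappa> (c a)) \<in> hom (G\<lparr>carrier := E\<rparr>) \<Gamma>"
proof -
  note [simp] = equivariant_closed[OF \<kappa>] and \<kappa>_mult = equivariant_mult[OF \<kappa>]
    and \<kappa>_act = equivariant_act[OF \<kappa>] and \<kappa>_pass = equivariant_pass[OF \<kappa>]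
  interpret G: group G by (rule G)
  interpret E: subgroup E G by (rule E)
  let ?n = "card E"
  have n: "0 < ?n" using fin E.one_closed by (metis card_gt_0_iff empty_iff)
  have EG: "a \<in> carrier G" if "a \<in> E" for a using that E.subset by blast
  note cl = \<sigma>[THEN funcset_mem] z E.m_closed EG act_closed
  \<comment> \<open>Associativity in \<Gamma> gives this identity only for \<open>card E\<close>-th
    powers; injectivity of \<open>\<kappa>\<close> and torsion-freeness remove the exponent.\<close>
  have cocycle: "z (a \<otimes>\<^bsub>G\<^esub> b) c \<otimes>\<^bsub>T\<^esub> act (z a b) (\<sigma> c) = z a (b \<otimes>\<^bsub>G\<^esub> c) \<otimes>\<^bsub>T\<^esub> z b c"
    if abc: "a \<in> E" "b \<in> E" "c \<in> E" for a b c
  proof -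
    have "(\<sigma> a \<otimes> \<sigma> b) \<otimes> \<sigma> c = \<sigma> (a \<otimes>\<^bsub>G\<^esub> b) \<otimes> (\<kappa> (z a b [^]\<^bsub>T\<^esub> ?n) \<otimes> \<sigma> c)"
      using abc by (simp add: mult cl m_assoc)
    also have "\<dots> = (\<sigma> (a \<otimes>\<^bsub>G\<^esub> b) \<otimes> \<sigma> c) \<otimes> \<kappa> (act (z a b [^]\<^bsub>T\<^esub> ?n) (\<sigma> c))"
      using abc by (simp add: cl m_assoc \<kappa>_act[of "z a b [^]\<^bsub>T\<^esub> ?n" "\<sigma> c"])
    also have "\<dots> = \<sigma> (a \<otimes>\<^bsub>G\<^esub> b \<otimes>\<^bsub>G\<^esub> c)
        \<otimes> \<kappa> (z (a \<otimes>\<^bsub>G\<^esub> b) c [^]\<^bsub>T\<^esub> ?n \<otimes>\<^bsub>T\<^esub> act (z a b [^]\<^bsub>T\<^esub> ?n) (\<sigma> c))"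
      using abc by (simp add: mult cl m_assoc \<kappa>_mult)
    also have "\<dots> = \<sigma> (a \<otimes>\<^bsub>G\<^esub> b \<otimes>\<^bsub>G\<^esub> c)
        \<otimes> \<kappa> ((z (a \<otimes>\<^bsub>G\<^esub> b) c \<otimes>\<^bsub>T\<^esub> act (z a b) (\<sigma> c)) [^]\<^bsub>T\<^esub> ?n)"
      using abc by (simp add: cl act_pow T.nat_pow_distrib)
    finally have l: "(\<sigma> a \<otimes> \<sigma> b) \<otimes> \<sigma> c = \<dots>" .
    have "\<sigma> a \<otimes> (\<sigma> b \<otimes> \<sigma> c) = (\<sigma> a \<otimes> \<sigma> (b \<otimes>\<^bsub>G\<^esub> c)) \<otimes> \<kappa> (z b c [^]\<^bsub>T\<^esub> ?n)"
      using abc by (simp add: mult[OF abc(2,3)] cl m_assoc)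
    also have "\<sigma> a \<otimes> \<sigma> (b \<otimes>\<^bsub>G\<^esub> c) = \<sigma> (a \<otimes>\<^bsub>G\<^esub> b \<otimes>\<^bsub>G\<^esub> c) \<otimes> \<kappa> (z a (b \<otimes>\<^bsub>G\<^esub> c) [^]\<^bsub>T\<^esub> ?n)"
      using abc by (simp add: mult cl G.m_assoc)
    also have "\<dots> \<otimes> \<kappa> (z b c [^]\<^bsub>T\<^esub> ?n) = \<sigma> (a \<otimes>\<^bsub>G\<^esub> b \<otimes>\<^bsub>G\<^esub> c)
        \<otimes> \<kappa> (z a (b \<otimes>\<^bsub>G\<^esub> c) [^]\<^bsub>T\<^esub> ?n \<otimes>\<^bsub>T\<^esub> z b c [^]\<^bsub>T\<^esub> ?n)"
      using abc by (simp add: cl m_assoc \<kappa>_mult)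
    also have "\<dots> = \<sigma> (a \<otimes>\<^bsub>G\<^esub> b \<otimes>\<^bsub>G\<^esub> c)
        \<otimes> \<kappa> ((z a (b \<otimes>\<^bsub>G\<^esub> c) \<otimes>\<^bsub>T\<^esub> z b c) [^]\<^bsub>T\<^esub> ?n)"
      using abc by (simp add: cl T.nat_pow_distrib)
    finally have "\<kappa> ((z (a \<otimes>\<^bsub>G\<^esub> b) c \<otimes>\<^bsub>T\<^esub> act (z a b) (\<sigma> c)) [^]\<^bsub>T\<^esub> ?n)
        = \<kappa> ((z a (b \<otimes>\<^bsub>G\<^esub> c) \<otimes>\<^bsub>T\<^esub> z b c) [^]\<^bsub>T\<^esub> ?n)"
      using l abc by (simp add: cl m_assoc)
    then have "(z (a \<otimes>\<^bsub>G\<^esub> b) c \<otimes>\<^bsub>T\<^esub> act (z a b) (\<sigma> c)) [^]\<^bsub>T\<^esub> ?n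
        = (z a (b \<otimes>\<^bsub>G\<^esub> c) \<otimes>\<^bsub>T\<^esub> z b c) [^]\<^bsub>T\<^esub> ?n"
      using inj_onD[OF inj] abc by (simp add: cl)
    then show ?thesis
      using nat_pow_inject[OF _ _ n] abc by (simp add: cl)
  qed
  \<comment> \<open>The sum of \<open>z\<close> over its first argument. Summing the cocycle
    identity over that argument shows that \<open>card E\<close> times \<open>z\<close>, which is
    the factor set of \<open>\<sigma>\<close>, is the coboundary of \<open>C\<close>.\<close>
  define C where "C b = finprod T (\<lambda>a. z a b) E" for b
  have C: "C b \<in> carrier T" if "b \<in> E" for b
    using that unfolding C_def by (auto intro!: T.finprod_closed simp: cl)
  have sum: "C c \<otimes>\<^bsub>T\<^esub> act (C b) (\<sigma> c) = C (b \<otimes>\<^bsub>G\<^esub> c) \<otimes>\<^bsub>T\<^esub> z b c [^]\<^bsub>T\<^esub> ?n"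
    if bc: "b \<in> E" "c \<in> E" for b c
  proof -
    have "C c = finprod T (\<lambda>a. z (a \<otimes>\<^bsub>G\<^esub> b) c) E"
      using G.finprod_translate[OF E T.comm_monoid_axioms, of "\<lambda>a. z a c" b] bc
      by (simp add: C_def cl)
    then have "C c \<otimes>\<^bsub>T\<^esub> act (C b) (\<sigma> c)
        = finprod T (\<lambda>a. z (a \<otimes>\<^bsub>G\<^esub> b) c \<otimes>\<^bsub>T\<^esub> act (z a b) (\<sigma> c)) E"
      using bc by (subst T.finprod_multf) (auto simp: cl C_def act_finprod)
    also have "\<dots> = finprod T (\<lambda>a. z a (b \<otimes>\<^bsub>G\<^esub> c) \<otimes>\<^bsub>T\<^esub> z b c) E"
      using bc by (intro T.finprod_cong') (auto simp: cl cocycle)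
    also have "\<dots> = C (b \<otimes>\<^bsub>G\<^esub> c) \<otimes>\<^bsub>T\<^esub> z b c [^]\<^bsub>T\<^esub> ?n"
      using bc by (subst T.finprod_multf) (auto simp: cl C_def T.finprod_const)
    finally show ?thesis .
  qed
  \<comment> \<open>Correcting \<open>\<sigma>\<close> by the inverse of \<open>C\<close> cancels
    its factor set and leaves a homomorphism.\<close>
  let ?c = "\<lambda>a. inv\<^bsub>T\<^esub> (C a)"
  have "(\<sigma> b \<otimes> \<kappa> (?c b)) \<otimes> (\<sigma> c \<otimes> \<kappa> (?c c))
      = \<sigma> (b \<otimes>\<^bsub>G\<^esub> c) \<otimes> \<kappa> (?c (b \<otimes>\<^bsub>G\<^esub> c))" if bc: "b \<in> E" "c \<in> E" for b c
  proof -
    have "(\<sigma> b \<otimes> \<kappa> (?c b)) \<otimes> (\<sigma> c \<otimes> \<kappa> (?c c))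
        = \<sigma> b \<otimes> \<sigma> c \<otimes> \<kappa> (act (?c b) (\<sigma> c) \<otimes>\<^bsub>T\<^esub> ?c c)"
      using bc by (intro \<kappa>_pass) (auto simp: cl C)
    also have "\<dots> = \<sigma> (b \<otimes>\<^bsub>G\<^esub> c)
        \<otimes> \<kappa> (z b c [^]\<^bsub>T\<^esub> ?n \<otimes>\<^bsub>T\<^esub> (act (?c b) (\<sigma> c) \<otimes>\<^bsub>T\<^esub> ?c c))"
      using bc by (simp add: mult cl C m_assoc \<kappa>_mult)
    also have "z b c [^]\<^bsub>T\<^esub> ?n \<otimes>\<^bsub>T\<^esub> (act (?c b) (\<sigma> c) \<otimes>\<^bsub>T\<^esub> ?c c) = ?c (b \<otimes>\<^bsub>G\<^esub> c)"
    proof -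
      have "act (?c b) (\<sigma> c) \<otimes>\<^bsub>T\<^esub> ?c c = inv\<^bsub>T\<^esub> (C c \<otimes>\<^bsub>T\<^esub> act (C b) (\<sigma> c))"
        using bc by (simp add: act_inv cl C T.inv_mult T.m_comm)
      also have "\<dots> = inv\<^bsub>T\<^esub> (z b c [^]\<^bsub>T\<^esub> ?n) \<otimes>\<^bsub>T\<^esub> ?c (b \<otimes>\<^bsub>G\<^esub> c)"
        using bc by (simp add: sum cl C T.inv_mult T.m_comm)
      finally show ?thesis
        using bc by (simp add: cl C T.m_assoc[symmetric])
    qed
    finally show ?thesis .
  qed
  then have "(\<lambda>a. \<sigma> a \<otimes> \<kappa> (?c a)) \<in> hom (G\<lparr>carrier := E\<rparr>) \<Gamma>"
    by (auto simp: hom_def cl C)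
  moreover have "?c \<in> E \<rightarrow> carrier T" using C by auto
  ultimately show ?thesis by (intro bexI[of _ ?c])
qed

text \<open>By injectivity of \<open>\<kappa>\<close> the discrepancy \<open>f\<close> is a
  1-cocycle on \<open>L\<close>. Averaging makes \<open>card L\<close> times \<open>f\<close> a
  coboundary, hence also \<open>c\<close> times \<open>f\<close>. The 0-cochain that bounds it,
  embedded by \<open>\<mu>\<close>, is the factor by which \<open>g\<close> is modified.\<close>

lemma conj_transfer:
  assumes \<kappa>: "equivariant \<kappa>" and L: "subgroup L \<Gamma>" and fin: "finite L" and inj: "inj_on \<kappa> (carrier T)"
    and \<phi>: "\<phi> \<in> L \<rightarrow> carrier \<Gamma>"
    and \<phi>_mult: "\<And>a b. a \<in> L \<Longrightarrow> b \<in> L \<Longrightarrow> \<phi> (a \<otimes> b) = \<phi> a \<otimes> \<phi> b"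
    and f: "f \<in> L \<rightarrow> carrier T" and g: "g \<in> carrier \<Gamma>"
    and conj: "\<And>a. a \<in> L \<Longrightarrow> a \<otimes> g = g \<otimes> (\<phi> a \<otimes> \<kappa> (f a))"
    and \<mu>: "equivariant \<mu>"
    and comm: "\<And>s t. s \<in> carrier T \<Longrightarrow> t \<in> carrier T \<Longrightarrow> \<kappa> s \<otimes> \<mu> t = \<mu> t \<otimes> \<kappa> s"
    and c: "int (card L) dvd c"
  shows "\<exists>g'\<in>carrier \<Gamma>. \<forall>a\<in>L. a \<otimes> g' = g' \<otimes> (\<phi> a \<otimes> (\<kappa> (f a) \<otimes> \<mu> (f a [^]\<^bsub>T\<^esub> c)))"
proof -
  note [simp] = equivariant_closed[OF \<kappa>] and \<kappa>_mult = equivariant_mult[OF \<kappa>]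
    and \<kappa>_act = equivariant_act[OF \<kappa>] and \<kappa>_pass = equivariant_pass[OF \<kappa>]
  interpret L: subgroup L \<Gamma> by (rule L)
  note cl = f[THEN funcset_mem] \<phi>[THEN funcset_mem] g L.m_closed L.mem_carrier act_closed
  have cocycle: "f (a \<otimes> b) = act (f a) (\<phi> b) \<otimes>\<^bsub>T\<^esub> f b" if ab: "a \<in> L" "b \<in> L" for a b
  proof -
    have "g \<otimes> (\<phi> (a \<otimes> b) \<otimes> \<kappa> (f (a \<otimes> b))) = a \<otimes> (b \<otimes> g)"
      using ab conj[of "a \<otimes> b"] by (simp add: cl m_assoc)
    also have "\<dots> = a \<otimes> g \<otimes> (\<phi> b \<otimes> \<kappa> (f b))"
      using ab conj[of b] by (simp add: cl m_assoc)
    also have "\<dots> = g \<otimes> (\<phi> a \<otimes> \<kappa> (f a) \<otimes> (\<phi> b \<otimes> \<kappa> (f b)))"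
      using ab conj[of a] by (simp add: cl m_assoc)
    also have "\<phi> a \<otimes> \<kappa> (f a) \<otimes> (\<phi> b \<otimes> \<kappa> (f b))
        = \<phi> (a \<otimes> b) \<otimes> \<kappa> (act (f a) (\<phi> b) \<otimes>\<^bsub>T\<^esub> f b)"
      using ab by (subst \<kappa>_pass) (auto simp: cl \<phi>_mult)
    finally have "\<kappa> (f (a \<otimes> b)) = \<kappa> (act (f a) (\<phi> b) \<otimes>\<^bsub>T\<^esub> f b)"
      using ab by (simp add: cl)
    then show ?thesis
      using inj_onD[OF inj] ab by (simp add: cl)
  qed
  \<comment> \<open>The sum of all values of the 1-cocycle. Summing the cocycle identity presents
    \<open>card L\<close> times \<open>f b\<close> as the difference of \<open>D\<close> and its
    image under \<open>\<phi> b\<close>.\<close>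
  define D where "D = finprod T f L"
  have D: "D \<in> carrier T" using f by (simp add: D_def)
  have sum: "D = act D (\<phi> b) \<otimes>\<^bsub>T\<^esub> f b [^]\<^bsub>T\<^esub> card L" if b: "b \<in> L" for b
  proof -
    have "D = finprod T (\<lambda>a. f (a \<otimes> b)) L"
      using finprod_translate[OF L T.comm_monoid_axioms f b] by (simp add: D_def)
    also have "\<dots> = finprod T (\<lambda>a. act (f a) (\<phi> b) \<otimes>\<^bsub>T\<^esub> f b) L"
      using b by (intro T.finprod_cong') (auto simp: cl cocycle)
    also have "\<dots> = act D (\<phi> b) \<otimes>\<^bsub>T\<^esub> f b [^]\<^bsub>T\<^esub> card L"
      using b f by (subst T.finprod_multf) (auto simp: cl D_def T.finprod_const act_finprod)
    finally show ?thesis .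
  qed
  obtain q where q: "c = int (card L) * q" using c by (auto elim: dvdE)
  \<comment> \<open>Since \<open>q\<close> is \<open>c\<close> divided by \<open>card L\<close>,
    this is the 0-cochain that bounds \<open>c\<close> times \<open>f\<close>.\<close>
  define s where "s = D [^]\<^bsub>T\<^esub> q"
  have s: "s \<in> carrier T" using D by (simp add: s_def)
  have key: "s = act s (\<phi> b) \<otimes>\<^bsub>T\<^esub> f b [^]\<^bsub>T\<^esub> c" if b: "b \<in> L" for b
  proof -
    have "s = (act D (\<phi> b) \<otimes>\<^bsub>T\<^esub> f b [^]\<^bsub>T\<^esub> card L) [^]\<^bsub>T\<^esub> q"
      unfolding s_def using sum[OF b] by simp
    also have "\<dots> = act s (\<phi> b) \<otimes>\<^bsub>T\<^esub> (f b [^]\<^bsub>T\<^esub> int (card L)) [^]\<^bsub>T\<^esub> q"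
      using b D by (simp add: cl T.int_pow_distrib s_def act_int_pow int_pow_int)
    finally show ?thesis
      using b by (simp add: cl T.int_pow_pow q)
  qed
  \<comment> \<open>Moving \<open>\<mu> s\<close> to the right past \<open>\<phi> a\<close> and
    \<open>\<kappa> (f a)\<close> turns it into \<open>\<mu> (act s (\<phi> a))\<close>, which
    together with the additional factor is \<open>\<mu> s\<close> again by
    \<open>key\<close>.\<close>
  have "a \<otimes> (g \<otimes> \<mu> s) = (g \<otimes> \<mu> s) \<otimes> (\<phi> a \<otimes> (\<kappa> (f a) \<otimes> \<mu> (f a [^]\<^bsub>T\<^esub> c)))"
    if a: "a \<in> L" for a
  proof -
    have "(g \<otimes> \<mu> s) \<otimes> (\<phi> a \<otimes> (\<kappa> (f a) \<otimes> \<mu> (f a [^]\<^bsub>T\<^esub> c)))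
        = g \<otimes> (\<mu> s \<otimes> \<phi> a) \<otimes> (\<kappa> (f a) \<otimes> \<mu> (f a [^]\<^bsub>T\<^esub> c))"
      using a s by (simp add: cl m_assoc equivariant_closed[OF \<mu>])
    also have "\<mu> s \<otimes> \<phi> a = \<phi> a \<otimes> \<mu> (act s (\<phi> a))"
      using a s by (simp add: cl equivariant_act[OF \<mu>])
    also have "g \<otimes> (\<phi> a \<otimes> \<mu> (act s (\<phi> a))) \<otimes> (\<kappa> (f a) \<otimes> \<mu> (f a [^]\<^bsub>T\<^esub> c))
        = g \<otimes> \<phi> a \<otimes> ((\<mu> (act s (\<phi> a)) \<otimes> \<kappa> (f a)) \<otimes> \<mu> (f a [^]\<^bsub>T\<^esub> c))"
      using a s by (simp add: cl m_assoc equivariant_closed[OF \<mu>])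
    also have "\<mu> (act s (\<phi> a)) \<otimes> \<kappa> (f a) = \<kappa> (f a) \<otimes> \<mu> (act s (\<phi> a))"
      using a s by (simp add: cl comm)
    also have "g \<otimes> \<phi> a \<otimes> ((\<kappa> (f a) \<otimes> \<mu> (act s (\<phi> a))) \<otimes> \<mu> (f a [^]\<^bsub>T\<^esub> c))
        = g \<otimes> (\<phi> a \<otimes> \<kappa> (f a)) \<otimes> \<mu> (act s (\<phi> a) \<otimes>\<^bsub>T\<^esub> f a [^]\<^bsub>T\<^esub> c)"
      using a s by (simp add: cl m_assoc equivariant_closed[OF \<mu>] equivariant_mult[OF \<mu>])
    also have "\<dots> = a \<otimes> g \<otimes> \<mu> s"
      using conj[OF a] key[OF a] a s by (simp add: cl)
    finally show ?thesis
      using a s by (simp add: cl m_assoc equivariant_closed[OF \<mu>])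
  qed
  then show ?thesis
    using s by (intro bexI[of _ "g \<otimes> \<mu> s"]) (auto simp: g equivariant_closed[OF \<mu>])
qed

end

text \<open>A conjugation in \<open>G\<close> lifts to \<Gamma> up to errors in the image of
  \<open>\<kappa>\<close>. \<open>conj_transfer\<close> replaces them by the corresponding values of
  \<open>\<kappa>'\<close>, which \<open>\<psi>\<close> kills. The reverse direction is the same
  statement with the quotients exchanged and \<open>c\<close> negated.\<close>

lemma (in group_action_module) conj_descends:
  fixes G :: "('a, 'z) monoid_scheme" and H :: "('b, 'w) monoid_scheme"
  assumes G: "group G" and H: "group H" and \<pi>: "\<pi> \<in> hom \<Gamma> G" and \<psi>: "\<psi> \<in> hom \<Gamma> H"
    and surj: "carrier G \<subseteq> \<pi> ` carrier \<Gamma>"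
    and \<kappa>: "equivariant \<kappa>" and \<kappa>': "\<And>t. t \<in> carrier T \<Longrightarrow> \<kappa>' t = \<kappa> t \<otimes> \<mu> (t [^]\<^bsub>T\<^esub> (c::int))"
    and \<mu>: "equivariant \<mu>"
    and ker: "\<And>a. a \<in> carrier \<Gamma> \<Longrightarrow> \<pi> a = \<one>\<^bsub>G\<^esub> \<Longrightarrow> a \<in> \<kappa> ` carrier T"
    and ker': "\<And>t. t \<in> carrier T \<Longrightarrow> \<psi> (\<kappa>' t) = \<one>\<^bsub>H\<^esub>"
    and inj: "inj_on \<kappa> (carrier T)"
    and comm: "\<And>s t. s \<in> carrier T \<Longrightarrow> t \<in> carrier T \<Longrightarrow> \<kappa> s \<otimes> \<mu> t = \<mu> t \<otimes> \<kappa> s"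
    and L: "subgroup L \<Gamma>" and fin: "finite L" and c: "int (card L) dvd c"
    and L': "subgroup L' \<Gamma>" and injL': "inj_on \<pi> L'"
    and \<phi>: "\<phi> \<in> L \<rightarrow> L'"
    and conj: "\<exists>g\<in>carrier G. \<forall>a\<in>L. \<pi> a \<otimes>\<^bsub>G\<^esub> g = g \<otimes>\<^bsub>G\<^esub> \<pi> (\<phi> a)"
  shows "\<exists>h\<in>carrier H. \<forall>a\<in>L. \<psi> a \<otimes>\<^bsub>H\<^esub> h = h \<otimes>\<^bsub>H\<^esub> \<psi> (\<phi> a)"
proof -
  interpret \<pi>: group_hom \<Gamma> G \<pi>
    using G \<pi> by (simp add: group_hom_def group_hom_axioms_def is_group)
  interpret \<psi>: group_hom \<Gamma> H \<psi>
    using H \<psi> by (simp add: group_hom_def group_hom_axioms_def is_group)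
  interpret L: subgroup L \<Gamma> by (rule L)
  interpret L': subgroup L' \<Gamma> by (rule L')
  obtain g where g: "g \<in> carrier \<Gamma>"
    and conj: "\<And>a. a \<in> L \<Longrightarrow> \<pi> a \<otimes>\<^bsub>G\<^esub> \<pi> g = \<pi> g \<otimes>\<^bsub>G\<^esub> \<pi> (\<phi> a)"
    using conj surj by blast
  have \<phi>L: "\<phi> a \<in> L'" "\<phi> a \<in> carrier \<Gamma>" if "a \<in> L" for a
    using that \<phi> L'.mem_carrier by (auto simp: Pi_iff)
  have \<pi>\<phi>: "\<pi> (\<phi> a) = inv\<^bsub>G\<^esub> \<pi> g \<otimes>\<^bsub>G\<^esub> (\<pi> a \<otimes>\<^bsub>G\<^esub> \<pi> g)" if "a \<in> L" for a
    using that conj[OF that] g \<phi>L by (simp add: \<pi>.H.inv_solve_left)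
  \<comment> \<open>Multiplicativity of \<open>\<phi>\<close> is inherited from conjugation in
    \<open>G\<close>, as \<open>\<pi>\<close> is injective on \<open>L'\<close>.\<close>
  have \<phi>_mult: "\<phi> (a \<otimes> b) = \<phi> a \<otimes> \<phi> b" if "a \<in> L" "b \<in> L" for a b
  proof (rule inj_onD[OF injL'])
    have "\<pi> g \<otimes>\<^bsub>G\<^esub> \<pi> (\<phi> (a \<otimes> b)) = \<pi> a \<otimes>\<^bsub>G\<^esub> (\<pi> b \<otimes>\<^bsub>G\<^esub> \<pi> g)"
      using that g conj[of "a \<otimes> b"] by (simp add: \<pi>.H.m_assoc)
    also have "\<dots> = \<pi> a \<otimes>\<^bsub>G\<^esub> \<pi> g \<otimes>\<^bsub>G\<^esub> \<pi> (\<phi> b)"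
      using that g \<phi>L by (simp add: \<pi>.H.m_assoc conj[of b])
    also have "\<dots> = \<pi> g \<otimes>\<^bsub>G\<^esub> \<pi> (\<phi> a \<otimes> \<phi> b)"
      using that g \<phi>L by (simp add: \<pi>.H.m_assoc conj[of a])
    finally show "\<pi> (\<phi> (a \<otimes> b)) = \<pi> (\<phi> a \<otimes> \<phi> b)"
      using that g \<phi>L by simp
  qed (use that \<phi>L in auto)
  \<comment> \<open>The error by which \<open>g\<close> fails to conjugate \<open>a\<close> to
    \<open>\<phi> a\<close> in \<Gamma>; it becomes trivial in \<open>G\<close>.\<close>
  define r where "r a = inv (\<phi> a) \<otimes> (inv g \<otimes> (a \<otimes> g))" for a
  have r: "r a \<in> carrier \<Gamma>" if "a \<in> L" for a
    using that g \<phi>L by (simp add: r_def)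
  have "r a \<in> \<kappa> ` carrier T" if "a \<in> L" for a
  proof (rule ker[OF r[OF that]])
    show "\<pi> (r a) = \<one>\<^bsub>G\<^esub>"
      using that g \<phi>L by (simp add: r_def \<pi>\<phi>[symmetric])
  qed
  then obtain f where f: "\<And>a. a \<in> L \<Longrightarrow> f a \<in> carrier T \<and> r a = \<kappa> (f a)"
    unfolding image_iff by metis
  have conj': "a \<otimes> g = g \<otimes> (\<phi> a \<otimes> \<kappa> (f a))" if "a \<in> L" for a
  proof -
    have "g \<otimes> (\<phi> a \<otimes> r a) = a \<otimes> g"
      unfolding r_def using that g \<phi>L by (simp add: m_assoc[symmetric])
    then show ?thesis using f[OF that] by simp
  qed
  obtain g' where g': "g' \<in> carrier \<Gamma>"
    and *: "\<And>a. a \<in> L \<Longrightarrow> a \<otimes> g' = g' \<otimes> (\<phi> a \<otimes> (\<kappa> (f a) \<otimes> \<mu> (f a [^]\<^bsub>T\<^esub> c)))"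
    using conj_transfer[OF \<kappa> L fin inj _ \<phi>_mult _ g conj' \<mu> comm c] \<phi>L f
    by (metis (no_types, lifting) Pi_I)
  have "\<psi> a \<otimes>\<^bsub>H\<^esub> \<psi> g' = \<psi> g' \<otimes>\<^bsub>H\<^esub> \<psi> (\<phi> a)" if a: "a \<in> L" for a
  proof -
    have fa: "f a \<in> carrier T" using f[OF a] by simp
    have k: "\<kappa>' (f a) \<in> carrier \<Gamma>"
      using \<kappa>'[OF fa] equivariant_closed[OF \<kappa>] equivariant_closed[OF \<mu>] fa by simp
    have "a \<otimes> g' = g' \<otimes> (\<phi> a \<otimes> \<kappa>' (f a))" using *[OF a] \<kappa>'[OF fa] by simp
    then have "\<psi> (a \<otimes> g') = \<psi> (g' \<otimes> (\<phi> a \<otimes> \<kappa>' (f a)))" by simp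
    then show ?thesis using a g' \<phi>L k ker'[OF fa] by simp
  qed
  then show ?thesis using g' by (intro bexI[of _ "\<psi> g'"]) auto
qed

text \<open>The kernel is isomorphic to \<open>T\<close> and so has no element of order
  \<open>p\<close>, while the quotient of two elements of \<open>L\<close> with the same image lies
  in the kernel and is killed by \<open>p\<close>.\<close>

lemma (in group_action_module) inj_on_elem_ab:
  assumes G: "group G" and \<pi>: "\<pi> \<in> hom \<Gamma> G"
    and ker: "\<And>a. a \<in> carrier \<Gamma> \<Longrightarrow> \<pi> a = \<one>\<^bsub>G\<^esub> \<Longrightarrow> a \<in> \<kappa> ` carrier T"
    and \<kappa>: "equivariant \<kappa>" and inj: "inj_on \<kappa> (carrier T)" and p: "0 < p"
    and L: "elem_ab_p_subgroup p \<Gamma> L"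
  shows "inj_on \<pi> L"
proof (rule inj_onI)
  interpret \<pi>: group_hom \<Gamma> G \<pi>
    using G \<pi> by (simp add: group_hom_def group_hom_axioms_def is_group)
  interpret \<kappa>: group_hom T \<Gamma> \<kappa>
    using equivariant_hom[OF \<kappa>] by (simp add: group_hom_def group_hom_axioms_def is_group T.is_group)
  interpret L: subgroup L \<Gamma> using elem_ab_p_subgroupD[OF L] by simp
  fix a b assume ab: "a \<in> L" "b \<in> L" "\<pi> a = \<pi> b"
  have "\<pi> (a \<otimes> inv b) = \<one>\<^bsub>G\<^esub>" using ab by simp
  then obtain t where t: "t \<in> carrier T" "a \<otimes> inv b = \<kappa> t"
    using ker[of "a \<otimes> inv b"] ab by auto
  have "a \<otimes> inv b \<in> L" using ab by simp
  then have "\<kappa> t [^] p = \<one>" using L t by (simp add: elem_ab_p_subgroup_def)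
  then have "\<kappa> (t [^]\<^bsub>T\<^esub> p) = \<kappa> \<one>\<^bsub>T\<^esub>" using t by (simp add: \<kappa>.hom_nat_pow)
  then have "t = \<one>\<^bsub>T\<^esub>" using inj_onD[OF inj] torsion_free p t by simp
  then show "a = b" using t ab by (metis \<kappa>.hom_one L.mem_carrier inv_closed inv_equality inv_inv)
qed

text \<open>Averaging turns the section into a homomorphism on \<open>E\<close> that
  \<open>\<pi>\<close> inverts; its image is the required lift.\<close>

lemma (in group_action_module) elem_ab_lift:
  fixes G :: "('a, 'z) monoid_scheme"
  assumes G: "group G" and \<pi>: "\<pi> \<in> hom \<Gamma> G"
    and ker: "\<And>t. t \<in> carrier T \<Longrightarrow> \<pi> (\<kappa> t) = \<one>\<^bsub>G\<^esub>"
    and \<kappa>: "equivariant \<kappa>" and inj: "inj_on \<kappa> (carrier T)"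
    and E: "elem_ab_p_subgroup p G E" and fin: "finite E"
    and sec: "\<sigma> \<in> E \<rightarrow> carrier \<Gamma>" "\<And>a. a \<in> E \<Longrightarrow> \<pi> (\<sigma> a) = a"
    and z: "\<And>a b. a \<in> E \<Longrightarrow> b \<in> E \<Longrightarrow> z a b \<in> carrier T"
      "\<And>a b. a \<in> E \<Longrightarrow> b \<in> E \<Longrightarrow> \<sigma> a \<otimes> \<sigma> b = \<sigma> (a \<otimes>\<^bsub>G\<^esub> b) \<otimes> \<kappa> (z a b [^]\<^bsub>T\<^esub> card E)"
  shows "\<exists>L. elem_ab_p_subgroup p \<Gamma> L \<and> \<pi> ` L = E"
proof -
  interpret \<pi>: group_hom \<Gamma> G \<pi>
    using G \<pi> by (simp add: group_hom_def group_hom_axioms_def is_group)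
  have E': "subgroup E G" and EG: "E \<subseteq> carrier G" using elem_ab_p_subgroupD[OF E] by auto
  let ?E = "G\<lparr>carrier := E\<rparr>"
  have grE: "group ?E" using E' G by (rule subgroup.subgroup_is_group)
  obtain c where c: "c \<in> E \<rightarrow> carrier T" "(\<lambda>a. \<sigma> a \<otimes> \<kappa> (c a)) \<in> hom ?E \<Gamma>"
    using split_of_divisible_cocycle[OF \<kappa> G E' fin inj sec(1) z] by blast
  \<comment> \<open>The corrected section is a homomorphism on \<open>E\<close> only, so
    \<open>E\<close> is viewed as a subgroup of itself before its image is taken.\<close>
  have "elem_ab_p_subgroup p ?E E"
    using E group.subgroup_self[OF grE] \<pi>.H.nat_pow_consistent[symmetric]
    by (simp add: elem_ab_p_subgroup_def)
  from elem_ab_p_subgroup_hom_image[OF grE is_group c(2) this]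
  have "elem_ab_p_subgroup p \<Gamma> ((\<lambda>a. \<sigma> a \<otimes> \<kappa> (c a)) ` E)" .
  moreover have "\<pi> (\<sigma> a \<otimes> \<kappa> (c a)) = a" if "a \<in> E" for a
  proof -
    have "\<sigma> a \<in> carrier \<Gamma>" "c a \<in> carrier T" using that sec(1) c(1) by auto
    then show ?thesis using that sec(2)[OF that] EG ker equivariant_closed[OF \<kappa>] by (simp add: subset_iff)
  qed
  then have "\<pi> ` (\<lambda>a. \<sigma> a \<otimes> \<kappa> (c a)) ` E = E" by (simp add: image_image)
  ultimately show ?thesis by blast
qed

text \<open>The two kernels differ by \<open>\<mu>\<close> applied to \<open>c\<close>-fold
  multiples, and \<open>c\<close> is divisible by the order of every elementary abelian subgroup of
  \<Gamma>. The divisibility is asked for subgroups of \<open>G\<close>, into which those of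
  \<Gamma> embed.\<close>

lemma (in group_action_module) quillen_equivalent_of_kernels:
  fixes G :: "('a, 'z) monoid_scheme" and H :: "('b, 'w) monoid_scheme"
  assumes G: "group G" and H: "group H" and \<pi>: "\<pi> \<in> hom \<Gamma> G" and \<psi>: "\<psi> \<in> hom \<Gamma> H"
    and surj: "carrier G \<subseteq> \<pi> ` carrier \<Gamma>" "carrier H \<subseteq> \<psi> ` carrier \<Gamma>"
    and \<kappa>: "equivariant \<kappa>" "equivariant \<kappa>'" and \<mu>: "equivariant \<mu>"
    and \<kappa>': "\<And>t. t \<in> carrier T \<Longrightarrow> \<kappa>' t = \<kappa> t \<otimes> \<mu> (t [^]\<^bsub>T\<^esub> (c::int))"
    and ker: "\<And>a. a \<in> carrier \<Gamma> \<Longrightarrow> \<pi> a = \<one>\<^bsub>G\<^esub> \<longleftrightarrow> a \<in> \<kappa> ` carrier T"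
      "\<And>a. a \<in> carrier \<Gamma> \<Longrightarrow> \<psi> a = \<one>\<^bsub>H\<^esub> \<longleftrightarrow> a \<in> \<kappa>' ` carrier T"
    and inj: "inj_on \<kappa> (carrier T)" "inj_on \<kappa>' (carrier T)"
    and comm: "\<And>s t. s \<in> carrier T \<Longrightarrow> t \<in> carrier T \<Longrightarrow> \<kappa> s \<otimes> \<mu> t = \<mu> t \<otimes> \<kappa> s"
      "\<And>s t. s \<in> carrier T \<Longrightarrow> t \<in> carrier T \<Longrightarrow> \<kappa>' s \<otimes> \<mu> t = \<mu> t \<otimes> \<kappa>' s"
    and p: "0 < p"
    and fin: "\<And>E. elem_ab_p_subgroup p G E \<Longrightarrow> finite E \<and> int (card E) dvd c"
    and sec: "\<And>E. elem_ab_p_subgroup p G E \<Longrightarrow> \<exists>\<sigma>\<in>E \<rightarrow> carrier \<Gamma>. \<exists>z. (\<forall>a\<in>E. \<pi> (\<sigma> a) = a) \<and>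
        (\<forall>a\<in>E. \<forall>b\<in>E. z a b \<in> carrier T \<and>
           \<sigma> a \<otimes> \<sigma> b = \<sigma> (a \<otimes>\<^bsub>G\<^esub> b) \<otimes> \<kappa> (z a b [^]\<^bsub>T\<^esub> card E))"
      "\<And>E. elem_ab_p_subgroup p H E \<Longrightarrow> \<exists>\<sigma>\<in>E \<rightarrow> carrier \<Gamma>. \<exists>z. (\<forall>a\<in>E. \<psi> (\<sigma> a) = a) \<and>
        (\<forall>a\<in>E. \<forall>b\<in>E. z a b \<in> carrier T \<and>
           \<sigma> a \<otimes> \<sigma> b = \<sigma> (a \<otimes>\<^bsub>H\<^esub> b) \<otimes> \<kappa>' (z a b [^]\<^bsub>T\<^esub> card E))"
    and fin': "\<And>E. elem_ab_p_subgroup p H E \<Longrightarrow> finite E"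
  shows "cat_equivalent (quillen p G) (quillen p H)"
proof -
  \<comment> \<open>The relation between the kernels read backwards, with \<open>- c\<close>; it
    lets \<open>conj_descends\<close> be applied from \<open>H\<close> to \<open>G\<close>.\<close>
  have \<kappa>_inv: "\<kappa> t = \<kappa>' t \<otimes> \<mu> (t [^]\<^bsub>T\<^esub> (- c))" if t: "t \<in> carrier T" for t
  proof -
    note cl = equivariant_closed[OF \<kappa>(1)] equivariant_closed[OF \<mu>]
    have "\<mu> (t [^]\<^bsub>T\<^esub> c) \<otimes> \<mu> (t [^]\<^bsub>T\<^esub> (- c)) = \<mu> (t [^]\<^bsub>T\<^esub> (c + - c))"
      using t by (simp only: equivariant_mult[OF \<mu>] T.int_pow_mult T.int_pow_closed)
    also have "\<dots> = \<one>" using equivariant_one[OF \<mu>] by simp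
    finally show ?thesis using t by (simp add: \<kappa>' cl m_assoc)
  qed
  have ker1: "\<pi> (\<kappa> t) = \<one>\<^bsub>G\<^esub>" if "t \<in> carrier T" for t
    using ker(1)[of "\<kappa> t"] equivariant_closed[OF \<kappa>(1)] that by blast
  have ker2: "\<psi> (\<kappa>' t) = \<one>\<^bsub>H\<^esub>" if "t \<in> carrier T" for t
    using ker(2)[of "\<kappa>' t"] equivariant_closed[OF \<kappa>(2)] that by blast
  have inj\<pi>: "inj_on \<pi> L" if "elem_ab_p_subgroup p \<Gamma> L" for L
    using inj_on_elem_ab[OF G \<pi> _ \<kappa>(1) inj(1) p that] ker(1) by blast
  have inj\<psi>: "inj_on \<psi> L" if "elem_ab_p_subgroup p \<Gamma> L" for L
    using inj_on_elem_ab[OF H \<psi> _ \<kappa>(2) inj(2) p that] ker(2) by blast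
  have finL: "finite L \<and> int (card L) dvd c" if "elem_ab_p_subgroup p \<Gamma> L" for L
    using fin[OF elem_ab_p_subgroup_hom_image[OF is_group G \<pi> that]] inj\<pi>[OF that]
    by (simp add: card_image finite_image_iff)
  show ?thesis
  proof (rule quillen_equivalent_of_cover[OF is_group G H \<pi> \<psi>])
    fix E assume E: "elem_ab_p_subgroup p G E"
    obtain \<sigma> z where "\<sigma> \<in> E \<rightarrow> carrier \<Gamma>" "\<forall>a\<in>E. \<pi> (\<sigma> a) = a"
      "\<forall>a\<in>E. \<forall>b\<in>E. z a b \<in> carrier T \<and>
           \<sigma> a \<otimes> \<sigma> b = \<sigma> (a \<otimes>\<^bsub>G\<^esub> b) \<otimes> \<kappa> (z a b [^]\<^bsub>T\<^esub> card E)"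
      using sec(1)[OF E] by blast
    then show "\<exists>L. elem_ab_p_subgroup p \<Gamma> L \<and> \<pi> ` L = E"
      by (intro elem_ab_lift[OF G \<pi> ker1 \<kappa>(1) inj(1) E, of \<sigma> z]) (use fin[OF E] in auto)
  next
    fix E assume E: "elem_ab_p_subgroup p H E"
    obtain \<sigma> z where "\<sigma> \<in> E \<rightarrow> carrier \<Gamma>" "\<forall>a\<in>E. \<psi> (\<sigma> a) = a"
      "\<forall>a\<in>E. \<forall>b\<in>E. z a b \<in> carrier T \<and>
           \<sigma> a \<otimes> \<sigma> b = \<sigma> (a \<otimes>\<^bsub>H\<^esub> b) \<otimes> \<kappa>' (z a b [^]\<^bsub>T\<^esub> card E)"
      using sec(2)[OF E] by blast
    then show "\<exists>L. elem_ab_p_subgroup p \<Gamma> L \<and> \<psi> ` L = E"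
      by (intro elem_ab_lift[OF H \<psi> ker2 \<kappa>(2) inj(2) E, of \<sigma> z]) (use fin'[OF E] in auto)
  next
    show "\<forall>L L' \<phi>. elem_ab_p_subgroup p \<Gamma> L \<longrightarrow> elem_ab_p_subgroup p \<Gamma> L' \<longrightarrow> \<phi> \<in> L \<rightarrow> L' \<longrightarrow>
      (\<exists>g\<in>carrier G. \<forall>e\<in>L. \<pi> e \<otimes>\<^bsub>G\<^esub> g = g \<otimes>\<^bsub>G\<^esub> \<pi> (\<phi> e)) \<longleftrightarrow>
      (\<exists>h\<in>carrier H. \<forall>e\<in>L. \<psi> e \<otimes>\<^bsub>H\<^esub> h = h \<otimes>\<^bsub>H\<^esub> \<psi> (\<phi> e))"
    proof (intro allI impI iffI)
      fix L L' \<phi>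
      assume L: "elem_ab_p_subgroup p \<Gamma> L" and L': "elem_ab_p_subgroup p \<Gamma> L'" and \<phi>: "\<phi> \<in> L \<rightarrow> L'"
      note sub = elem_ab_p_subgroupD(1)[OF L] elem_ab_p_subgroupD(1)[OF L']
      have dvd: "int (card L) dvd c" "int (card L) dvd - c" and finL: "finite L"
        using finL[OF L] by auto
      show "\<exists>h\<in>carrier H. \<forall>e\<in>L. \<psi> e \<otimes>\<^bsub>H\<^esub> h = h \<otimes>\<^bsub>H\<^esub> \<psi> (\<phi> e)"
        if "\<exists>g\<in>carrier G. \<forall>e\<in>L. \<pi> e \<otimes>\<^bsub>G\<^esub> g = g \<otimes>\<^bsub>G\<^esub> \<pi> (\<phi> e)"
        by (rule conj_descends[OF G H \<pi> \<psi> surj(1) \<kappa>(1) \<kappa>' \<mu> _ ker2 inj(1) comm(1) sub(1) finL dvd(1)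
              sub(2) inj\<pi>[OF L'] \<phi> that]) (use ker(1) in auto)
      show "\<exists>g\<in>carrier G. \<forall>e\<in>L. \<pi> e \<otimes>\<^bsub>G\<^esub> g = g \<otimes>\<^bsub>G\<^esub> \<pi> (\<phi> e)"
        if "\<exists>h\<in>carrier H. \<forall>e\<in>L. \<psi> e \<otimes>\<^bsub>H\<^esub> h = h \<otimes>\<^bsub>H\<^esub> \<psi> (\<phi> e)"
        by (rule conj_descends[OF H G \<psi> \<pi> surj(2) \<kappa>(2) \<kappa>_inv \<mu> _ ker1 inj(2) comm(2) sub(1) finL dvd(2)
              sub(2) inj\<psi>[OF L'] \<phi> that]) (use ker(2) in auto)
    qed
  qed (use inj\<pi> inj\<psi> in auto)
qed

section \<open>Extensions by factor sets\<close>

text \<open>The module as a multiplicative group, so that finite products and powers become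
  available; \<open>[^]\<close> then stands for an integer multiple.\<close>

definition additive :: "('g, 'm) pmodule \<Rightarrow> 'm monoid" where
  "additive M = \<lparr>carrier = mcarrier M, monoid.mult = madd M, one = mzero M\<rparr>"

lemma additive_simps [simp]:
  "carrier (additive M) = mcarrier M"
  "monoid.mult (additive M) = madd M"
  "one (additive M) = mzero M"
  by (simp_all add: additive_def)

text \<open>\<open>is_pmodule\<close> speaks of the action only; the laws of an abelian group are
  added here.\<close>

locale gmodule = group P for P :: "('g, 'c) monoid_scheme" (structure) +
  fixes M :: "('g, 'm) pmodule"
  assumes is_pmodule: "is_pmodule P M"
    and add_closed [simp]: "u \<in> mcarrier M \<Longrightarrow> v \<in> mcarrier M \<Longrightarrow> madd M u v \<in> mcarrier M"
    and zero_closed [simp]: "mzero M \<in> mcarrier M"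
    and neg_closed [simp]: "u \<in> mcarrier M \<Longrightarrow> mneg M u \<in> mcarrier M"
    and add_assoc: "u \<in> mcarrier M \<Longrightarrow> v \<in> mcarrier M \<Longrightarrow> w \<in> mcarrier M \<Longrightarrow>
      madd M (madd M u v) w = madd M u (madd M v w)"
    and add_comm: "u \<in> mcarrier M \<Longrightarrow> v \<in> mcarrier M \<Longrightarrow> madd M u v = madd M v u"
    and add_zero [simp]: "u \<in> mcarrier M \<Longrightarrow> madd M (mzero M) u = u"
    and add_neg [simp]: "u \<in> mcarrier M \<Longrightarrow> madd M (mneg M u) u = mzero M"
begin

sublocale A: comm_group "additive M"
proof (rule comm_groupI)
  fix u assume "u \<in> carrier (additive M)"
  then show "\<exists>v\<in>carrier (additive M). v \<otimes>\<^bsub>additive M\<^esub> u = \<one>\<^bsub>additive M\<^esub>"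
    by (intro bexI[of _ "mneg M u"]) auto
qed (auto simp: add_assoc intro: add_comm)

lemma add_zero_right [simp]: "u \<in> mcarrier M \<Longrightarrow> madd M u (mzero M) = u"
  using A.r_one[of u] by simp

lemma add_neg_right [simp]: "u \<in> mcarrier M \<Longrightarrow> madd M u (mneg M u) = mzero M"
  by (simp add: add_comm[of u])

lemma add_left_comm:
  "u \<in> mcarrier M \<Longrightarrow> v \<in> mcarrier M \<Longrightarrow> w \<in> mcarrier M \<Longrightarrow>
    madd M u (madd M v w) = madd M v (madd M u w)"
  using A.m_lcomm[of u v w] by simp

lemmas add_ac = add_assoc add_comm add_left_comm

lemma add_cancel_left [simp]:
  "u \<in> mcarrier M \<Longrightarrow> v \<in> mcarrier M \<Longrightarrow> w \<in> mcarrier M \<Longrightarrow>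
    madd M u v = madd M u w \<longleftrightarrow> v = w"
  by (metis add_assoc add_neg add_zero neg_closed)

lemma add_neg_cancel [simp]:
  "u \<in> mcarrier M \<Longrightarrow> v \<in> mcarrier M \<Longrightarrow> madd M (mneg M u) (madd M u v) = v"
  "u \<in> mcarrier M \<Longrightarrow> v \<in> mcarrier M \<Longrightarrow> madd M u (madd M (mneg M u) v) = v"
  by (simp_all add: add_assoc[symmetric])

lemma inv_additive: "u \<in> mcarrier M \<Longrightarrow> inv\<^bsub>additive M\<^esub> u = mneg M u"
  by (rule A.inv_equality) auto

lemma add_eq_zero_iff:
  "u \<in> mcarrier M \<Longrightarrow> v \<in> mcarrier M \<Longrightarrow> madd M u v = mzero M \<longleftrightarrow> v = mneg M u"
  by (metis add_cancel_left add_neg_right neg_closed)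

lemma act_closed [simp]: "g \<in> carrier P \<Longrightarrow> u \<in> mcarrier M \<Longrightarrow> mact M u g \<in> mcarrier M"
  using is_pmodule by (simp add: is_pmodule_def)

lemma act_add:
  "g \<in> carrier P \<Longrightarrow> u \<in> mcarrier M \<Longrightarrow> v \<in> mcarrier M \<Longrightarrow>
    mact M (madd M u v) g = madd M (mact M u g) (mact M v g)"
  using is_pmodule by (simp add: is_pmodule_def)

lemma act_one [simp]: "u \<in> mcarrier M \<Longrightarrow> mact M u \<one> = u"
  using is_pmodule by (simp add: is_pmodule_def)

lemma act_act:
  "g \<in> carrier P \<Longrightarrow> h \<in> carrier P \<Longrightarrow> u \<in> mcarrier M \<Longrightarrow>
    mact M (mact M u g) h = mact M u (g \<otimes> h)"
  using is_pmodule by (simp add: is_pmodule_def)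

lemma act_hom: "g \<in> carrier P \<Longrightarrow> (\<lambda>u. mact M u g) \<in> hom (additive M) (additive M)"
  by (simp add: hom_def act_add)

lemma group_hom_act: "g \<in> carrier P \<Longrightarrow> group_hom (additive M) (additive M) (\<lambda>u. mact M u g)"
  using act_hom by (simp add: group_hom_def group_hom_axioms_def A.is_group)

lemma act_zero [simp]: "g \<in> carrier P \<Longrightarrow> mact M (mzero M) g = mzero M"
  using group_hom.hom_one[OF group_hom_act] by simp

lemma act_neg: "g \<in> carrier P \<Longrightarrow> u \<in> mcarrier M \<Longrightarrow> mact M (mneg M u) g = mneg M (mact M u g)"
  using group_hom.hom_inv[OF group_hom_act, of g u] by (simp add: inv_additive)

lemma act_int_pow:
  "g \<in> carrier P \<Longrightarrow> u \<in> mcarrier M \<Longrightarrow>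
    mact M (u [^]\<^bsub>additive M\<^esub> (c::int)) g = mact M u g [^]\<^bsub>additive M\<^esub> c"
  using group_hom.hom_int_pow[OF group_hom_act, of g u] by simp

end

text \<open>The normalised 2-cocycle condition at arguments from \<open>P\<close>, with the negative
  terms moved across and no demand on other lists. In this form it passes to pairs, sums and
  multiples by powers of \<open>p\<close> without bookkeeping off the domain.\<close>

definition factor_set :: "('g, 'c) monoid_scheme \<Rightarrow> ('g, 'm) pmodule \<Rightarrow> ('g list \<Rightarrow> 'm) \<Rightarrow> bool" where
  "factor_set P M \<tau> \<longleftrightarrow>
     (\<forall>g\<in>carrier P. \<forall>h\<in>carrier P. \<tau> [g, h] \<in> mcarrier M) \<and>
     (\<forall>g\<in>carrier P. \<tau> [\<one>\<^bsub>P\<^esub>, g] = mzero M \<and> \<tau> [g, \<one>\<^bsub>P\<^esub>] = mzero M) \<and>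
     (\<forall>g\<in>carrier P. \<forall>h\<in>carrier P. \<forall>k\<in>carrier P.
        madd M (\<tau> [h, k]) (\<tau> [g, h \<otimes>\<^bsub>P\<^esub> k]) = madd M (\<tau> [g \<otimes>\<^bsub>P\<^esub> h, k]) (mact M (\<tau> [g, h]) k))"

context gmodule
begin

lemma cobound_2:
  assumes "f \<in> cochains P M 2" "g \<in> carrier P" "h \<in> carrier P" "k \<in> carrier P"
  shows "cobound P M 2 f [g, h, k] = madd M (f [h, k]) (madd M (mneg M (f [g \<otimes> h, k]))
      (madd M (f [g, h \<otimes> k]) (mneg M (mact M (f [g, h]) k))))"
proof -
  have "f [a, b] \<in> mcarrier M" if "a \<in> carrier P" "b \<in> carrier P" for a b
    using assms(1) that by (simp add: cochains_def)
  moreover have "[0..<2] = [0, 1::nat]" by (simp add: upt_rec)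
  ultimately show ?thesis
    using assms by (simp add: cobound_def msum_def msign_def)
qed

lemma factor_set_of_cocycle:
  assumes "f \<in> cocycles P M 2"
  shows "factor_set P M f"
proof -
  have f: "f \<in> cochains P M 2" using assms by (simp add: cocycles_def)
  have cl: "f [a, b] \<in> mcarrier M" if "a \<in> carrier P" "b \<in> carrier P" for a b
    using f that by (simp add: cochains_def)
  have "f [\<one>, a] = mzero M" "f [a, \<one>] = mzero M" if "a \<in> carrier P" for a
    using f that by (simp_all add: cochains_def)
  moreover have "madd M (f [h, k]) (f [g, h \<otimes> k]) = madd M (f [g \<otimes> h, k]) (mact M (f [g, h]) k)"
    if "g \<in> carrier P" "h \<in> carrier P" "k \<in> carrier P" for g h k
  proof -
    let ?a = "f [h, k]" and ?b = "f [g \<otimes> h, k]" and ?c = "f [g, h \<otimes> k]" and ?d = "mact M (f [g, h]) k"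
    have in_M: "?a \<in> mcarrier M" "?b \<in> mcarrier M" "?c \<in> mcarrier M" "?d \<in> mcarrier M"
      using that cl by auto
    have "madd M ?a (madd M (mneg M ?b) (madd M ?c (mneg M ?d))) = mzero M"
      using cobound_2[OF f that] assms by (simp add: cocycles_def czero_def)
    then have "madd M (madd M ?b ?d) (madd M ?a (madd M (mneg M ?b) (madd M ?c (mneg M ?d)))) = madd M ?b ?d"
      using in_M by simp
    moreover have "madd M (madd M ?b ?d) (madd M ?a (madd M (mneg M ?b) (madd M ?c (mneg M ?d))))
        = madd M ?a ?c"
    proof -
      have "madd M (madd M ?b ?d) (madd M ?a (madd M (mneg M ?b) (madd M ?c (mneg M ?d))))
         = madd M ?b (madd M (mneg M ?b) (madd M ?d (madd M (mneg M ?d) (madd M ?a ?c))))"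
        using in_M by (simp only: add_ac add_closed neg_closed)
      then show ?thesis using in_M by simp
    qed
    ultimately show ?thesis by simp
  qed
  ultimately show ?thesis using cl by (simp add: factor_set_def)
qed

context
  fixes \<tau>
  assumes \<tau>: "factor_set P M \<tau>"
begin

lemma factor_closed: "g \<in> carrier P \<Longrightarrow> h \<in> carrier P \<Longrightarrow> \<tau> [g, h] \<in> mcarrier M"
  using \<tau> by (simp add: factor_set_def)

lemma factor_one: "g \<in> carrier P \<Longrightarrow> \<tau> [\<one>, g] = mzero M" "g \<in> carrier P \<Longrightarrow> \<tau> [g, \<one>] = mzero M"
  using \<tau> by (simp_all add: factor_set_def)

lemma factor_cocycle:
  "g \<in> carrier P \<Longrightarrow> h \<in> carrier P \<Longrightarrow> k \<in> carrier P \<Longrightarrow>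
    madd M (\<tau> [h, k]) (\<tau> [g, h \<otimes> k]) = madd M (\<tau> [g \<otimes> h, k]) (mact M (\<tau> [g, h]) k)"
  using \<tau> by (simp add: factor_set_def)

text \<open>Once the module terms are sorted, associativity is exactly the cocycle identity.\<close>

lemma group_Ext: "group (Ext P M \<tau>)"
proof (rule groupI)
  fix x y z
  assume "x \<in> carrier (Ext P M \<tau>)" "y \<in> carrier (Ext P M \<tau>)" "z \<in> carrier (Ext P M \<tau>)"
  then obtain g u h v k w where eq: "x = (g, u)" "y = (h, v)" "z = (k, w)"
    and c: "g \<in> carrier P" "h \<in> carrier P" "k \<in> carrier P"
      "u \<in> mcarrier M" "v \<in> mcarrier M" "w \<in> mcarrier M"
    by (auto simp: Ext_def)
  have f: "\<tau> [g, h] \<in> mcarrier M" "\<tau> [h, k] \<in> mcarrier M" "\<tau> [g \<otimes> h, k] \<in> mcarrier M"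
    "\<tau> [g, h \<otimes> k] \<in> mcarrier M" using c factor_closed by auto
  let ?r = "madd M (mact M u (h \<otimes> k)) (madd M (mact M v k) w)"
  have "madd M (madd M (mact M (madd M (madd M (mact M u h) v) (\<tau> [g, h])) k) w) (\<tau> [g \<otimes> h, k])
      = madd M ?r (madd M (\<tau> [g \<otimes> h, k]) (mact M (\<tau> [g, h]) k))"
    using c f by (simp add: act_add act_act add_ac)
  also have "\<dots> = madd M ?r (madd M (\<tau> [h, k]) (\<tau> [g, h \<otimes> k]))"
    using c by (simp add: factor_cocycle)
  also have "\<dots> = madd M (madd M (mact M u (h \<otimes> k)) (madd M (madd M (mact M v k) w) (\<tau> [h, k])))
      (\<tau> [g, h \<otimes> k])"
    using c f by (simp add: add_ac)
  finally show "x \<otimes>\<^bsub>Ext P M \<tau>\<^esub> y \<otimes>\<^bsub>Ext P M \<tau>\<^esub> z = x \<otimes>\<^bsub>Ext P M \<tau>\<^esub> (y \<otimes>\<^bsub>Ext P M \<tau>\<^esub> z)"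
    using c by (simp add: eq Ext_def m_assoc)
next
  fix x assume "x \<in> carrier (Ext P M \<tau>)"
  then obtain g u where x: "x = (g, u)" "g \<in> carrier P" "u \<in> mcarrier M"
    by (auto simp: Ext_def)
  \<comment> \<open>The solution \<open>n\<close> of \<open>n^g + u + \<tau> [inv g, g] = 0\<close>,
    which makes \<open>(inv g, n)\<close> a left inverse.\<close>
  let ?n = "mact M (mneg M (madd M u (\<tau> [inv g, g]))) (inv g)"
  have f: "\<tau> [inv g, g] \<in> mcarrier M" using x factor_closed by simp
  have "madd M (madd M (mact M ?n g) u) (\<tau> [inv g, g]) = mzero M"
    using x f by (simp add: act_act add_assoc)
  then show "\<exists>y\<in>carrier (Ext P M \<tau>). y \<otimes>\<^bsub>Ext P M \<tau>\<^esub> x = \<one>\<^bsub>Ext P M \<tau>\<^esub>"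
    using x f by (intro bexI[of _ "(inv g, ?n)"]) (auto simp: Ext_def)
qed (auto simp: Ext_def factor_closed factor_one)

lemma Ext_inclusion_hom: "(\<lambda>u. (\<one>, u)) \<in> hom (additive M) (Ext P M \<tau>)"
  by (auto simp: hom_def Ext_def factor_one)

lemma Ext_inclusion_act:
  assumes "u \<in> mcarrier M" "x \<in> carrier (Ext P M \<tau>)"
  shows "(\<one>, u) \<otimes>\<^bsub>Ext P M \<tau>\<^esub> x = x \<otimes>\<^bsub>Ext P M \<tau>\<^esub> (\<one>, mact M u (fst x))"
  using assms by (auto simp: Ext_def factor_one add_comm)

end

end

lemma Ext_hom:
  assumes "gmodule P M" "gmodule P M'" "factor_set P M \<tau>"
    and "\<phi> \<in> mcarrier M \<rightarrow> mcarrier M'"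
    and "\<And>u v. u \<in> mcarrier M \<Longrightarrow> v \<in> mcarrier M \<Longrightarrow> \<phi> (madd M u v) = madd M' (\<phi> u) (\<phi> v)"
    and "\<And>u g. u \<in> mcarrier M \<Longrightarrow> g \<in> carrier P \<Longrightarrow> \<phi> (mact M u g) = mact M' (\<phi> u) g"
    and "\<And>g h. g \<in> carrier P \<Longrightarrow> h \<in> carrier P \<Longrightarrow> \<phi> (\<tau> [g, h]) = \<tau>' [g, h]"
  shows "(\<lambda>(g, u). (g, \<phi> u)) \<in> hom (Ext P M \<tau>) (Ext P M' \<tau>')"
proof -
  interpret M: gmodule P M by fact
  show ?thesis
    using assms(4-) by (auto simp: hom_def Ext_def Pi_iff M.factor_closed[OF assms(3)])
qed

definition prod_module :: "('g, 'm) pmodule \<Rightarrow> ('g, 'n) pmodule \<Rightarrow> ('g, 'm \<times> 'n) pmodule" where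
  "prod_module M N = \<lparr>mcarrier = mcarrier M \<times> mcarrier N,
     madd = (\<lambda>x y. (madd M (fst x) (fst y), madd N (snd x) (snd y))),
     mzero = (mzero M, mzero N), mneg = (\<lambda>x. (mneg M (fst x), mneg N (snd x))),
     mact = (\<lambda>x g. (mact M (fst x) g, mact N (snd x) g))\<rparr>"

lemma gmodule_prod:
  assumes "gmodule P M" "gmodule P N"
  shows "gmodule P (prod_module M N)"
proof -
  interpret M: gmodule P M by fact
  interpret N: gmodule P N by fact
  show ?thesis
    by unfold_locales
      (auto simp: prod_module_def is_pmodule_def M.act_add N.act_add M.act_act N.act_act
        M.add_assoc N.add_assoc intro: M.add_comm N.add_comm)
qed

lemma factor_set_prod:
  assumes "factor_set P M \<tau>" "factor_set P N \<tau>'"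
  shows "factor_set P (prod_module M N) (\<lambda>xs. (\<tau> xs, \<tau>' xs))"
  using assms by (simp add: factor_set_def prod_module_def)

lemma factor_set_add:
  assumes "gmodule P M" "factor_set P M \<tau>" "factor_set P M \<tau>'"
  shows "factor_set P M (cadd M \<tau> \<tau>')"
proof -
  interpret M: gmodule P M by fact
  note cl = M.factor_closed[OF assms(2)] M.factor_closed[OF assms(3)]
  have "madd M (madd M (\<tau> [h, k]) (\<tau>' [h, k])) (madd M (\<tau> [g, h \<otimes>\<^bsub>P\<^esub> k]) (\<tau>' [g, h \<otimes>\<^bsub>P\<^esub> k]))
      = madd M (madd M (\<tau> [g \<otimes>\<^bsub>P\<^esub> h, k]) (\<tau>' [g \<otimes>\<^bsub>P\<^esub> h, k])) (mact M (madd M (\<tau> [g, h]) (\<tau>' [g, h])) k)"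
    if "g \<in> carrier P" "h \<in> carrier P" "k \<in> carrier P" for g h k
  proof -
    have "madd M (madd M (\<tau> [h, k]) (\<tau>' [h, k])) (madd M (\<tau> [g, h \<otimes>\<^bsub>P\<^esub> k]) (\<tau>' [g, h \<otimes>\<^bsub>P\<^esub> k]))
        = madd M (madd M (\<tau> [h, k]) (\<tau> [g, h \<otimes>\<^bsub>P\<^esub> k])) (madd M (\<tau>' [h, k]) (\<tau>' [g, h \<otimes>\<^bsub>P\<^esub> k]))"
      using that by (simp add: cl M.add_ac)
    then show ?thesis
      using that by (simp add: cl M.factor_cocycle[OF assms(2)] M.factor_cocycle[OF assms(3)] M.act_add M.add_ac)
  qed
  then show ?thesis
    using assms(2,3) by (simp add: factor_set_def cadd_def)
qed

section \<open>Vectors of p-adic integers and of residues\<close>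

definition zscale :: "nat \<Rightarrow> int \<Rightarrow> zpvec \<Rightarrow> zpvec" where
  "zscale p c v = (\<lambda>i n. (c * v i n) mod int p ^ n)"

text \<open>As \<open>p\<close> is positive, the zero coordinates from \<open>d\<close> on satisfy
  the residue conditions too, so these can be stated uniformly in the coordinate.\<close>

lemma Tvec_iff:
  assumes "0 < p"
  shows "v \<in> Tvec p d \<longleftrightarrow>
    (\<forall>i n. 0 \<le> v i n \<and> v i n < int p ^ n \<and> v i (Suc n) mod int p ^ n = v i n) \<and>
    (\<forall>i n. d \<le> i \<longrightarrow> v i n = 0)"
proof
  assume v: "v \<in> Tvec p d"
  have "0 \<le> v i n \<and> v i n < int p ^ n \<and> v i (Suc n) mod int p ^ n = v i n" for i n
    using v assms by (cases "i < d") (auto simp: Tvec_def Zp_def)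
  then show "(\<forall>i n. 0 \<le> v i n \<and> v i n < int p ^ n \<and> v i (Suc n) mod int p ^ n = v i n) \<and>
    (\<forall>i n. d \<le> i \<longrightarrow> v i n = 0)"
    using v by (auto simp: Tvec_def)
qed (auto simp: Tvec_def Zp_def)

lemma Rvec_iff:
  assumes "0 < p"
  shows "r \<in> Rvec p d N \<longleftrightarrow> (\<forall>i. 0 \<le> r i \<and> r i < int p ^ N) \<and> (\<forall>i. d \<le> i \<longrightarrow> r i = 0)"
  using assms by (auto simp: Rvec_def) (metis linorder_not_less of_nat_0_less_iff order_refl zero_less_power)+

context
  fixes p d :: nat
  assumes p: "0 < p"
begin

lemma Tvec_mod_self: "v \<in> Tvec p d \<Longrightarrow> v i n mod int p ^ n = v i n"
  using Tvec_iff[OF p] by (simp add: mod_pos_pos_trivial)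

lemma Tvec_mod:
  assumes "v \<in> Tvec p d" "n \<le> k"
  shows "v i k mod int p ^ n = v i n"
  using assms(2)
proof (induction k rule: dec_induct)
  case base
  then show ?case by (rule Tvec_mod_self[OF assms(1)])
next
  case (step k)
  have "v i (Suc k) mod int p ^ n = (v i (Suc k) mod int p ^ k) mod int p ^ n"
    using step by (simp add: mod_mod_cancel le_imp_power_dvd)
  then show ?case using step assms(1) Tvec_iff[OF p] by simp
qed

text \<open>Integers that agree from level to level modulo the smaller power are enough; reducing
  them supplies the canonical residues. Closure under sums, negatives, multiples and
  \<open>lift\<close> follows from this.\<close>

lemma TvecI:
  assumes "\<And>i n. w i (Suc n) mod int p ^ n = w i n mod int p ^ n" "\<And>i n. d \<le> i \<Longrightarrow> w i n = 0"
  shows "(\<lambda>i n. w i n mod int p ^ n) \<in> Tvec p d"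
  using p assms by (simp add: Tvec_iff mod_mod_cancel le_imp_power_dvd del: power_Suc)

lemma Tvec_Suc: "v \<in> Tvec p d \<Longrightarrow> v i (Suc n) mod int p ^ n = v i n mod int p ^ n"
  by (simp add: Tvec_mod)

lemma Tvec_zero: "v \<in> Tvec p d \<Longrightarrow> d \<le> i \<Longrightarrow> v i n = 0"
  using Tvec_iff[OF p] by simp

lemma zero_in_Tvec: "(\<lambda>i n. 0) \<in> Tvec p d"
  using p by (simp add: Tvec_iff)

lemma vadd_closed:
  assumes "v \<in> Tvec p d" "w \<in> Tvec p d"
  shows "vadd p v w \<in> Tvec p d"
  unfolding vadd_def zp_add_def
  by (rule TvecI) (use assms in \<open>auto simp: Tvec_zero intro: mod_add_cong Tvec_Suc\<close>)

lemma vneg_closed: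
  assumes "v \<in> Tvec p d"
  shows "vneg p v \<in> Tvec p d"
  unfolding vneg_def zp_neg_def
  by (rule TvecI) (use assms in \<open>auto simp: Tvec_zero intro: mod_minus_cong Tvec_Suc\<close>)

lemma zscale_closed:
  assumes "v \<in> Tvec p d"
  shows "zscale p c v \<in> Tvec p d"
  unfolding zscale_def
  by (rule TvecI) (use assms in \<open>auto simp: Tvec_zero intro: mod_mult_cong Tvec_Suc\<close>)

lemma lift_closed:
  assumes "\<And>i. d \<le> i \<Longrightarrow> r i = 0"
  shows "lift p r \<in> Tvec p d"
  unfolding lift_def by (rule TvecI) (use assms in auto)

lemma lift_Rvec_closed: "r \<in> Rvec p d N \<Longrightarrow> lift p r \<in> Tvec p d"
  by (rule lift_closed) (simp add: Rvec_def)

lemma proj_closed: "v \<in> Tvec p d \<Longrightarrow> proj N v \<in> Rvec p d N"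
  using p by (simp add: Tvec_iff Rvec_iff proj_def)

lemma proj_lift: "r \<in> Rvec p d N \<Longrightarrow> proj N (lift p r) = r"
  using p by (simp add: Rvec_iff proj_def lift_def mod_pos_pos_trivial)

lemma proj_vadd: "proj N (vadd p v w) = radd p N (proj N v) (proj N w)"
  by (simp add: proj_def vadd_def radd_def zp_add_def)

lemma proj_vneg: "proj N (vneg p v) = rneg p N (proj N v)"
  by (simp add: proj_def vneg_def rneg_def zp_neg_def)

lemma vadd_assoc: "vadd p (vadd p u v) w = vadd p u (vadd p v w)"
  by (simp add: vadd_def zp_add_def fun_eq_iff mod_simps add.assoc)

lemma vadd_comm: "vadd p u v = vadd p v u"
  by (simp add: vadd_def zp_add_def fun_eq_iff add.commute)

lemma vadd_zero: "v \<in> Tvec p d \<Longrightarrow> vadd p (\<lambda>i n. 0) v = v"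
  by (simp add: vadd_def zp_add_def fun_eq_iff Tvec_mod_self)

lemma vadd_vneg: "vadd p (vneg p v) v = (\<lambda>i n. 0)"
  by (simp add: vadd_def vneg_def zp_add_def zp_neg_def fun_eq_iff mod_simps)

lemma zscale_zero: "v \<in> Tvec p d \<Longrightarrow> zscale p 0 v = (\<lambda>i n. 0)"
  by (simp add: zscale_def fun_eq_iff)

lemma zscale_one: "v \<in> Tvec p d \<Longrightarrow> zscale p 1 v = v"
  by (simp add: zscale_def fun_eq_iff Tvec_mod_self)

lemma zscale_add: "zscale p (b + c) v = vadd p (zscale p b v) (zscale p c v)"
  by (simp add: zscale_def vadd_def zp_add_def fun_eq_iff mod_simps distrib_right)

lemma zscale_minus: "zscale p (- c) v = vneg p (zscale p c v)"
  by (simp add: zscale_def vneg_def zp_neg_def fun_eq_iff mod_simps)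

lemma zscale_zscale: "zscale p b (zscale p c v) = zscale p (b * c) v"
  by (simp add: zscale_def fun_eq_iff mod_simps mult.assoc)

lemma zscale_vadd: "zscale p c (vadd p v w) = vadd p (zscale p c v) (zscale p c w)"
  by (simp add: zscale_def vadd_def zp_add_def fun_eq_iff mod_simps distrib_left)

lemma zscale_vneg: "zscale p c (vneg p v) = vneg p (zscale p c v)"
  by (simp add: zscale_def vneg_def zp_neg_def fun_eq_iff mod_simps)

lemma proj_zscale_power: "proj N (zscale p (int p ^ N * c) v) = (\<lambda>i. 0)"
  by (simp add: proj_def zscale_def mult.assoc)

text \<open>The map from T/p^N T to T/p^(N+j) T induced by p^j multiplies canonical residues with no
  reduction, since the products stay below p^(N+j).\<close>

lemma proj_zscale_mult:
  assumes "v \<in> Tvec p d"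
  shows "proj (N + j) (zscale p (int p ^ j) v) = (\<lambda>i. int p ^ j * proj N v i)"
proof
  fix i
  have "int p ^ j * v i (N + j) mod int p ^ (N + j) = int p ^ j * (v i (N + j) mod int p ^ N)"
    by (metis add.commute mult_mod_right power_add)
  then show "proj (N + j) (zscale p (int p ^ j) v) i = int p ^ j * proj N v i"
    using Tvec_mod[OF assms, of N "N + j" i] by (simp add: proj_def zscale_def)
qed

text \<open>Residue 0 at level \<open>N\<close> forces p^N to divide all residues from level
  \<open>N\<close> on. Division loses \<open>N\<close> levels, which is why \<open>divp\<close>
  reads level \<open>n + N\<close> to produce level \<open>n\<close>.\<close>

lemma divp_closed_scale:
  assumes v: "v \<in> Tvec p d" and 0: "proj N v = (\<lambda>i. 0)"
  shows "divp p N v \<in> Tvec p d" and "zscale p (int p ^ N) (divp p N v) = v"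
proof -
  have pos: "0 < int p ^ n" for n using p by simp
  have dvd: "int p ^ N dvd v i (n + N)" for i n
  proof -
    have "v i (n + N) mod int p ^ N = v i N" using Tvec_mod[OF v, of N "n + N" i] by simp
    then show ?thesis using fun_cong[OF 0, of i] by (simp add: proj_def dvd_eq_mod_eq_0)
  qed
  show "zscale p (int p ^ N) (divp p N v) = v"
    using dvd by (simp add: zscale_def divp_def fun_eq_iff Tvec_mod[OF v])
  have "(v i (Suc n + N) div int p ^ N) mod int p ^ n = v i (n + N) div int p ^ N" for i n
  proof -
    obtain q where q: "v i (Suc n + N) = int p ^ N * q" using dvd[of i "Suc n"] unfolding dvd_def by blast
    have "v i (n + N) = v i (Suc n + N) mod int p ^ (n + N)"
      using Tvec_mod[OF v, of "n + N" "Suc n + N" i] by simp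
    also have "\<dots> = int p ^ N * (q mod int p ^ n)"
      unfolding q by (metis add.commute mult_mod_right power_add)
    finally show ?thesis unfolding q using pos[of N] by simp
  qed
  moreover have "0 \<le> v i (n + N) div int p ^ N \<and> v i (n + N) div int p ^ N < int p ^ n" for i n
  proof -
    have "0 \<le> v i (n + N)" "v i (n + N) < int p ^ N * int p ^ n"
      using v Tvec_iff[OF p] by (auto simp: power_add[symmetric] add.commute)
    moreover obtain q where "v i (n + N) = int p ^ N * q" using dvd[of i n] unfolding dvd_def by blast
    ultimately show ?thesis using pos[of N] by (auto simp: zero_le_mult_iff)
  qed
  ultimately show "divp p N v \<in> Tvec p d"
    using Tvec_zero[OF v] by (auto simp: Tvec_iff[OF p] divp_def)
qed

lemma zscale_prime_eq_zero:
  assumes v: "v \<in> Tvec p d" and 0: "zscale p (int p) v = (\<lambda>i n. 0)"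
  shows "v = (\<lambda>i n. 0)"
proof (intro ext)
  fix i n
  \<comment> \<open>Multiplication by \<open>p\<close> loses one level: level \<open>n\<close> of
    \<open>v\<close> is read off from level \<open>Suc n\<close> of the multiple.\<close>
  have "int p * v i (Suc n) mod (int p * int p ^ n) = 0"
    using fun_cong[OF fun_cong[OF 0, of i], of "Suc n"] by (simp add: zscale_def)
  then have "v i (Suc n) mod int p ^ n = 0"
    using p by (simp add: mod_mult_mult1)
  then show "v i n = 0" using Tvec_mod[OF v, of n "Suc n" i] by simp
qed

text \<open>Factors \<open>p\<close> of \<open>c\<close> are stripped off one at a time; what
  remains is prime to \<open>p\<close>, hence invertible modulo every p^n.\<close>

lemma zscale_torsion_free:
  assumes "prime p" "v \<in> Tvec p d" "0 < c" "zscale p (int c) v = (\<lambda>i n. 0)"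
  shows "v = (\<lambda>i n. 0)"
  using assms(2-4)
proof (induction c arbitrary: v rule: less_induct)
  case (less c)
  show ?case
  proof (cases "p dvd c")
    case True
    then obtain c' where c': "c = p * c'" by blast
    have "zscale p (int c') (zscale p (int p) v) = (\<lambda>i n. 0)"
      using less.prems(3) by (simp add: zscale_zscale c' mult.commute)
    moreover have "c' < c" "0 < c'" using less.prems(2) prime_gt_1_nat[OF assms(1)] by (auto simp: c')
    ultimately have "zscale p (int p) v = (\<lambda>i n. 0)"
      using less.IH zscale_closed less.prems(1) by blast
    then show ?thesis using zscale_prime_eq_zero less.prems(1) by blast
  next
    case False
    show ?thesis
    proof (intro ext)
      fix i n
      have "int p ^ n dvd int c * v i n"
        using fun_cong[OF fun_cong[OF less.prems(3), of i], of n]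
        by (simp add: zscale_def dvd_eq_mod_eq_0)
      moreover have "coprime (int p ^ n) (int c)"
        using False assms(1) by (simp add: prime_imp_coprime_nat)
      ultimately have "int p ^ n dvd v i n" by (simp add: coprime_dvd_mult_right_iff)
      then show "v i n = 0"
        using Tvec_mod_self[OF less.prems(1), of i n] by (simp add: dvd_eq_mod_eq_0)
    qed
  qed
qed

lemma proj_eq_imp:
  assumes "v \<in> Tvec p d" "w \<in> Tvec p d" "proj N v = proj N w"
  shows "\<exists>u\<in>Tvec p d. v = vadd p w (zscale p (int p ^ N) u)"
proof -
  let ?x = "vadd p (vneg p w) v"
  have x: "?x \<in> Tvec p d" using assms by (simp add: vadd_closed vneg_closed)
  have "proj N ?x = (\<lambda>i. 0)"
    by (simp add: proj_vadd proj_vneg assms(3) radd_def rneg_def mod_simps)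
  note u = divp_closed_scale[OF x this]
  have "vadd p w ?x = v"
    using vadd_zero[OF assms(1)] by (simp add: vadd_assoc[symmetric] vadd_comm[of w] vadd_vneg)
  then show ?thesis using u by metis
qed

section \<open>Arithmetic of residue vectors\<close>

lemma radd_closed: "r \<in> Rvec p d N \<Longrightarrow> s \<in> Rvec p d N \<Longrightarrow> radd p N r s \<in> Rvec p d N"
  using p by (simp add: Rvec_iff radd_def)

lemma rneg_closed: "r \<in> Rvec p d N \<Longrightarrow> rneg p N r \<in> Rvec p d N"
  using p by (simp add: Rvec_iff rneg_def)

lemma radd_assoc: "radd p N (radd p N r s) t = radd p N r (radd p N s t)"
  by (simp add: radd_def fun_eq_iff mod_simps add.assoc)

lemma radd_comm: "radd p N r s = radd p N s r"
  by (simp add: radd_def fun_eq_iff add.commute)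

lemma radd_radd_swap:
  "radd p N (radd p N r s) (radd p N r' s') = radd p N (radd p N r r') (radd p N s s')"
  by (simp only: radd_def mod_add_eq add.assoc add.left_commute)

lemma radd_zero: "r \<in> Rvec p d N \<Longrightarrow> radd p N (\<lambda>i. 0) r = r"
  using p by (simp add: radd_def fun_eq_iff Rvec_iff mod_pos_pos_trivial)

lemma radd_rneg: "radd p N (rneg p N r) r = (\<lambda>i. 0)"
  by (simp add: radd_def rneg_def fun_eq_iff mod_simps)

lemma zero_in_Rvec: "(\<lambda>i. 0) \<in> Rvec p d N"
  using p by (simp add: Rvec_iff)

lemma mult_Rvec:
  assumes "r \<in> Rvec p d N"
  shows "(\<lambda>i. int p ^ j * r i) \<in> Rvec p d (N + j)"
  using assms p by (auto simp: Rvec_iff power_add mult.commute)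

lemma mult_radd:
  "(\<lambda>i. int p ^ j * radd p N r s i) = radd p (N + j) (\<lambda>i. int p ^ j * r i) (\<lambda>i. int p ^ j * s i)"
proof
  fix i
  have "int p ^ j * ((r i + s i) mod int p ^ N) = int p ^ j * (r i + s i) mod int p ^ (N + j)"
    by (metis add.commute mult_mod_right power_add)
  then show "int p ^ j * radd p N r s i = radd p (N + j) (\<lambda>i. int p ^ j * r i) (\<lambda>i. int p ^ j * s i) i"
    by (simp add: radd_def distrib_left)
qed

end

section \<open>The modules T and T / p^N T\<close>

lemma card_Rvec: "card (Rvec p d N) = p ^ (N * d)"
proof -
  have "bij_betw (\<lambda>r. restrict r {..<d}) (Rvec p d N) (PiE {..<d} (\<lambda>_. {0..<int p ^ N}))"
  \<comment> \<open>\<open>Rvec\<close> pads with 0 from \<open>d\<close> on, extensional functions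
    with \<open>undefined\<close>; the two maps exchange the padding.\<close>
  proof (rule bij_betw_byWitness[where f' = "\<lambda>s i. if i < d then s i else 0"])
    show "\<forall>r\<in>Rvec p d N. (\<lambda>i. if i < d then restrict r {..<d} i else 0) = r"
      by (auto simp: Rvec_def fun_eq_iff)
  qed (auto simp: Rvec_def fun_eq_iff PiE_def extensional_def)
  then have "card (Rvec p d N) = (\<Prod>i<d. card {0..<int p ^ N})"
    by (simp add: bij_betw_same_card card_PiE)
  also have "card {0..<int p ^ N} = p ^ N"
    by (metis card_atLeastLessThan_int diff_zero nat_int of_nat_power)
  finally show ?thesis by (simp add: power_mult)
qed

lemma finite_Rvec: "0 < p \<Longrightarrow> finite (Rvec p d N)"
  using card_Rvec[of p d N] by (metis card.infinite less_irrefl zero_less_power)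

locale zp_module = group P for P :: "('g, 'c) monoid_scheme" (structure) +
  fixes p d :: nat and act :: "'g \<Rightarrow> zpvec \<Rightarrow> zpvec"
  assumes prime: "prime p" and T_pmodule: "is_pmodule P (Tmod p d act)"
begin

lemma p_pos [simp]: "0 < p"
  using prime by (rule prime_gt_0_nat)

lemma Tmod_simps [simp]:
  "mcarrier (Tmod p d act) = Tvec p d" "madd (Tmod p d act) = vadd p"
  "mzero (Tmod p d act) = (\<lambda>i n. 0)" "mneg (Tmod p d act) = vneg p"
  "mact (Tmod p d act) v g = act g v"
  by (simp_all add: Tmod_def)

lemma Rmod_simps [simp]:
  "mcarrier (Rmod p d act N) = Rvec p d N" "madd (Rmod p d act N) = radd p N"
  "mzero (Rmod p d act N) = (\<lambda>i. 0)" "mneg (Rmod p d act N) = rneg p N"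
  by (simp_all add: Rmod_def)

sublocale T: gmodule P "Tmod p d act"
  by unfold_locales
    (simp_all add: T_pmodule vadd_closed vneg_closed zero_in_Tvec vadd_assoc vadd_zero vadd_vneg,
      rule vadd_comm[OF p_pos])

lemma act_closed: "g \<in> carrier P \<Longrightarrow> v \<in> Tvec p d \<Longrightarrow> act g v \<in> Tvec p d"
  using T.act_closed[of g v] by simp

lemma act_vadd: "g \<in> carrier P \<Longrightarrow> v \<in> Tvec p d \<Longrightarrow> w \<in> Tvec p d \<Longrightarrow>
    act g (vadd p v w) = vadd p (act g v) (act g w)"
  using T.act_add[of g v w] by simp

text \<open>Connects the abstract powers of the averaging arguments with concrete multiples of
  p-adic vectors.\<close>

lemma int_pow_T:
  assumes "v \<in> Tvec p d"
  shows "v [^]\<^bsub>additive (Tmod p d act)\<^esub> (c::int) = zscale p c v"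
proof -
  have nat: "v [^]\<^bsub>additive (Tmod p d act)\<^esub> (n::nat) = zscale p (int n) v" for n
  proof (induction n)
    case (Suc n)
    then show ?case
      using zscale_add[OF p_pos, of "int n" 1 v] zscale_one[OF p_pos assms] by (simp add: add.commute)
  qed (simp add: zscale_zero[OF p_pos assms])
  show ?thesis
  proof (cases c rule: int_cases2)
    case (nonneg n)
    show ?thesis unfolding nonneg int_pow_int by (rule nat)
  next
    case (nonpos n)
    have "v [^]\<^bsub>additive (Tmod p d act)\<^esub> (- int n) = inv\<^bsub>additive (Tmod p d act)\<^esub> zscale p (int n) v"
      using T.A.int_pow_neg_int[of v n] assms unfolding nat by simp
    also have "\<dots> = vneg p (zscale p (int n) v)"
      using T.inv_additive[of "zscale p (int n) v"] zscale_closed[OF p_pos assms] by simp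
    finally show ?thesis unfolding nonpos zscale_minus[OF p_pos] .
  qed
qed

lemma act_zscale: "g \<in> carrier P \<Longrightarrow> v \<in> Tvec p d \<Longrightarrow> act g (zscale p c v) = zscale p c (act g v)"
  using T.act_int_pow[of g v c] by (simp add: int_pow_T act_closed)

text \<open>The action commutes with multiplication by p^N and so preserves p^N T. Hence the
  particular lift used in \<open>Rmod\<close> does not influence the action on residues.\<close>

lemma proj_act_cong:
  assumes "g \<in> carrier P" "v \<in> Tvec p d" "w \<in> Tvec p d" "proj N v = proj N w"
  shows "proj N (act g v) = proj N (act g w)"
proof -
  obtain u where u: "u \<in> Tvec p d" "v = vadd p w (zscale p (int p ^ N) u)"
    using proj_eq_imp[OF p_pos assms(2-4)] by blast
  have "act g v = vadd p (act g w) (zscale p (int p ^ N) (act g u))"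
    using u assms by (simp add: act_vadd act_zscale zscale_closed[OF p_pos])
  moreover have "radd p N (proj N (act g w)) (\<lambda>i. 0) = proj N (act g w)"
    using radd_zero[OF p_pos proj_closed[OF p_pos act_closed[OF assms(1,3)]]] radd_comm[OF p_pos]
    by metis
  ultimately show ?thesis
    using proj_zscale_power[OF p_pos, of N 1] by (simp add: proj_vadd)
qed

lemma proj_act:
  assumes "g \<in> carrier P" "v \<in> Tvec p d"
  shows "mact (Rmod p d act N) (proj N v) g = proj N (act g v)"
proof -
  have "proj N v \<in> Rvec p d N" using proj_closed[OF p_pos assms(2)] .
  then show ?thesis
    using assms by (simp add: Rmod_def)
      (intro proj_act_cong, auto simp: lift_Rvec_closed[OF p_pos] proj_lift[OF p_pos])
qed

lemma Rvec_proj: "r \<in> Rvec p d N \<Longrightarrow> \<exists>v\<in>Tvec p d. r = proj N v"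
  using lift_Rvec_closed[OF p_pos] proj_lift[OF p_pos] by metis

text \<open>The laws of the action are inherited from \<open>T\<close>, by writing residues as
  projections and applying \<open>proj_act\<close>.\<close>

lemma R_gmodule: "gmodule P (Rmod p d act N)"
proof
  have act: "mact (Rmod p d act N) (radd p N r s) g
      = radd p N (mact (Rmod p d act N) r g) (mact (Rmod p d act N) s g)"
    if g: "g \<in> carrier P" and r: "r \<in> Rvec p d N" and s: "s \<in> Rvec p d N" for g r s
  proof -
    obtain v w where "v \<in> Tvec p d" "r = proj N v" "w \<in> Tvec p d" "s = proj N w"
      using Rvec_proj[OF r] Rvec_proj[OF s] by blast
    then show ?thesis
      using g by (simp add: proj_vadd[symmetric] proj_act vadd_closed act_vadd)
  qed
  show "is_pmodule P (Rmod p d act N)"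
    unfolding is_pmodule_def
  proof (intro conjI ballI)
    fix r assume "r \<in> mcarrier (Rmod p d act N)"
    then obtain v where v: "v \<in> Tvec p d" "r = proj N v" using Rvec_proj by auto
    show "mact (Rmod p d act N) r \<one> = r"
      using v proj_act[OF one_closed v(1)] T.act_one[of v] by simp
    fix g assume g: "g \<in> carrier P"
    show "mact (Rmod p d act N) r g \<in> mcarrier (Rmod p d act N)"
      using v g by (simp add: proj_act proj_closed[OF p_pos] act_closed)
  next
    fix g h r assume gh: "g \<in> carrier P" "h \<in> carrier P" and "r \<in> mcarrier (Rmod p d act N)"
    then obtain v where v: "v \<in> Tvec p d" "r = proj N v" using Rvec_proj by auto
    show "mact (Rmod p d act N) (mact (Rmod p d act N) r g) h = mact (Rmod p d act N) r (g \<otimes> h)"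
      using v gh T.act_act[of g h v] by (simp add: proj_act act_closed)
  qed (simp add: act)
qed (simp_all add: radd_closed rneg_closed zero_in_Rvec radd_assoc radd_zero radd_rneg,
      rule radd_comm[OF p_pos])

sublocale R: gmodule P "Rmod p d act N" for N
  by (rule R_gmodule)

lemma mult_act:
  assumes "g \<in> carrier P" "r \<in> Rvec p d N"
  shows "(\<lambda>i. int p ^ j * mact (Rmod p d act N) r g i)
    = mact (Rmod p d act (N + j)) (\<lambda>i. int p ^ j * r i) g"
proof -
  obtain v where v: "v \<in> Tvec p d" "r = proj N v" using Rvec_proj[OF assms(2)] by blast
  note m = proj_zscale_mult[OF p_pos, where d = d, symmetric]
  show ?thesis
    using assms v by (simp add: proj_act m act_closed zscale_closed[OF p_pos] act_zscale)
qed

lemma factor_set_pro: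
  assumes "factor_set P (Tmod p d act) \<rho>"
  shows "factor_set P (Rmod p d act N) (pro_c N \<rho>)"
proof -
  have "vadd p (\<rho> [h, k]) (\<rho> [g, h \<otimes> k]) = vadd p (\<rho> [g \<otimes> h, k]) (act k (\<rho> [g, h]))"
    if "g \<in> carrier P" "h \<in> carrier P" "k \<in> carrier P" for g h k
    using T.factor_cocycle[OF assms that] by simp
  moreover have "\<rho> [g, h] \<in> Tvec p d" if "g \<in> carrier P" "h \<in> carrier P" for g h
    using T.factor_closed[OF assms that] by simp
  moreover have "proj N (\<lambda>i n. 0) = (\<lambda>i. 0)" by (simp add: proj_def)
  ultimately show ?thesis
    using T.factor_one[OF assms]
    by (simp add: factor_set_def pro_c_def proj_closed[OF p_pos] proj_vadd[symmetric] proj_act)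
qed

section \<open>The order of elementary abelian subgroups\<close>

lemma nat_pow_R:
  assumes "r \<in> Rvec p d N"
  shows "r [^]\<^bsub>additive (Rmod p d act N)\<^esub> (n::nat) = (\<lambda>i. (int n * r i) mod int p ^ N)"
  by (induction n) (auto simp: radd_def mod_simps distrib_right add.commute)

text \<open>With \<open>N = Suc n\<close>, being killed by \<open>p\<close> means being divisible by
  p^n, and dividing by p^n leaves a vector of residues modulo \<open>p\<close>.\<close>

lemma card_killed_by_p:
  assumes "0 < N"
  shows "finite {r \<in> Rvec p d N. \<forall>i. (int p * r i) mod int p ^ N = 0}"
    and "card {r \<in> Rvec p d N. \<forall>i. (int p * r i) mod int p ^ N = 0} \<le> p ^ d"
proof -
  let ?V = "{r \<in> Rvec p d N. \<forall>i. (int p * r i) mod int p ^ N = 0}"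
  show "finite ?V" using finite_Rvec[OF p_pos] by simp
  obtain n where n: "N = Suc n" using assms gr0_implies_Suc by blast
  have "?V \<subseteq> (\<lambda>s i. int p ^ n * s i) ` Rvec p d 1"
  proof
    fix r assume "r \<in> ?V"
    then have r: "r \<in> Rvec p d N" "\<And>i. int p * int p ^ n dvd int p * r i"
      by (auto simp: n dvd_eq_mod_eq_0)
    have "int p ^ n dvd r i" for i using r(2)[of i] p_pos by simp
    then have eq: "r i = int p ^ n * (r i div int p ^ n)" for i by simp
    have "(\<lambda>i. r i div int p ^ n) \<in> Rvec p d 1"
    proof -
      have "0 \<le> r i div int p ^ n \<and> r i div int p ^ n < int p" for i
      proof -
        have "0 \<le> r i" "r i < int p ^ n * int p" using r(1) Rvec_iff[OF p_pos] by (auto simp: n mult.commute)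
        then have "0 \<le> int p ^ n * (r i div int p ^ n)" "int p ^ n * (r i div int p ^ n) < int p ^ n * int p"
          using eq[of i] by auto
        moreover have "0 < int p ^ n" by simp
        ultimately show ?thesis by (metis mult_less_cancel_left_pos zero_le_mult_iff linorder_not_less order_less_imp_le)
      qed
      then show ?thesis using r(1) by (auto simp: Rvec_iff[OF p_pos])
    qed
    then show "r \<in> (\<lambda>s i. int p ^ n * s i) ` Rvec p d 1"
      using eq by (intro image_eqI[of _ _ "\<lambda>i. r i div int p ^ n"]) auto
  qed
  then have "card ?V \<le> card (Rvec p d 1)"
    using surj_card_le[of "Rvec p d 1"] finite_Rvec[OF p_pos] by blast
  then show "card ?V \<le> p ^ d" by (simp add: card_Rvec)
qed

text \<open>The image of \<open>E\<close> in \<open>P\<close> has at most p^m elements, and the part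
  of \<open>E\<close> inside the module is killed by \<open>p\<close>, which leaves at most p^d.
  Lagrange makes the order a power of \<open>p\<close>, so the two bounds limit its exponent
  independently of \<open>N\<close>.\<close>

lemma elem_ab_card:
  assumes \<tau>: "factor_set P (Rmod p d act N) \<tau>" and N: "0 < N"
    and P: "finite (carrier P)" "card (carrier P) = p ^ m"
    and E: "elem_ab_p_subgroup p (Ext P (Rmod p d act N) \<tau>) E"
  shows "finite E \<and> (\<exists>a\<le>m + d. card E = p ^ a)"
proof -
  let ?G = "Ext P (Rmod p d act N) \<tau>"
  interpret G: group ?G by (rule R.group_Ext[OF \<tau>])
  have sub: "subgroup E ?G" and EG: "E \<subseteq> carrier ?G" using elem_ab_p_subgroupD[OF E] by auto
  interpret E: subgroup E ?G by (rule sub)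
  interpret i: group_hom "additive (Rmod p d act N)" ?G "\<lambda>u. (\<one>, u)"
    using R.Ext_inclusion_hom[OF \<tau>] R.A.is_group G.is_group
    by (simp add: group_hom_def group_hom_axioms_def)
  have car: "carrier ?G = carrier P \<times> Rvec p d N" by (simp add: Ext_def)
  have finG: "finite (carrier ?G)" using P(1) finite_Rvec[OF p_pos] by (simp add: car)
  have finE: "finite E" using finite_subset[OF EG finG] .
  have "order ?G = p ^ (m + N * d)"
    using P(2) by (simp add: order_def car card_cartesian_product card_Rvec power_add)
  then have "card E dvd p ^ (m + N * d)"
    using G.lagrange_finite[OF finG sub] by (metis dvd_triv_right)
  then obtain a where a: "card E = p ^ a"
    using prime by (auto simp: divides_primepow_nat)
  let ?V = "{r \<in> Rvec p d N. \<forall>i. (int p * r i) mod int p ^ N = 0}"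
  \<comment> \<open>One representative in \<open>E\<close> for each element of its image in
    \<open>P\<close>. Elsewhere the value is arbitrary, which is harmless because only an upper
    bound is counted.\<close>
  define rep where "rep h = (SOME e. e \<in> E \<and> fst e = h)" for h
  have "E \<subseteq> (\<lambda>(h, r). rep h \<otimes>\<^bsub>?G\<^esub> (\<one>, r)) ` (carrier P \<times> ?V)"
  proof
    fix e assume e: "e \<in> E"
    have rep: "rep (fst e) \<in> E" "fst (rep (fst e)) = fst e"
      using someI[of "\<lambda>e'. e' \<in> E \<and> fst e' = fst e" e] e by (auto simp: rep_def)
    define x where "x = inv\<^bsub>?G\<^esub> (rep (fst e)) \<otimes>\<^bsub>?G\<^esub> e"
    have x: "x \<in> E" using rep(1) e by (simp add: x_def)
    have ex: "e = rep (fst e) \<otimes>\<^bsub>?G\<^esub> x"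
      using x_def by (rule iffD1[OF G.inv_solve_left, rotated 3]) (use x rep(1) e EG in blast)+
    have fx: "fst x \<in> carrier P" "snd x \<in> Rvec p d N" "fst e \<in> carrier P"
    proof -
      have "x \<in> carrier P \<times> Rvec p d N" "e \<in> carrier P \<times> Rvec p d N"
        using x e EG unfolding car by blast+
      then show "fst x \<in> carrier P" "snd x \<in> Rvec p d N" "fst e \<in> carrier P"
        by (simp_all only: mem_Times_iff)
    qed
    have "fst e = fst e \<otimes> fst x"
      using arg_cong[OF ex, of fst] rep(2) by (simp add: Ext_def split_beta)
    then have fst1: "fst x = \<one>" using fx by simp
    then have x1: "x = (\<one>, snd x)" by (metis prod.collapse)
    have "x [^]\<^bsub>?G\<^esub> p = \<one>\<^bsub>?G\<^esub>" using E x by (simp add: elem_ab_p_subgroup_def)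
    then have "(\<one>, snd x [^]\<^bsub>additive (Rmod p d act N)\<^esub> p) = \<one>\<^bsub>?G\<^esub>"
      using i.hom_nat_pow[of "snd x" p] fx x1 by simp
    then have "snd x \<in> ?V"
      using fx by (auto simp: Ext_def nat_pow_R fun_eq_iff)
    then show "e \<in> (\<lambda>(h, r). rep h \<otimes>\<^bsub>?G\<^esub> (\<one>, r)) ` (carrier P \<times> ?V)"
      using ex x1 fx by (intro image_eqI[of _ _ "(fst e, snd x)"]) auto
  qed
  then have "card E \<le> card (carrier P \<times> ?V)"
    using surj_card_le[of "carrier P \<times> ?V"] P(1) card_killed_by_p(1)[OF N] by blast
  also have "\<dots> \<le> p ^ (m + d)"
    using card_killed_by_p(2)[OF N] P(2) by (simp add: card_cartesian_product power_add)
  finally have "a \<le> m + d"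
    using a prime_gt_1_nat[OF prime] by (simp add: power_increasing_iff)
  then show ?thesis using a finE by blast
qed

end

section \<open>The common cover\<close>

text \<open>\<open>N\<close> and \<open>\<epsilon>\<close> are the level k + e and the cocycle
  \<open>\<eta>_k\<close> of a fixed reference member. \<open>\<epsilon>_dvd\<close> reflects
  \<open>\<eta>_k = p^k \<eta>_0\<close>, and \<open>k_ge\<close> ensures that the order of an
  elementary abelian subgroup divides p^k.\<close>

locale zp_cover = zp_module +
  fixes \<rho> :: "'a list \<Rightarrow> zpvec" and \<epsilon> :: "'a list \<Rightarrow> resvec" and N k m :: nat
  assumes \<rho>: "factor_set P (Tmod p d act) \<rho>" and \<epsilon>: "factor_set P (Rmod p d act N) \<epsilon>"
    and \<epsilon>_dvd: "g \<in> carrier P \<Longrightarrow> h \<in> carrier P \<Longrightarrow> int p ^ k dvd \<epsilon> [g, h] i"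
    and k_le: "k \<le> N" and N_pos: "0 < N" and k_ge: "m + d \<le> k"
    and finite_P: "finite (carrier P)" and card_P: "card (carrier P) = p ^ m"
begin

abbreviation T where "T \<equiv> Tmod p d act"
abbreviation R where "R n \<equiv> Rmod p d act n"

text \<open>This is \<open>\<eta>_(k+j)\<close> for the family, so that \<open>quotient j\<close> is
  its member with index k + j.\<close>

definition mult_\<epsilon> :: "nat \<Rightarrow> 'a list \<Rightarrow> resvec" where
  "mult_\<epsilon> j xs = (\<lambda>i. int p ^ j * \<epsilon> xs i)"

definition quotient :: "nat \<Rightarrow> ('a \<times> resvec) monoid" where
  "quotient j = Ext P (R (N + j)) (cadd (R (N + j)) (pro_c (N + j) \<rho>) (mult_\<epsilon> j))"

definition cover :: "('a \<times> zpvec \<times> resvec) monoid" where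
  "cover = Ext P (prod_module T (R N)) (\<lambda>xs. (\<rho> xs, \<epsilon> xs))"

definition \<pi> :: "nat \<Rightarrow> 'a \<times> zpvec \<times> resvec \<Rightarrow> 'a \<times> resvec" where
  "\<pi> j = (\<lambda>(g, tw). (g, radd p (N + j) (proj (N + j) (fst tw)) (\<lambda>i. int p ^ j * snd tw i)))"

definition \<kappa> :: "nat \<Rightarrow> zpvec \<Rightarrow> 'a \<times> zpvec \<times> resvec" where
  "\<kappa> j t = (\<one>, (zscale p (- (int p ^ j)) t, proj N t))"

text \<open>The kernel embeddings \<open>\<kappa> j\<close> for different \<open>j\<close> have the
  same second component \<open>proj N t\<close>, so they differ by values of this inclusion of the
  first factor.\<close>

definition \<mu> :: "zpvec \<Rightarrow> 'a \<times> zpvec \<times> resvec" where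
  "\<mu> t = (\<one>, (t, \<lambda>i. 0))"

sublocale M: gmodule P "prod_module T (R N)"
  by (rule gmodule_prod[OF T.gmodule_axioms R.gmodule_axioms])

lemma M_simps [simp]:
  "mcarrier (prod_module T (R N)) = Tvec p d \<times> Rvec p d N"
  "madd (prod_module T (R N)) = (\<lambda>x y. (vadd p (fst x) (fst y), radd p N (snd x) (snd y)))"
  "mzero (prod_module T (R N)) = (\<lambda>i n. 0, \<lambda>i. 0)"
  "mact (prod_module T (R N)) x g = (act g (fst x), mact (R N) (snd x) g)"
  by (simp_all add: prod_module_def)

lemma cover_factor_set: "factor_set P (prod_module T (R N)) (\<lambda>xs. (\<rho> xs, \<epsilon> xs))"
  by (rule factor_set_prod[OF \<rho> \<epsilon>])

lemma group_cover: "group cover"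
  unfolding cover_def by (rule M.group_Ext[OF cover_factor_set])

lemma carrier_cover: "carrier cover = carrier P \<times> Tvec p d \<times> Rvec p d N"
  by (simp add: cover_def Ext_def)

lemma carrier_quotient: "carrier (quotient j) = carrier P \<times> Rvec p d (N + j)"
  by (simp add: quotient_def Ext_def)

lemma factor_set_mult: "factor_set P (R (N + j)) (mult_\<epsilon> j)"
proof -
  have "\<epsilon> [g, h] \<in> Rvec p d N" if "g \<in> carrier P" "h \<in> carrier P" for g h
    using R.factor_closed[OF \<epsilon> that] by simp
  moreover have "radd p N (\<epsilon> [h, k]) (\<epsilon> [g, h \<otimes> k]) = radd p N (\<epsilon> [g \<otimes> h, k]) (mact (R N) (\<epsilon> [g, h]) k)"
    if "g \<in> carrier P" "h \<in> carrier P" "k \<in> carrier P" for g h k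
    using R.factor_cocycle[OF \<epsilon> that] by simp
  ultimately show ?thesis
    using R.factor_one[OF \<epsilon>]
    by (simp add: factor_set_def mult_\<epsilon>_def mult_Rvec mult_radd[symmetric] mult_act[symmetric])
qed

lemma quotient_factor_set:
  "factor_set P (R (N + j)) (cadd (R (N + j)) (pro_c (N + j) \<rho>) (mult_\<epsilon> j))"
  by (rule factor_set_add[OF R.gmodule_axioms factor_set_pro[OF \<rho>] factor_set_mult])

lemma group_quotient: "group (quotient j)"
  unfolding quotient_def by (rule R.group_Ext[OF quotient_factor_set])

lemma \<pi>_hom: "\<pi> j \<in> hom cover (quotient j)"
  unfolding \<pi>_def cover_def quotient_def
proof (rule Ext_hom[OF M.gmodule_axioms R.gmodule_axioms cover_factor_set])
  let ?f = "\<lambda>x. radd p (N + j) (proj (N + j) (fst x)) (\<lambda>i. int p ^ j * snd x i)"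
  have cl: "proj (N + j) v \<in> mcarrier (R (N + j))" "(\<lambda>i. int p ^ j * r i) \<in> mcarrier (R (N + j))"
    if "v \<in> Tvec p d" "r \<in> Rvec p d N" for v r
    using that by (simp_all add: proj_closed mult_Rvec)
  show "?f \<in> mcarrier (prod_module T (R N)) \<rightarrow> mcarrier (R (N + j))"
    by (auto simp: radd_closed proj_closed mult_Rvec)
  show "?f (madd (prod_module T (R N)) u v) = madd (R (N + j)) (?f u) (?f v)"
    if "u \<in> mcarrier (prod_module T (R N))" "v \<in> mcarrier (prod_module T (R N))" for u v
  proof -
    have "fst u \<in> Tvec p d" "snd u \<in> Rvec p d N" "fst v \<in> Tvec p d" "snd v \<in> Rvec p d N"
      using that by auto
    note c = cl[OF this(1,2)] cl[OF this(3,4)]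
    show ?thesis
      using c by (simp add: proj_vadd mult_radd radd_radd_swap)
  qed
  show "?f (mact (prod_module T (R N)) u g) = mact (R (N + j)) (?f u) g"
    if "u \<in> mcarrier (prod_module T (R N))" "g \<in> carrier P" for u g
  proof -
    have u: "fst u \<in> Tvec p d" "snd u \<in> Rvec p d N" using that by auto
    then show ?thesis
      using R.act_add[OF that(2) cl[OF u]] that(2) by (simp add: proj_act mult_act)
  qed
  show "?f (\<rho> [g, h], \<epsilon> [g, h]) = cadd (R (N + j)) (pro_c (N + j) \<rho>) (mult_\<epsilon> j) [g, h]"
    for g h
    by (simp add: cadd_def pro_c_def mult_\<epsilon>_def)
qed

lemma \<pi>_surj: "carrier (quotient j) \<subseteq> \<pi> j ` carrier cover"
proof
  fix x assume "x \<in> carrier (quotient j)"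
  then have x: "fst x \<in> carrier P" "snd x \<in> Rvec p d (N + j)" by (auto simp: carrier_quotient)
  let ?y = "(fst x, (lift p (snd x), \<lambda>i. 0))"
  have "\<pi> j ?y = x"
    using x R.add_zero_right[of "snd x" "N + j"] by (simp add: \<pi>_def proj_lift)
  moreover have "?y \<in> carrier cover"
    using x by (simp add: carrier_cover lift_Rvec_closed zero_in_Rvec)
  ultimately show "x \<in> \<pi> j ` carrier cover" by (metis imageI)
qed

sublocale G: group_action_module cover "additive T" "\<lambda>t x. act (fst x) t"
proof -
  interpret cover: group cover by (rule group_cover)
  show "group_action_module cover (additive T) (\<lambda>t x. act (fst x) t)"
  proof
    fix x assume "x \<in> carrier cover"
    then show "(\<lambda>t. act (fst x) t) \<in> hom (additive T) (additive T)"
      using T.act_hom[of "fst x"] by (auto simp: carrier_cover)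
  next
    fix t and n :: nat
    assume t: "t \<in> carrier (additive T)" "0 < n" "t [^]\<^bsub>additive T\<^esub> n = \<one>\<^bsub>additive T\<^esub>"
    then have "zscale p (int n) t = (\<lambda>i n. 0)"
      using int_pow_T[of t "int n"] int_pow_int[of "additive T" t n] by simp
    then show "t = \<one>\<^bsub>additive T\<^esub>"
      using zscale_torsion_free[OF p_pos prime _ t(2), of t d] t(1) by simp
  qed
qed

lemma equivariant_inclusion:
  assumes "\<phi> \<in> hom (additive T) (additive (prod_module T (R N)))"
    and "\<And>t g. t \<in> Tvec p d \<Longrightarrow> g \<in> carrier P \<Longrightarrow> \<phi> (act g t) = mact (prod_module T (R N)) (\<phi> t) g"
  shows "G.equivariant (\<lambda>t. (\<one>, \<phi> t))"
  unfolding G.equivariant_def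
proof (intro conjI ballI)
  show "(\<lambda>t. (\<one>, \<phi> t)) \<in> hom (additive T) cover"
    using Group.hom_compose[OF assms(1) M.Ext_inclusion_hom[OF cover_factor_set]]
    by (simp add: cover_def comp_def)
  fix t a assume t: "t \<in> carrier (additive T)" and a: "a \<in> carrier cover"
  have "\<phi> t \<in> mcarrier (prod_module T (R N))"
    using assms(1) t by (auto simp: hom_def simp del: M_simps)
  then show "(\<one>, \<phi> t) \<otimes>\<^bsub>cover\<^esub> a = a \<otimes>\<^bsub>cover\<^esub> (\<one>, \<phi> (act (fst a) t))"
    using M.Ext_inclusion_act[OF cover_factor_set, of "\<phi> t" a] a t assms(2)[of t "fst a"]
    by (auto simp: cover_def[symmetric] carrier_cover)
qed

lemma equivariant_\<kappa>: "G.equivariant (\<kappa> j)"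
  unfolding \<kappa>_def
  by (rule equivariant_inclusion)
    (auto simp: hom_def zscale_closed proj_closed zscale_vadd proj_vadd proj_act act_zscale)

lemma equivariant_\<mu>: "G.equivariant \<mu>"
  unfolding \<mu>_def
  by (rule equivariant_inclusion) (use R.act_zero[of _ N] in \<open>auto simp: hom_def zero_in_Rvec radd_zero\<close>)

lemma inclusion_mult:
  assumes "x \<in> Tvec p d \<times> Rvec p d N" "y \<in> Tvec p d \<times> Rvec p d N"
  shows "(\<one>, x) \<otimes>\<^bsub>cover\<^esub> (\<one>, y) = (\<one>, madd (prod_module T (R N)) x y)"
  using hom_mult[OF M.Ext_inclusion_hom[OF cover_factor_set], of x y] assms
  by (simp add: cover_def)

lemma \<kappa>_\<mu>:
  assumes "t \<in> carrier (additive T)"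
  shows "\<kappa> j t = \<kappa> i t \<otimes>\<^bsub>cover\<^esub> \<mu> (t [^]\<^bsub>additive T\<^esub> (int p ^ i - int p ^ j))"
proof -
  have t: "t \<in> Tvec p d" using assms by simp
  let ?c = "int p ^ i - int p ^ j"
  have "zscale p (- (int p ^ i) + ?c) t = vadd p (zscale p (- (int p ^ i)) t) (zscale p ?c t)"
    by (rule zscale_add[OF p_pos])
  moreover have "radd p N (proj N t) (\<lambda>i. 0) = proj N t"
    using R.add_zero_right[of "proj N t" N] proj_closed[OF p_pos t] by simp
  ultimately show ?thesis
    using t by (simp add: \<kappa>_def \<mu>_def int_pow_T inclusion_mult zscale_closed proj_closed zero_in_Rvec)
qed

lemma \<kappa>_\<mu>_commute:
  assumes "s \<in> carrier (additive T)" "t \<in> carrier (additive T)"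
  shows "\<kappa> j s \<otimes>\<^bsub>cover\<^esub> \<mu> t = \<mu> t \<otimes>\<^bsub>cover\<^esub> \<kappa> j s"
proof -
  have "(zscale p (- (int p ^ j)) s, proj N s) \<in> Tvec p d \<times> Rvec p d N" "(t, \<lambda>i. 0) \<in> Tvec p d \<times> Rvec p d N"
    using assms by (simp_all add: zscale_closed proj_closed zero_in_Rvec)
  then show ?thesis
    unfolding \<kappa>_def \<mu>_def by (subst (1 2) inclusion_mult) (auto intro: vadd_comm radd_comm)
qed

lemma \<kappa>_inj: "inj_on (\<kappa> j) (carrier (additive T))"
proof (rule inj_onI)
  fix s t assume st: "s \<in> carrier (additive T)" "t \<in> carrier (additive T)" and "\<kappa> j s = \<kappa> j t"
  then have "zscale p (- (int p ^ j)) s = zscale p (- (int p ^ j)) t" by (simp add: \<kappa>_def)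
  then have "zscale p (- 1) (zscale p (- (int p ^ j)) s) = zscale p (- 1) (zscale p (- (int p ^ j)) t)"
    by simp
  then have "zscale p (int (p ^ j)) s = zscale p (int (p ^ j)) t"
    by (simp add: zscale_zscale)
  then have "s [^]\<^bsub>additive T\<^esub> (p ^ j) = t [^]\<^bsub>additive T\<^esub> (p ^ j)"
    using st by (simp only: int_pow_int[symmetric] int_pow_T additive_simps Tmod_simps)
  then show "s = t"
    using G.nat_pow_inject[OF st, of "p ^ j"] by simp
qed

lemma \<pi>_kernel:
  assumes "x \<in> carrier cover"
  shows "\<pi> j x = \<one>\<^bsub>quotient j\<^esub> \<longleftrightarrow> x \<in> \<kappa> j ` carrier (additive T)"
proof -
  obtain g t w where x: "x = (g, (t, w))" "g \<in> carrier P" "t \<in> Tvec p d" "w \<in> Rvec p d N"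
    using assms by (auto simp: carrier_cover)
  let ?J = "int p ^ j"
  have one: "\<one>\<^bsub>quotient j\<^esub> = (\<one>, \<lambda>i. 0)" by (simp add: quotient_def Ext_def)
  have mult: "(\<lambda>i. ?J * proj N v i) = proj (N + j) (zscale p ?J v)" if "v \<in> Tvec p d" for v
    using proj_zscale_mult[OF p_pos that] by simp
  show ?thesis
  proof
    assume "\<pi> j x = \<one>\<^bsub>quotient j\<^esub>"
    then have g: "g = \<one>" and 0: "radd p (N + j) (proj (N + j) t) (\<lambda>i. ?J * w i) = (\<lambda>i. 0)"
      by (simp_all add: \<pi>_def x(1) one)
    obtain v where v: "v \<in> Tvec p d" "w = proj N v" using Rvec_proj[OF x(4)] by blast
    have "proj (N + j) (vadd p t (zscale p ?J v)) = proj (N + j) (\<lambda>i n. 0)"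
      using 0 v by (simp add: mult proj_vadd) (simp add: proj_def)
    then obtain u where u: "u \<in> Tvec p d"
      "vadd p t (zscale p ?J v) = vadd p (\<lambda>i n. 0) (zscale p (int p ^ (N + j)) u)"
      using proj_eq_imp[OF p_pos, of "vadd p t (zscale p ?J v)" d "\<lambda>i n. 0" "N + j"] x v
      by (auto simp: vadd_closed zscale_closed zero_in_Tvec)
    \<comment> \<open>The equation t + p^j v = p^(N+j) u suggests s = v - p^N u: it still reduces to
      \<open>w\<close> modulo p^N, and -p^j s = t.\<close>
    define s where "s = vadd p v (zscale p (- (int p ^ N)) u)"
    have s: "s \<in> Tvec p d" using u v by (simp add: s_def vadd_closed zscale_closed)
    have "proj N s = w"
      using proj_zscale_power[OF p_pos, of N "-1" u] R.add_zero_right[of w N] x(4) v(2)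
      by (simp add: s_def proj_vadd)
    moreover have "zscale p (- ?J) s = t"
    proof -
      have "zscale p (- ?J) s = vadd p (zscale p (- ?J) v) (zscale p (int p ^ (N + j)) u)"
        by (simp add: s_def zscale_vadd zscale_zscale power_add mult.commute)
      also have "zscale p (int p ^ (N + j)) u = vadd p t (zscale p ?J v)"
        using u vadd_zero[OF p_pos zscale_closed[OF p_pos u(1)]] by simp
      also have "vadd p (zscale p (- ?J) v) (vadd p t (zscale p ?J v)) = t"
        using T.add_neg_cancel(1)[of "zscale p ?J v" t] x(3) v(1)
        by (simp add: zscale_closed zscale_minus vadd_comm[OF p_pos, of t "zscale p ?J v"])
      finally show ?thesis .
    qed
    ultimately show "x \<in> \<kappa> j ` carrier (additive T)"
      using s x g by (intro image_eqI[of _ _ s]) (simp_all add: \<kappa>_def)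
  next
    assume "x \<in> \<kappa> j ` carrier (additive T)"
    then obtain s where s: "s \<in> Tvec p d" "g = \<one>" "t = zscale p (- ?J) s" "w = proj N s"
      by (auto simp: \<kappa>_def x)
    have "vadd p t (zscale p ?J s) = (\<lambda>i n. 0)"
      using s by (simp add: zscale_minus vadd_vneg)
    then have "radd p (N + j) (proj (N + j) t) (\<lambda>i. ?J * w i) = proj (N + j) (\<lambda>i n. 0)"
      using s(1) by (simp add: s(4) mult proj_vadd[symmetric])
    then show "\<pi> j x = \<one>\<^bsub>quotient j\<^esub>"
      using s by (simp add: \<pi>_def x(1) one) (simp add: proj_def)
  qed
qed

end

section \<open>Lifting elementary abelian subgroups to the cover\<close>

context zp_cover
begin

text \<open>The section \<open>\<sigma>\<close> has M-component 0, so the M-component of a product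
  of two of its values is \<open>\<epsilon>\<close> alone. Comparison with the kernel element
  \<open>\<kappa> j u\<close> shows that \<open>u\<close> reduces modulo p^N to a value of
  \<open>\<epsilon>\<close>, and therefore is divisible by p^k.\<close>

lemma section_cocycle:
  assumes ab: "a \<in> carrier (quotient j)" "b \<in> carrier (quotient j)" and n: "n \<le> k"
  defines "\<sigma> \<equiv> \<lambda>x. (fst x, (lift p (snd x), \<lambda>i. 0))"
  shows "\<exists>z\<in>Tvec p d. \<sigma> a \<otimes>\<^bsub>cover\<^esub> \<sigma> b
    = \<sigma> (a \<otimes>\<^bsub>quotient j\<^esub> b) \<otimes>\<^bsub>cover\<^esub> \<kappa> j (z [^]\<^bsub>additive T\<^esub> (p ^ n))"
proof -
  interpret Q: group "quotient j" by (rule group_quotient)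
  interpret \<pi>: group_hom cover "quotient j" "\<pi> j"
    using \<pi>_hom by (simp add: group_hom_def group_hom_axioms_def group_cover Q.is_group)
  let ?c = "a \<otimes>\<^bsub>quotient j\<^esub> b"
  have \<sigma>: "\<sigma> x \<in> carrier cover" "\<pi> j (\<sigma> x) = x" if "x \<in> carrier (quotient j)" for x
  proof -
    have x: "fst x \<in> carrier P" "snd x \<in> Rvec p d (N + j)" using that by (auto simp: carrier_quotient)
    show "\<sigma> x \<in> carrier cover"
      using x by (simp add: \<sigma>_def carrier_cover lift_Rvec_closed zero_in_Rvec)
    show "\<pi> j (\<sigma> x) = x"
      using x R.add_zero_right[of "snd x" "N + j"] by (simp add: \<sigma>_def \<pi>_def proj_lift)
  qed
  have c: "?c \<in> carrier (quotient j)" using ab by simp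
  define r where "r = inv\<^bsub>cover\<^esub> \<sigma> ?c \<otimes>\<^bsub>cover\<^esub> (\<sigma> a \<otimes>\<^bsub>cover\<^esub> \<sigma> b)"
  have r: "r \<in> carrier cover" using \<sigma> ab c by (simp add: r_def)
  have "\<pi> j r = \<one>\<^bsub>quotient j\<^esub>" using \<sigma> ab c by (simp add: r_def)
  then obtain u where u: "u \<in> Tvec p d" "r = \<kappa> j u" using \<pi>_kernel[OF r] by auto
  have eq: "\<sigma> a \<otimes>\<^bsub>cover\<^esub> \<sigma> b = \<sigma> ?c \<otimes>\<^bsub>cover\<^esub> \<kappa> j u"
    using r_def[unfolded u(2)]
    by (rule iffD1[OF G.inv_solve_left, rotated 3]) (use r u \<sigma> ab c in auto)
  have P: "fst a \<in> carrier P" "fst b \<in> carrier P" "fst ?c = fst a \<otimes> fst b"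
    using ab by (auto simp: carrier_quotient quotient_def Ext_def split_beta)
  have "snd (snd (\<sigma> a \<otimes>\<^bsub>cover\<^esub> \<sigma> b)) = \<epsilon> [fst a, fst b]"
    using P R.act_zero[of "fst b" N] R.factor_closed[OF \<epsilon> P(1,2)]
    by (simp add: \<sigma>_def cover_def Ext_def radd_zero zero_in_Rvec)
  moreover have "snd (snd (\<sigma> ?c \<otimes>\<^bsub>cover\<^esub> \<kappa> j u)) = proj N u"
    using P u R.act_zero[of \<one> N] R.factor_one(2)[OF \<epsilon>, of "fst a \<otimes> fst b"]
      R.add_zero_right[of "proj N u" N] R.add_zero[of "proj N u" N]
    by (simp add: \<sigma>_def \<kappa>_def cover_def Ext_def radd_zero zero_in_Rvec proj_closed)
  ultimately have \<epsilon>u: "proj N u = \<epsilon> [fst a, fst b]" using eq by simp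
  have "u i k = 0" for i
  proof -
    have "u i k = u i N mod int p ^ k" using Tvec_mod[OF p_pos u(1) k_le] by simp
    also have "u i N = \<epsilon> [fst a, fst b] i" using fun_cong[OF \<epsilon>u, of i] by (simp add: proj_def)
    finally show ?thesis using \<epsilon>_dvd[OF P(1,2), of i] by simp
  qed
  then have "proj k u = (\<lambda>i. 0)" by (simp add: proj_def)
  note v = divp_closed_scale[OF p_pos u(1) this]
  \<comment> \<open>Only the factor p^n is to be split off, while p^k divides \<open>u\<close>; the
    surplus p^(k-n) goes into the witness.\<close>
  let ?z = "zscale p (int p ^ (k - n)) (divp p k u)"
  have z: "?z \<in> Tvec p d" using v(1) by (simp add: zscale_closed)
  have "int (p ^ n) * int p ^ (k - n) = int p ^ k" using n by (simp add: power_add[symmetric])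
  then have "?z [^]\<^bsub>additive T\<^esub> (p ^ n) = u"
    using v(2) int_pow_T[OF z, of "int (p ^ n)"] by (simp add: zscale_zscale int_pow_int del: of_nat_power)
  then show ?thesis using z eq by metis
qed

lemma elem_ab_quotient:
  assumes "elem_ab_p_subgroup p (quotient j) E"
  obtains n where "finite E" "n \<le> m + d" "card E = p ^ n"
  using elem_ab_card[OF quotient_factor_set _ finite_P card_P assms[unfolded quotient_def]] N_pos
  by auto

text \<open>The order of \<open>E\<close> is p^n with n at most m + d, hence at most k: here the
  choice of the reference member pays off.\<close>

lemma elem_ab_section:
  assumes E: "elem_ab_p_subgroup p (quotient j) E"
  shows "\<exists>\<sigma>\<in>E \<rightarrow> carrier cover. \<exists>z. (\<forall>a\<in>E. \<pi> j (\<sigma> a) = a) \<and>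
    (\<forall>a\<in>E. \<forall>b\<in>E. z a b \<in> carrier (additive T) \<and> \<sigma> a \<otimes>\<^bsub>cover\<^esub> \<sigma> b
      = \<sigma> (a \<otimes>\<^bsub>quotient j\<^esub> b) \<otimes>\<^bsub>cover\<^esub> \<kappa> j (z a b [^]\<^bsub>additive T\<^esub> card E))"
proof -
  let ?\<sigma> = "\<lambda>x :: 'a \<times> resvec. (fst x, (lift p (snd x), \<lambda>i. 0 :: int))"
  have sub: "E \<subseteq> carrier (quotient j)" using elem_ab_p_subgroupD[OF E] by simp
  obtain n where n: "n \<le> m + d" "card E = p ^ n" using elem_ab_quotient[OF E] by metis
  have E': "fst x \<in> carrier P" "snd x \<in> Rvec p d (N + j)" if "x \<in> E" for x
    using that sub by (auto simp: carrier_quotient)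
  have "\<forall>a\<in>E. \<forall>b\<in>E. \<exists>z. z \<in> Tvec p d \<and> ?\<sigma> a \<otimes>\<^bsub>cover\<^esub> ?\<sigma> b
      = ?\<sigma> (a \<otimes>\<^bsub>quotient j\<^esub> b) \<otimes>\<^bsub>cover\<^esub> \<kappa> j (z [^]\<^bsub>additive T\<^esub> card E)"
  proof (intro ballI)
    fix a b assume "a \<in> E" "b \<in> E"
    then have ab: "a \<in> carrier (quotient j)" "b \<in> carrier (quotient j)" using sub by auto
    show "\<exists>z. z \<in> Tvec p d \<and> ?\<sigma> a \<otimes>\<^bsub>cover\<^esub> ?\<sigma> b
      = ?\<sigma> (a \<otimes>\<^bsub>quotient j\<^esub> b) \<otimes>\<^bsub>cover\<^esub> \<kappa> j (z [^]\<^bsub>additive T\<^esub> card E)"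
      using section_cocycle[OF ab order_trans[OF n(1) k_ge]] unfolding n(2) by blast
  qed
  then have "\<forall>a\<in>E. \<exists>z. \<forall>b\<in>E. z b \<in> Tvec p d \<and> ?\<sigma> a \<otimes>\<^bsub>cover\<^esub> ?\<sigma> b
      = ?\<sigma> (a \<otimes>\<^bsub>quotient j\<^esub> b) \<otimes>\<^bsub>cover\<^esub> \<kappa> j (z b [^]\<^bsub>additive T\<^esub> card E)"
    by (intro ballI, intro bchoice) blast
  from bchoice[OF this] obtain z where "\<forall>a\<in>E. \<forall>b\<in>E. z a b \<in> Tvec p d \<and> ?\<sigma> a \<otimes>\<^bsub>cover\<^esub> ?\<sigma> b
      = ?\<sigma> (a \<otimes>\<^bsub>quotient j\<^esub> b) \<otimes>\<^bsub>cover\<^esub> \<kappa> j (z a b [^]\<^bsub>additive T\<^esub> card E)"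
    by blast
  moreover have "\<pi> j (?\<sigma> x) = x" if "x \<in> E" for x
    using E'[OF that] R.add_zero_right[of "snd x" "N + j"] by (simp add: \<pi>_def proj_lift)
  moreover have "?\<sigma> \<in> E \<rightarrow> carrier cover"
    using E' lift_Rvec_closed[OF p_pos, where d = d and N = "N + j"]
    by (intro Pi_I) (simp add: carrier_cover zero_in_Rvec)
  ultimately show ?thesis by (intro bexI[of _ ?\<sigma>] exI[of _ z]) auto
qed

theorem quotients_equivalent:
  assumes "m + d \<le> i" "m + d \<le> j"
  shows "cat_equivalent (quillen p (quotient i)) (quillen p (quotient j))"
proof (rule G.quillen_equivalent_of_kernels[OF group_quotient group_quotient \<pi>_hom \<pi>_hom
      \<pi>_surj \<pi>_surj equivariant_\<kappa> equivariant_\<kappa> equivariant_\<mu> \<kappa>_\<mu> \<pi>_kernel \<pi>_kernel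
      \<kappa>_inj \<kappa>_inj \<kappa>_\<mu>_commute \<kappa>_\<mu>_commute p_pos _ elem_ab_section elem_ab_section])
  fix E assume E: "elem_ab_p_subgroup p (quotient i) E"
  obtain n where n: "finite E" "n \<le> m + d" "card E = p ^ n" using elem_ab_quotient[OF E] .
  \<comment> \<open>Both exponents are at least m + d, so the order p^n divides each of the two
    powers.\<close>
  then have "int (card E) dvd int p ^ i - int p ^ j"
    using assms by (auto intro!: dvd_diff le_imp_power_dvd)
  then show "finite E \<and> int (card E) dvd int p ^ i - int p ^ j" using n by simp
next
  fix E assume E: "elem_ab_p_subgroup p (quotient j) E"
  show "finite E" using elem_ab_quotient[OF E] .
qed

end

section \<open>The connecting homomorphism\<close>

lemma length_3_conv: "length xs = 3 \<longleftrightarrow> (\<exists>a b c. xs = [a, b, c])"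
  by (auto simp: numeral_3_eq_3 length_Suc_conv)

lemma cobound_2_outside:
  assumes "\<nexists>g h k. xs = [g, h, k] \<and> g \<in> carrier P \<and> h \<in> carrier P \<and> k \<in> carrier P"
  shows "cobound P M 2 f xs = mzero M"
  using assms by (auto simp: cobound_def length_3_conv)

section \<open>Coboundaries of 2-cochains\<close>

context gmodule
begin

lemma cochains_closed: "f \<in> cochains P M n \<Longrightarrow> f xs \<in> mcarrier M"
  by (cases "length xs = n \<and> set xs \<subseteq> carrier P") (auto simp: cochains_def)

lemma cochains_cadd:
  assumes "f \<in> cochains P M n" "h \<in> cochains P M n"
  shows "cadd M f h \<in> cochains P M n"
  using assms by (simp add: cochains_def cadd_def)

lemma neg_zero [simp]: "mneg M (mzero M) = mzero M"
  using add_neg_right[of "mzero M"] add_zero[of "mneg M (mzero M)"] by simp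

lemma cochains_neg:
  assumes "f \<in> cochains P M n"
  shows "(\<lambda>xs. mneg M (f xs)) \<in> cochains P M n"
  using assms by (simp add: cochains_def)

lemma neg_add:
  "u \<in> mcarrier M \<Longrightarrow> v \<in> mcarrier M \<Longrightarrow> mneg M (madd M u v) = madd M (mneg M u) (mneg M v)"
  using A.inv_mult[of u v] by (simp add: inv_additive)

lemma neg_neg [simp]: "u \<in> mcarrier M \<Longrightarrow> mneg M (mneg M u) = u"
  using A.inv_inv[of u] by (simp add: inv_additive)

lemma cobound_2_cadd:
  assumes "f \<in> cochains P M 2" "h \<in> cochains P M 2"
  shows "cobound P M 2 (cadd M f h) = cadd M (cobound P M 2 f) (cobound P M 2 h)"
proof
  fix xs
  show "cobound P M 2 (cadd M f h) xs = cadd M (cobound P M 2 f) (cobound P M 2 h) xs"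
  proof (cases "\<exists>a b c. xs = [a, b, c] \<and> a \<in> carrier P \<and> b \<in> carrier P \<and> c \<in> carrier P")
    case True
    then obtain a b c where xs: "xs = [a, b, c]" and c: "a \<in> carrier P" "b \<in> carrier P" "c \<in> carrier P"
      by blast
    note cl = cochains_closed[OF assms(1)] cochains_closed[OF assms(2)]
    show ?thesis
      unfolding xs cobound_2[OF cochains_cadd[OF assms] c]
      unfolding cadd_def cobound_2[OF assms(1) c] cobound_2[OF assms(2) c]
      using c cl by (simp add: act_add neg_add add_ac)
  next
    case False
    show ?thesis unfolding cadd_def cobound_2_outside[OF False] by simp
  qed
qed

lemma cobound_2_neg:
  assumes "f \<in> cochains P M 2"
  shows "cobound P M 2 (\<lambda>xs. mneg M (f xs)) = (\<lambda>xs. mneg M (cobound P M 2 f xs))"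
proof
  fix xs
  show "cobound P M 2 (\<lambda>xs. mneg M (f xs)) xs = mneg M (cobound P M 2 f xs)"
  proof (cases "\<exists>a b c. xs = [a, b, c] \<and> a \<in> carrier P \<and> b \<in> carrier P \<and> c \<in> carrier P")
    case True
    then obtain a b c where xs: "xs = [a, b, c]" and c: "a \<in> carrier P" "b \<in> carrier P" "c \<in> carrier P"
      by blast
    show ?thesis
      unfolding xs cobound_2[OF cochains_neg[OF assms] c] cobound_2[OF assms c]
      using c cochains_closed[OF assms] by (simp add: act_neg neg_add)
  next
    case False
    show ?thesis unfolding cobound_2_outside[OF False] by simp
  qed
qed

lemma cobound_2_closed:
  assumes "f \<in> cochains P M 2"
  shows "cobound P M 2 f xs \<in> mcarrier M"
proof (cases "\<exists>a b c. xs = [a, b, c] \<and> a \<in> carrier P \<and> b \<in> carrier P \<and> c \<in> carrier P")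
  case True
  then show ?thesis using cobound_2[OF assms] cochains_closed[OF assms] by auto
next
  case False
  show ?thesis unfolding cobound_2_outside[OF False] by simp
qed

text \<open>The zero cochain puts the representative into its own class; so members of
  \<open>cohom\<close> are nonempty and an element can be picked from them.\<close>

lemma cohom_class_3_self:
  assumes "z \<in> cocycles P M 3"
  shows "z \<in> cohom_class P M 3 z"
proof -
  let ?b = "cobound P M 2 (czero M)"
  have 0: "czero M \<in> cochains P M 2" by (simp add: cochains_def czero_def)
  have "?b xs = mzero M" for xs
  proof (cases "\<exists>a b c. xs = [a, b, c] \<and> a \<in> carrier P \<and> b \<in> carrier P \<and> c \<in> carrier P")
    case True
    then show ?thesis using cobound_2[OF 0] by (auto simp: czero_def)
  qed (rule cobound_2_outside)
  moreover have "z xs \<in> mcarrier M" for xs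
    using assms cochains_closed[of z 3] by (simp add: cocycles_def)
  ultimately have "z = cadd M z ?b" by (simp add: cadd_def)
  moreover have "?b \<in> coboundaries P M 3"
    using 0 by (simp add: coboundaries_def numeral_3_eq_3 numeral_2_eq_2)
  ultimately show ?thesis using assms unfolding cohom_class_def by blast
qed

end

section \<open>Compatibility with \<open>mul_c\<close> and injectivity on the complement\<close>

context zp_module
begin

lemma lift_zero [simp]: "lift p (\<lambda>i. 0) = (\<lambda>i n. 0)"
  by (simp add: lift_def)

lemma proj_zero [simp]: "proj N (\<lambda>i n. 0) = (\<lambda>i. 0)"
  by (simp add: proj_def)

lemma cochains_lift:
  assumes "f \<in> cochains P (Rmod p d act N) n"
  shows "(\<lambda>xs. lift p (f xs)) \<in> cochains P (Tmod p d act) n"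
  using assms by (auto simp: cochains_def lift_Rvec_closed[OF p_pos, where d = d and N = N])

lemma cochains_zscale:
  assumes "f \<in> cochains P (Tmod p d act) n"
  shows "(\<lambda>xs. zscale p c (f xs)) \<in> cochains P (Tmod p d act) n"
proof -
  have "zscale p c (\<lambda>i n. 0) = (\<lambda>i n. 0)" by (simp add: zscale_def)
  then show ?thesis using assms by (simp add: cochains_def zscale_closed)
qed

lemma cobound_2_zscale:
  assumes "f \<in> cochains P (Tmod p d act) 2"
  shows "cobound P (Tmod p d act) 2 (\<lambda>xs. zscale p c (f xs)) xs
    = zscale p c (cobound P (Tmod p d act) 2 f xs)"
proof (cases "\<exists>g h k. xs = [g, h, k] \<and> g \<in> carrier P \<and> h \<in> carrier P \<and> k \<in> carrier P")
  case True
  then obtain g h k where xs: "xs = [g, h, k]" and ghk: "g \<in> carrier P" "h \<in> carrier P" "k \<in> carrier P"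
    by blast
  show ?thesis
    unfolding xs T.cobound_2[OF cochains_zscale[OF assms] ghk] T.cobound_2[OF assms ghk]
    using ghk T.cochains_closed[OF assms] by (simp add: act_zscale zscale_vadd zscale_vneg)
next
  case False
  have "zscale p c (\<lambda>i n. 0) = (\<lambda>i n. 0)" by (simp add: zscale_def)
  then show ?thesis unfolding cobound_2_outside[OF False] by simp
qed

lemma proj_cobound_2:
  assumes "f \<in> cochains P (Tmod p d act) 2" "h \<in> cochains P (Rmod p d act N) 2"
    and "\<And>xs. proj N (f xs) = h xs"
  shows "proj N (cobound P (Tmod p d act) 2 f xs) = cobound P (Rmod p d act N) 2 h xs"
proof (cases "\<exists>g h k. xs = [g, h, k] \<and> g \<in> carrier P \<and> h \<in> carrier P \<and> k \<in> carrier P")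
  case True
  then obtain a b c where xs: "xs = [a, b, c]" and abc: "a \<in> carrier P" "b \<in> carrier P" "c \<in> carrier P"
    by blast
  show ?thesis
    unfolding xs T.cobound_2[OF assms(1) abc] R.cobound_2[OF assms(2) abc]
    using abc T.cochains_closed[OF assms(1)]
    by (simp add: proj_vadd proj_vneg proj_act assms(3)[symmetric])
next
  case False
  then show ?thesis unfolding cobound_2_outside[OF False] by simp
qed

text \<open>A lift of a cocycle modulo p^N satisfies the cocycle condition up to p^N T, so
  \<open>divp\<close> in the definition of \<open>conn\<close> is a true division.\<close>

lemma cobound_lift_divisible:
  assumes "f \<in> cocycles P (Rmod p d act N) 2"
  fixes xs
  defines "D \<equiv> cobound P (Tmod p d act) 2 (\<lambda>ys. lift p (f ys)) xs"
  shows "D = zscale p (int p ^ N) (divp p N D)" and "divp p N D \<in> Tvec p d"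
proof -
  have f: "f \<in> cochains P (Rmod p d act N) 2" using assms by (simp add: cocycles_def)
  have "proj N (lift p (f ys)) = f ys" for ys
    using R.cochains_closed[OF f, of ys] by (simp add: proj_lift)
  then have "proj N D = cobound P (Rmod p d act N) 2 f xs"
    unfolding D_def using proj_cobound_2[OF cochains_lift[OF f] f] by simp
  then have 0: "proj N D = (\<lambda>i. 0)" using assms(1) by (simp add: cocycles_def czero_def)
  have D: "D \<in> Tvec p d" unfolding D_def using T.cobound_2_closed[OF cochains_lift[OF f]] by simp
  show "D = zscale p (int p ^ N) (divp p N D)" "divp p N D \<in> Tvec p d"
    using divp_closed_scale[OF p_pos D 0] by auto
qed

text \<open>Lifting turns \<open>mul_c\<close> into multiplication by \<open>p\<close>, which
  dividing by p^(N+1) in place of p^N undoes. The two representing cochains agree, not only their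
  classes.\<close>

lemma conn_mul_c:
  assumes f: "f \<in> cocycles P (Rmod p d act N) 2"
  shows "conn P p d act (Suc N) (mul_c p f) = conn P p d act N f"
proof -
  have f': "f \<in> cochains P (Rmod p d act N) 2" using f by (simp add: cocycles_def)
  have "lift p (mul_c p f ys) = zscale p (int p) (lift p (f ys))" for ys
    by (simp add: lift_def mul_c_def rmul_def zscale_def mod_simps fun_eq_iff)
  then have eq: "cobound P (Tmod p d act) 2 (\<lambda>ys. lift p (mul_c p f ys)) xs
      = zscale p (int p) (cobound P (Tmod p d act) 2 (\<lambda>ys. lift p (f ys)) xs)" for xs
    using cobound_2_zscale[OF cochains_lift[OF f']] by simp
  have "divp p (Suc N) (zscale p (int p) v) = divp p N v" if v: "v \<in> Tvec p d" for v
  proof (intro ext)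
    fix i n
    have "int p * v i (Suc (n + N)) mod int p ^ Suc (n + N) = int p * (v i (Suc (n + N)) mod int p ^ (n + N))"
      by (metis mult_mod_right power_Suc)
    also have "v i (Suc (n + N)) mod int p ^ (n + N) = v i (n + N)"
      using Tvec_mod[OF p_pos v, of "n + N" "Suc (n + N)"] by simp
    finally have "int p * v i (Suc (n + N)) mod int p ^ Suc (n + N) div int p ^ Suc N
        = (int p * v i (n + N)) div (int p * int p ^ N)"
      by (simp only: power_Suc)
    also have "\<dots> = v i (n + N) div int p ^ N" by (rule div_mult_mult1) simp
    finally show "divp p (Suc N) (zscale p (int p) v) i n = divp p N v i n"
      by (simp only: divp_def zscale_def add_Suc_right)
  qed
  then have "divp p (Suc N) (cobound P (Tmod p d act) 2 (\<lambda>ys. lift p (mul_c p f ys)) xs)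
      = divp p N (cobound P (Tmod p d act) 2 (\<lambda>ys. lift p (f ys)) xs)" for xs
    unfolding eq using T.cobound_2_closed[OF cochains_lift[OF f'], of xs] by simp
  then show ?thesis by (simp add: conn_def)
qed

text \<open>If \<open>f\<close> and \<open>h\<close> have the same image under the connecting homomorphism,
  correcting the difference of their lifts by \<open>p ^ N\<close> times a cochain gives a cocycle.\<close>
lemma conn_eq_imp:
  assumes f: "f \<in> cocycles P (Rmod p d act N) 2" and h: "h \<in> cocycles P (Rmod p d act N) 2"
    and eq: "conn P p d act N f = \<eta>" "conn P p d act N h = \<eta>"
    and \<eta>: "\<eta> \<in> cohom P (Tmod p d act) 3"
  shows "cadd (Rmod p d act N) f (\<lambda>xs. mneg (Rmod p d act N) (h xs))
    \<in> pro_c N ` cocycles P (Tmod p d act) 2"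
proof -
  let ?T = "Tmod p d act" and ?R = "Rmod p d act N" and ?q = "int p ^ N"
  let ?\<delta> = "cobound P ?T 2"
  let ?F = "\<lambda>ys. lift p (f ys)" and ?H = "\<lambda>ys. lift p (h ys)"
  \<comment> \<open>A common element of both classes. Each cochain is compared with
    \<open>z\<close>, which replaces an argument about symmetry and transitivity of being
    cohomologous.\<close>
  obtain z where z: "z \<in> \<eta>"
    using \<eta> T.cohom_class_3_self unfolding cohom_def by blast
  have cob: "\<exists>c\<in>cochains P ?T 2. z = cadd ?T (\<lambda>xs. divp p N (?\<delta> (\<lambda>ys. lift p (f ys)) xs)) (?\<delta> c)"
    if "conn P p d act N f = \<eta>" for f
  proof -
    have "z \<in> conn P p d act N f" using z that by simp
    then obtain b where "b \<in> coboundaries P ?T 3"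
      "z = cadd ?T (\<lambda>xs. divp p N (?\<delta> (\<lambda>ys. lift p (f ys)) xs)) b"
      unfolding conn_def cohom_class_def by blast
    then show ?thesis by (auto simp: coboundaries_def numeral_3_eq_3 numeral_2_eq_2)
  qed
  obtain a where a: "a \<in> cochains P ?T 2" "z = cadd ?T (\<lambda>xs. divp p N (?\<delta> ?F xs)) (?\<delta> a)"
    using cob[OF eq(1)] by blast
  obtain b where b: "b \<in> cochains P ?T 2" "z = cadd ?T (\<lambda>xs. divp p N (?\<delta> ?H xs)) (?\<delta> b)"
    using cob[OF eq(2)] by blast
  have f': "f \<in> cochains P ?R 2" and h': "h \<in> cochains P ?R 2"
    using f h by (simp_all add: cocycles_def)
  have FH: "?F \<in> cochains P ?T 2" "?H \<in> cochains P ?T 2"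
    using cochains_lift f' h' by auto
  \<comment> \<open>The corrections by p^N a and p^N b give both lifts the same coboundary p^N z,
    and they vanish on reduction modulo p^N.\<close>
  let ?u = "cadd ?T ?F (\<lambda>xs. zscale p ?q (a xs))" and ?v = "cadd ?T ?H (\<lambda>xs. zscale p ?q (b xs))"
  have uv: "?u \<in> cochains P ?T 2" "?v \<in> cochains P ?T 2"
    using T.cochains_cadd cochains_zscale FH a(1) b(1) by auto
  have "?\<delta> ?u xs = zscale p ?q (z xs)" for xs
  proof -
    have "?\<delta> ?u xs = vadd p (?\<delta> ?F xs) (zscale p ?q (?\<delta> a xs))"
      using T.cobound_2_cadd[OF FH(1) cochains_zscale[OF a(1)]]
      by (simp add: cobound_2_zscale[OF a(1)]) (simp add: cadd_def cobound_2_zscale[OF a(1)])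
    then show ?thesis
      using cobound_lift_divisible(1)[OF f, of xs] by (simp add: a(2) cadd_def zscale_vadd)
  qed
  moreover have "?\<delta> ?v xs = zscale p ?q (z xs)" for xs
  proof -
    have "?\<delta> ?v xs = vadd p (?\<delta> ?H xs) (zscale p ?q (?\<delta> b xs))"
      using T.cobound_2_cadd[OF FH(2) cochains_zscale[OF b(1)]]
      by (simp add: cobound_2_zscale[OF b(1)]) (simp add: cadd_def cobound_2_zscale[OF b(1)])
    then show ?thesis
      using cobound_lift_divisible(1)[OF h, of xs] by (simp add: b(2) cadd_def zscale_vadd)
  qed
  ultimately have \<delta>uv: "?\<delta> ?u xs = ?\<delta> ?v xs" for xs by simp
  let ?w = "cadd ?T ?u (\<lambda>xs. mneg ?T (?v xs))"
  have "?w \<in> cochains P ?T 2"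
    using T.cochains_cadd T.cochains_neg uv by blast
  moreover have "?\<delta> ?w = czero ?T"
  proof
    fix xs
    have "?\<delta> ?w xs = madd ?T (?\<delta> ?u xs) (mneg ?T (?\<delta> ?v xs))"
      using T.cobound_2_cadd[OF uv(1) T.cochains_neg[OF uv(2)]] T.cobound_2_neg[OF uv(2)]
      by (simp add: cadd_def)
    also have "\<dots> = mzero ?T"
      using T.add_neg_right[of "?\<delta> ?v xs"] T.cobound_2_closed[OF uv(2)] \<delta>uv by simp
    finally show "?\<delta> ?w xs = czero ?T xs" by (simp add: czero_def)
  qed
  ultimately have w: "?w \<in> cocycles P ?T 2" by (simp add: cocycles_def)
  have "pro_c N ?w = cadd ?R f (\<lambda>xs. mneg ?R (h xs))"
  proof
    fix xs
    have fh: "f xs \<in> Rvec p d N" "h xs \<in> Rvec p d N"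
      using R.cochains_closed[OF f'] R.cochains_closed[OF h'] by auto
    have "proj N (?u xs) = f xs" "proj N (?v xs) = h xs"
      using R.add_zero_right[of "f xs" N] R.add_zero_right[of "h xs" N] fh
        proj_zscale_power[OF p_pos, of N 1 "a xs"] proj_zscale_power[OF p_pos, of N 1 "b xs"]
      by (simp_all add: cadd_def proj_vadd proj_lift)
    then show "pro_c N ?w xs = cadd ?R f (\<lambda>xs. mneg ?R (h xs)) xs"
      unfolding pro_c_def cadd_def[of _ f] cadd_def[of _ ?u]
      by (simp only: Tmod_simps Rmod_simps proj_vadd[OF p_pos] proj_vneg[OF p_pos])
  qed
  from imageI[OF w, of "pro_c N", unfolded this] show ?thesis .
qed

text \<open>The difference of two elements of \<open>K\<close> with equal image lies in the image of
  \<open>pro_c\<close> by \<open>conn_eq_imp\<close>, and also in \<open>K\<close>; hence it is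
  zero. This is the injectivity of the map from K to H^3(P,T).\<close>

lemma complement_eq:
  assumes K: "K \<subseteq> cocycles P (Rmod p d act N) 2"
      "\<And>f h. f \<in> K \<Longrightarrow> h \<in> K \<Longrightarrow> cadd (Rmod p d act N) f h \<in> K"
      "\<And>f. f \<in> K \<Longrightarrow> (\<lambda>xs. mneg (Rmod p d act N) (f xs)) \<in> K"
      "pro_c N ` cocycles P (Tmod p d act) 2 \<inter> K = {czero (Rmod p d act N)}"
    and fh: "f \<in> K" "h \<in> K"
    and eq: "conn P p d act N f = \<eta>" "conn P p d act N h = \<eta>"
    and \<eta>: "\<eta> \<in> cohom P (Tmod p d act) 3"
  shows "f = h"
proof
  fix xs
  have coc: "f \<in> cocycles P (Rmod p d act N) 2" "h \<in> cocycles P (Rmod p d act N) 2"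
    using K(1) fh by auto
  have "cadd (Rmod p d act N) f (\<lambda>xs. mneg (Rmod p d act N) (h xs)) = czero (Rmod p d act N)"
    using conn_eq_imp[OF coc eq \<eta>] K(2)[OF fh(1) K(3)[OF fh(2)]] K(4) by blast
  from fun_cong[OF this, of xs]
  have 0: "madd (Rmod p d act N) (f xs) (mneg (Rmod p d act N) (h xs)) = mzero (Rmod p d act N)"
    by (simp add: cadd_def czero_def)
  have "f xs \<in> mcarrier (Rmod p d act N)" "h xs \<in> mcarrier (Rmod p d act N)"
    using coc R.cochains_closed unfolding cocycles_def by blast+
  then show "f xs = h xs"
    using 0 R.add_eq_zero_iff[of "f xs" N "mneg (Rmod p d act N) (h xs)"] R.neg_neg
    by (metis R.neg_closed)
qed

end

theorem theorem1p1:
  fixes p m d :: nat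
    and P :: "('g, 'c) monoid_scheme"
    and act :: "'g \<Rightarrow> zpvec \<Rightarrow> zpvec"
    and \<rho> :: "'g list \<Rightarrow> zpvec"
    and K :: "nat \<Rightarrow> ('g list \<Rightarrow> resvec) set"
    and \<eta> :: "('g list \<Rightarrow> zpvec) set"
    and etas :: "nat \<Rightarrow> ('g list \<Rightarrow> resvec)"
  assumes "coclass_setting p P m d act \<rho>"
    and "complement_choice p P m d act K"
    and "\<eta> \<in> cohom P (Tmod p d act) 3"
    and "\<forall>x. etas x \<in> K x \<and> conn P p d act (x + 3 * m) (etas x) = \<eta>"
  shows "\<exists>x0::nat. \<forall>x y. x0 \<le> x \<longrightarrow> x0 \<le> y \<longrightarrow>
           cat_equivalent (quillen p (family_member p P m d act \<rho> etas x))
                          (quillen p (family_member p P m d act \<rho> etas y))"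
proof -
  have setting: "prime p" "group P" "finite (carrier P)" "card (carrier P) = p ^ m"
    "is_pmodule P (Tmod p d act)" "\<rho> \<in> cocycles P (Tmod p d act) 2"
    using assms(1) by (simp_all add: coclass_setting_def)
  interpret group P by fact
  interpret zp_module P p d act by unfold_locales (use setting in auto)
  have K: "K x \<subseteq> cocycles P (Rmod p d act (x + 3 * m)) 2"
    "\<And>f h. f \<in> K x \<Longrightarrow> h \<in> K x \<Longrightarrow> cadd (Rmod p d act (x + 3 * m)) f h \<in> K x"
    "\<And>f. f \<in> K x \<Longrightarrow> (\<lambda>xs. mneg (Rmod p d act (x + 3 * m)) (f xs)) \<in> K x"
    "pro_c (x + 3 * m) ` cocycles P (Tmod p d act) 2 \<inter> K x = {czero (Rmod p d act (x + 3 * m))}"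
    "mul_c p ` K x = K (Suc x)" for x
    using assms(2) unfolding complement_choice_def Let_def by simp_all
  have etas: "etas x \<in> K x" "conn P p d act (x + 3 * m) (etas x) = \<eta>" for x
    using assms(4) by auto
  \<comment> \<open>Multiplication by \<open>p\<close> maps \<open>K x\<close> into
    \<open>K (Suc x)\<close> and preserves the image \<eta>; uniqueness in \<open>K (Suc x)\<close>
    then identifies the result.\<close>
  have etas_Suc: "etas (Suc x) = mul_c p (etas x)" for x
  proof (rule complement_eq[OF K(1-4) etas(1) _ etas(2) _ assms(3)])
    show "mul_c p (etas x) \<in> K (Suc x)" using K(5) etas(1) by blast
    show "conn P p d act (Suc x + 3 * m) (mul_c p (etas x)) = \<eta>"
      using conn_mul_c[of "etas x" "x + 3 * m"] K(1) etas by auto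
  qed
  have etas_add: "etas (x + j) xs = (\<lambda>i. int p ^ j * etas x xs i)" for x j xs
    by (induction j) (simp_all add: etas_Suc mul_c_def rmul_def mult.assoc)
  \<comment> \<open>The exponent of an elementary abelian order is at most m + d; the successor
    makes the level k + 3 m positive even for m = d = 0.\<close>
  define k where "k = Suc (m + d)"
  interpret zp_cover P p d act \<rho> "etas k" "k + 3 * m" k m
  proof unfold_locales
    show "factor_set P (Tmod p d act) \<rho>" using T.factor_set_of_cocycle setting(6) .
    show "factor_set P (Rmod p d act (k + 3 * m)) (etas k)"
      using R.factor_set_of_cocycle K(1) etas(1) by blast
    \<comment> \<open>\<open>etas k\<close> is p^k times \<open>etas 0\<close>, by
      \<open>etas_add\<close> starting at index 0.\<close>
    show "int p ^ k dvd etas k [g, h] i" for g h i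
      using etas_add[of 0 k "[g, h]"] by simp
  qed (use setting in \<open>auto simp: k_def\<close>)
  have member: "family_member p P m d act \<rho> etas (k + j) = quotient j" for j
  proof -
    have "mult_\<epsilon> j = etas (k + j)" by (rule ext) (simp add: mult_\<epsilon>_def etas_add)
    moreover have "k + j + 3 * m = k + 3 * m + j" by simp
    ultimately show ?thesis by (simp only: family_member_def Let_def quotient_def)
  qed
  \<comment> \<open>Index \<open>x\<close> belongs to the quotient \<open>x - k\<close>, and this
    difference has to be at least m + d.\<close>
  have "cat_equivalent (quillen p (family_member p P m d act \<rho> etas x))
      (quillen p (family_member p P m d act \<rho> etas y))"
    if "k + (m + d) \<le> x" "k + (m + d) \<le> y" for x y
    using quotients_equivalent[of "x - k" "y - k"] that member[of "x - k"] member[of "y - k"] by simp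
  then show ?thesis by blast
qed

end
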